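(* Let $(R,\mathfrak m)$ be an absolutely Koszul noetherian local ring and let $x\in\mathfrak m\setminus\mathfrak m^2$ be such that the residue class $\overline{x}\in\mathfrak m/\mathfrak m^2$ is $\operatorname{gr}_{\mathfrak m}R$-regular (i.e. a nonzerodivisor on $\operatorname{gr}_{\mathfrak m}R$). Then $R/(x)$ is also absolutely Koszul.
   Context: Rings are commutative noetherian local rings; statements are also meant to cover, with the obvious changes, the graded situation (standard graded algebras over a field $k$, graded modules). $\operatorname{gr}_{\mathfrak m}R=\bigoplus_{i\ge 0}\mathfrak m^i/\mathfrak m^{i+1}$ is the associated graded ring. Linearity defect: for a finitely generated module $M$ over $(R,\mathfrak m)$ with minimal free resolution $F$, filter $F$ by the subcomplexes $\mathcal G^nF$ with $(\mathcal G^nF)_i=\mathfrak m^{n-i}F_i$ (where $\mathfrak m^j=R$ for $j\le 0$), with differential induced by that of $F$. The associated graded complex of this filtration is the linear part $\operatorname{lin}^R F$. The linearity defect is $\operatorname{ld}_R M=\sup\{i: H_i(\operatorname{lin}^R F)\ne 0\}\in\{0,1,\dots\}\cup\{\infty\}$ for $M\neq 0$, and $\operatorname{ld}_R 0=0$. $R$ is absolutely Koszul if every finitely generated $R$-module has finite linearity defect. *)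

theory Defs
  imports "HOL-Algebra.Algebra" "HOL-Library.Extended_Nat"
begin

section \<open>Noetherian local rings and associated graded rings\<close>

definition max_ideal :: "('a, 'r) ring_scheme \<Rightarrow> 'a set" where
  "max_ideal R = (THE I. maximalideal I R)"

definition noetherian_local_ring :: "('a, 'r) ring_scheme \<Rightarrow> bool" where
  "noetherian_local_ring R \<longleftrightarrow> cring R \<and> noetherian_ring R \<and> (\<exists>!I. maximalideal I R)"

text \<open>Powers in the monoid of ideals; its unit is the unit ideal, so the zeroth power is all of R.\<close>

abbreviation ideal_pow :: "('a, 'r) ring_scheme \<Rightarrow> 'a set \<Rightarrow> nat \<Rightarrow> 'a set" where
  "ideal_pow R I n \<equiv> I [^]\<^bsub>ideals_set R\<^esub> n"

text \<open>
  An element of \<open>gr\<^sub>I R\<close> is a finitely supported family \<open>f\<close> whose i-th component is a coset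
  \<open>I\<^sup>i\<^sup>+\<^sup>1 + a\<close> with \<open>a \<in> I\<^sup>i\<close>.  Each graded piece is viewed inside the quotient ring
  \<open>R / I\<^sup>n\<^sup>+\<^sup>1\<close>.  The product of two homogeneous components of degrees i and n - i is the coset
  modulo \<open>I\<^sup>n\<^sup>+\<^sup>1\<close> of the products of their representatives.
\<close>

definition assoc_graded_ring :: "('a, 'r) ring_scheme \<Rightarrow> 'a set \<Rightarrow> (nat \<Rightarrow> 'a set) ring" where
  "assoc_graded_ring R I =
    \<lparr>carrier = {f. (\<forall>i. f i \<in> (\<lambda>a. ideal_pow R I (Suc i) +>\<^bsub>R\<^esub> a) ` ideal_pow R I i) \<and>
                   finite {i. f i \<noteq> ideal_pow R I (Suc i)}},
     monoid.mult = (\<lambda>f g n. finsum (R Quot ideal_pow R I (Suc n))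
                       (\<lambda>i. rcoset_mult R (ideal_pow R I (Suc n)) (f i) (g (n - i))) {..n}),
     monoid.one = (\<lambda>i. ideal_pow R I (Suc i) +>\<^bsub>R\<^esub> (if i = 0 then \<one>\<^bsub>R\<^esub> else \<zero>\<^bsub>R\<^esub>)),
     ring.zero = (\<lambda>i. ideal_pow R I (Suc i)),
     ring.add = (\<lambda>f g i. f i <+>\<^bsub>R\<^esub> g i)\<rparr>"

text \<open>The residue class of \<open>x \<in> I\<close> in \<open>I / I\<^sup>2\<close>, as a homogeneous element of degree one.\<close>

definition degree_one_class :: "('a, 'r) ring_scheme \<Rightarrow> 'a set \<Rightarrow> 'a \<Rightarrow> nat \<Rightarrow> 'a set" where
  "degree_one_class R I x = (\<lambda>i. ideal_pow R I (Suc i) +>\<^bsub>R\<^esub> (if i = 1 then x else \<zero>\<^bsub>R\<^esub>))"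

definition nonzerodivisor :: "('a, 'r) ring_scheme \<Rightarrow> 'a \<Rightarrow> bool" where
  "nonzerodivisor A a \<longleftrightarrow>
     a \<in> carrier A \<and> (\<forall>b\<in>carrier A. a \<otimes>\<^bsub>A\<^esub> b = \<zero>\<^bsub>A\<^esub> \<longrightarrow> b = \<zero>\<^bsub>A\<^esub>)"


section \<open>Modules\<close>

definition fin_gen_module :: "('a, 'r) ring_scheme \<Rightarrow> ('a, 'b, 'm) module_scheme \<Rightarrow> bool" where
  "fin_gen_module R M \<longleftrightarrow> module R M \<and>
     (\<exists>A. finite A \<and> A \<subseteq> carrier M \<and> (\<forall>N. submodule N R M \<and> A \<subseteq> N \<longrightarrow> N = carrier M))"

definition module_homs ::
  "('a, 'r) ring_scheme \<Rightarrow> ('a, 'b, 'm) module_scheme \<Rightarrow> ('a, 'c, 'n) module_scheme \<Rightarrow> ('b \<Rightarrow> 'c) set"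
where
  "module_homs R M N =
     {h \<in> hom (add_monoid M) (add_monoid N).
        \<forall>a\<in>carrier R. \<forall>v\<in>carrier M. h (a \<odot>\<^bsub>M\<^esub> v) = a \<odot>\<^bsub>N\<^esub> h v}"

text \<open>The submodule \<open>I M\<close>.\<close>

definition ideal_smult :: "'a set \<Rightarrow> ('a, 'b, 'm) module_scheme \<Rightarrow> 'b set" where
  "ideal_smult I M = generate (add_monoid M) {a \<odot>\<^bsub>M\<^esub> v | a v. a \<in> I \<and> v \<in> carrier M}"

text \<open>
  The free module \<open>R\<^sup>n\<close>.  The module record extends the ring record, so it also has multiplication
  and unit fields; no definition refers to them.
\<close>

definition free_module :: "('a, 'r) ring_scheme \<Rightarrow> nat \<Rightarrow> ('a, nat \<Rightarrow> 'a) module" where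
  "free_module R n =
    \<lparr>carrier = {..<n} \<rightarrow>\<^sub>E carrier R,
     monoid.mult = (\<lambda>u v. \<lambda>k\<in>{..<n}. u k \<otimes>\<^bsub>R\<^esub> v k),
     monoid.one = (\<lambda>k\<in>{..<n}. \<one>\<^bsub>R\<^esub>),
     ring.zero = (\<lambda>k\<in>{..<n}. \<zero>\<^bsub>R\<^esub>),
     ring.add = (\<lambda>u v. \<lambda>k\<in>{..<n}. u k \<oplus>\<^bsub>R\<^esub> v k),
     module.smult = (\<lambda>a v. \<lambda>k\<in>{..<n}. a \<otimes>\<^bsub>R\<^esub> v k)\<rparr>"


section \<open>Minimal free resolutions\<close>

text \<open>
  In a complex \<open>F\<close> with differential \<open>d\<close>, the map \<open>d i\<close> goes from \<open>F i\<close> to \<open>F (i - 1)\<close>, for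
  \<open>i \<ge> 1\<close>; \<open>d 0\<close> is not used.  Finitely generated free modules are taken in the form \<open>R\<^sup>n\<close>,
  \<open>b\<close> is the sequence of ranks and \<open>e\<close> the augmentation.
\<close>

definition minimal_free_resolution ::
  "('a, 'r) ring_scheme \<Rightarrow> ('a, 'c, 'm) module_scheme \<Rightarrow> (nat \<Rightarrow> nat) \<Rightarrow>
     (nat \<Rightarrow> (nat \<Rightarrow> 'a) \<Rightarrow> (nat \<Rightarrow> 'a)) \<Rightarrow> ((nat \<Rightarrow> 'a) \<Rightarrow> 'c) \<Rightarrow> bool"
where
  "minimal_free_resolution R M b d e \<longleftrightarrow>
     (let F = (\<lambda>i. free_module R (b i)) in
       (\<forall>i. d (Suc i) \<in> module_homs R (F (Suc i)) (F i)) \<and>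
       e \<in> module_homs R (F 0) M \<and>
       e ` carrier (F 0) = carrier M \<and>
       d 1 ` carrier (F 1) = a_kernel (F 0) M e \<and>
       (\<forall>i. d (Suc (Suc i)) ` carrier (F (Suc (Suc i))) = a_kernel (F (Suc i)) (F i) (d (Suc i))) \<and>
       (\<forall>i. d (Suc i) ` carrier (F (Suc i)) \<subseteq> ideal_smult (max_ideal R) (F i)))"


section \<open>The linear part and the linearity defect\<close>

text \<open>
  \<open>(\<G>\<^sup>nF)\<^sub>i = \<mm>\<^sup>n\<^sup>-\<^sup>i F\<^sub>i\<close>.  Truncated subtraction implements \<open>\<mm>\<^sup>j = R\<close> for \<open>j \<le> 0\<close>.  Only
  \<open>n \<ge> 0\<close> is considered, since the filtration is constantly \<open>F\<close> for \<open>n \<le> 0\<close>.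
\<close>

definition G_filt ::
  "('a, 'r) ring_scheme \<Rightarrow> (nat \<Rightarrow> ('a, 'b, 'm) module_scheme) \<Rightarrow> nat \<Rightarrow> nat \<Rightarrow> 'b set"
where
  "G_filt R F n i = ideal_smult (ideal_pow R (max_ideal R) (n - i)) (F i)"

text \<open>The underlying abelian groups \<open>\<Oplus>\<^sub>n (\<G>\<^sup>nF)\<^sub>i / (\<G>\<^sup>n\<^sup>+\<^sup>1F)\<^sub>i\<close> of the associated graded complex.\<close>

definition lin_part ::
  "('a, 'r) ring_scheme \<Rightarrow> (nat \<Rightarrow> ('a, 'b, 'm) module_scheme) \<Rightarrow> nat \<Rightarrow> (nat \<Rightarrow> 'b set) monoid"
where
  "lin_part R F i =
     sum_group UNIV
       (\<lambda>n. (add_monoid (F i))\<lparr>carrier := G_filt R F n i\<rparr> Mod G_filt R F (Suc n) i)"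

text \<open>
  The induced differential from degree \<open>i\<close> to degree \<open>i - 1\<close>.  In the n-th component it sends the
  class of \<open>a\<close> to the class of \<open>d i a\<close>; the union runs over equal cosets.
\<close>

definition lin_diff ::
  "('a, 'r) ring_scheme \<Rightarrow> (nat \<Rightarrow> ('a, 'b, 'm) module_scheme) \<Rightarrow> (nat \<Rightarrow> 'b \<Rightarrow> 'b) \<Rightarrow>
     nat \<Rightarrow> (nat \<Rightarrow> 'b set) \<Rightarrow> (nat \<Rightarrow> 'b set)"
where
  "lin_diff R F d i u =
     (\<lambda>n. \<Union>a\<in>u n. G_filt R F (Suc n) (i - 1) +>\<^bsub>F (i - 1)\<^esub> d i a)"

text \<open>
  Homology of a nonnegatively graded complex of abelian groups (written multiplicatively): the
  map out of degree \<open>0\<close> is the zero map.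
\<close>

definition homology_of ::
  "(nat \<Rightarrow> ('c, 'm) monoid_scheme) \<Rightarrow> (nat \<Rightarrow> 'c \<Rightarrow> 'c) \<Rightarrow> nat \<Rightarrow> 'c set monoid"
where
  "homology_of C d i =
     (C i)\<lparr>carrier := (if i = 0 then carrier (C 0) else kernel (C i) (C (i - 1)) (d i))\<rparr>
       Mod (d (Suc i) ` carrier (C (Suc i)))"

definition lin_homology ::
  "('a, 'r) ring_scheme \<Rightarrow> (nat \<Rightarrow> ('a, 'b, 'm) module_scheme) \<Rightarrow> (nat \<Rightarrow> 'b \<Rightarrow> 'b) \<Rightarrow>
     nat \<Rightarrow> (nat \<Rightarrow> 'b set) set monoid"
where
  "lin_homology R F d i = homology_of (lin_part R F) (lin_diff R F d) i"

text \<open>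
  Over a noetherian local ring a finitely generated module has a minimal free resolution, unique up
  to isomorphism, so the choice below does not matter.
\<close>

definition linearity_defect :: "('a, 'r) ring_scheme \<Rightarrow> ('a, 'c, 'm) module_scheme \<Rightarrow> enat" where
  "linearity_defect R M =
     (if carrier M = {\<zero>\<^bsub>M\<^esub>} then 0
      else let (b, d) = (SOME (b, d). \<exists>e. minimal_free_resolution R M b d e);
               H = lin_homology R (\<lambda>i. free_module R (b i)) d
           in Sup {enat i | i. carrier (H i) \<noteq> {\<one>\<^bsub>H i\<^esub>}})"

text \<open>
  HOL cannot quantify over all types inside a formula, so modules range over those whose elements
  are sets of functions \<open>nat \<Rightarrow> 'a\<close>.  Every finitely generated module is isomorphic to such a
  module, because it is a quotient \<open>R\<^sup>n / N\<close>, whose elements are cosets in \<open>R\<^sup>n\<close>.  Lemma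
  \<open>absolutely_koszulD\<close> below confirms that modules of every other type are covered.
\<close>

definition absolutely_koszul :: "('a, 'r) ring_scheme \<Rightarrow> bool" where
  "absolutely_koszul R \<longleftrightarrow> noetherian_local_ring R \<and>
     (\<forall>M :: ('a, (nat \<Rightarrow> 'a) set) module. fin_gen_module R M \<longrightarrow> linearity_defect R M \<noteq> \<infinity>)"



lemma (in module) span_submodule:
  fixes g :: "nat \<Rightarrow> 'c"
  assumes g: "g \<in> {..<n} \<rightarrow> carrier M"
  shows "submodule ((\<lambda>c. \<Oplus>\<^bsub>M\<^esub>k\<in>{..<n}. c k \<odot>\<^bsub>M\<^esub> g k) ` ({..<n} \<rightarrow>\<^sub>E carrier R)) R M"
    (is "submodule (?f ` ?C) R M")
proof (rule submoduleI)
  have gc: "\<And>k. k < n \<Longrightarrow> g k \<in> carrier M" using g by auto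
  have cc: "\<And>c k. c \<in> ?C \<Longrightarrow> k < n \<Longrightarrow> c k \<in> carrier R" by auto
  show "?f ` ?C \<subseteq> carrier M"
    by (auto intro!: M.finsum_closed smult_closed gc cc)
  show "\<zero>\<^bsub>M\<^esub> \<in> ?f ` ?C"
  proof (rule image_eqI)
    show "(\<lambda>k\<in>{..<n}. \<zero>) \<in> ?C" by auto
    show "\<zero>\<^bsub>M\<^esub> = ?f (\<lambda>k\<in>{..<n}. \<zero>)"
      by (rule sym, rule M.add.finprod_one_eqI) (simp add: gc)
  qed
  have smul: "a \<odot>\<^bsub>M\<^esub> ?f c = ?f (\<lambda>k\<in>{..<n}. a \<otimes> c k) \<and> (\<lambda>k\<in>{..<n}. a \<otimes> c k) \<in> ?C"
    if "a \<in> carrier R" "c \<in> ?C" for a c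
  proof
    have "a \<odot>\<^bsub>M\<^esub> ?f c = (\<Oplus>\<^bsub>M\<^esub>k\<in>{..<n}. a \<odot>\<^bsub>M\<^esub> (c k \<odot>\<^bsub>M\<^esub> g k))"
      using that by (intro finsum_smult_ldistr) (auto intro!: gc cc)
    also have "\<dots> = ?f (\<lambda>k\<in>{..<n}. a \<otimes> c k)"
      using that by (intro M.finsum_cong') (auto simp: smult_assoc1 gc cc intro!: smult_closed m_closed)
    finally show "a \<odot>\<^bsub>M\<^esub> ?f c = ?f (\<lambda>k\<in>{..<n}. a \<otimes> c k)" .
    show "(\<lambda>k\<in>{..<n}. a \<otimes> c k) \<in> ?C" using that by auto
  qed
  show "a \<odot>\<^bsub>M\<^esub> v \<in> ?f ` ?C" if "a \<in> carrier R" "v \<in> ?f ` ?C" for a v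
    using that smul by blast
  show "v \<oplus>\<^bsub>M\<^esub> w \<in> ?f ` ?C" if vw: "v \<in> ?f ` ?C" "w \<in> ?f ` ?C" for v w
  proof -
    obtain c d where c: "c \<in> ?C" "v = ?f c" and d: "d \<in> ?C" "w = ?f d" using vw by blast
    have "v \<oplus>\<^bsub>M\<^esub> w = (\<Oplus>\<^bsub>M\<^esub>k\<in>{..<n}. c k \<odot>\<^bsub>M\<^esub> g k \<oplus>\<^bsub>M\<^esub> d k \<odot>\<^bsub>M\<^esub> g k)"
      unfolding c(2) d(2) by (intro M.finsum_addf[symmetric]) (auto intro!: smult_closed gc cc[OF c(1)] cc[OF d(1)])
    also have "\<dots> = (\<Oplus>\<^bsub>M\<^esub>k\<in>{..<n}. (c k \<oplus> d k) \<odot>\<^bsub>M\<^esub> g k)"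
      by (intro M.finsum_cong') (auto simp: smult_l_distr gc cc[OF c(1)] cc[OF d(1)])
    also have "\<dots> = ?f (\<lambda>k\<in>{..<n}. c k \<oplus> d k)"
      by (intro M.finsum_cong') (auto simp: gc cc[OF c(1)] cc[OF d(1)])
    finally have "v \<oplus>\<^bsub>M\<^esub> w = ?f (\<lambda>k\<in>{..<n}. c k \<oplus> d k)" .
    moreover have "(\<lambda>k\<in>{..<n}. c k \<oplus> d k) \<in> ?C" using c(1) d(1) by auto
    ultimately show ?thesis by (rule image_eqI)
  qed
  show "\<ominus>\<^bsub>M\<^esub> v \<in> ?f ` ?C" if v: "v \<in> ?f ` ?C" for v
  proof -
    obtain c where c: "c \<in> ?C" "v = ?f c" using v by blast
    have vc: "v \<in> carrier M" unfolding c(2) by (auto intro!: M.finsum_closed smult_closed gc cc[OF c(1)])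
    have "\<ominus>\<^bsub>M\<^esub> v = (\<ominus> \<one>) \<odot>\<^bsub>M\<^esub> v" using vc smult_l_minus[of \<one> v] by simp
    moreover have "(\<ominus> \<one>) \<odot>\<^bsub>M\<^esub> v = ?f (\<lambda>k\<in>{..<n}. \<ominus> \<one> \<otimes> c k)"
      "(\<lambda>k\<in>{..<n}. \<ominus> \<one> \<otimes> c k) \<in> ?C"
      unfolding c(2) using smul[of "\<ominus> \<one>" c] c(1) by simp_all
    ultimately show ?thesis by (simp only: image_eqI)
  qed
qed

lemma fin_gen_module_inj:
  fixes M :: "('a, 'c, 'm) module_scheme"
  assumes "fin_gen_module R M"
  shows "\<exists>j :: 'c \<Rightarrow> (nat \<Rightarrow> 'a) set. inj_on j (carrier M)"
proof -
  interpret module R M using assms by (simp add: fin_gen_module_def)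
  obtain A where A: "finite A" "A \<subseteq> carrier M"
    "\<And>N. submodule N R M \<Longrightarrow> A \<subseteq> N \<Longrightarrow> N = carrier M"
    using assms unfolding fin_gen_module_def by blast
  obtain n and g :: "nat \<Rightarrow> 'c" where g: "A = g ` {k. k < n}"
    using finite_imp_nat_seg_image_inj_on[OF A(1)] by blast
  have gM: "g \<in> {..<n} \<rightarrow> carrier M" using A(2) g by auto
  let ?C = "{..<n} \<rightarrow>\<^sub>E carrier R"
  let ?f = "\<lambda>c. \<Oplus>\<^bsub>M\<^esub>k\<in>{..<n}. c k \<odot>\<^bsub>M\<^esub> g k"
  have "A \<subseteq> ?f ` ?C"
  proof
    fix v assume "v \<in> A"
    then obtain i where i: "i < n" "v = g i" using g by auto
    let ?e = "\<lambda>k\<in>{..<n}. if k = i then \<one>\<^bsub>R\<^esub> else \<zero>\<^bsub>R\<^esub>"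
    have "?f ?e = (\<Oplus>\<^bsub>M\<^esub>k\<in>{..<n}. if i = k then g k else \<zero>\<^bsub>M\<^esub>)"
      using gM by (intro M.finsum_cong') (auto simp: Pi_iff)
    also have "\<dots> = g i" using gM i by (intro M.finsum_singleton) auto
    finally have "v = ?f ?e" using i by simp
    moreover have "?e \<in> ?C" by auto
    ultimately show "v \<in> ?f ` ?C" by (rule image_eqI)
  qed
  then have surj: "?f ` ?C = carrier M" using A(3) span_submodule[OF gM] by blast
  have "inj_on (\<lambda>v. {c \<in> ?C. ?f c = v}) (carrier M)"
  proof (rule inj_onI)
    fix v w assume v: "v \<in> carrier M" and eq: "{c \<in> ?C. ?f c = v} = {c \<in> ?C. ?f c = w}"
    obtain c where "c \<in> ?C" "?f c = v" using v surj by (metis (no_types, lifting) imageE)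
    then show "v = w" using eq by blast
  qed
  then show ?thesis by blast
qed

definition transport_module ::
  "('b \<Rightarrow> 'c) \<Rightarrow> ('a, 'b, 'm) module_scheme \<Rightarrow> ('a, 'c) module" where
  "transport_module j M = (let i = inv_into (carrier M) j in
    \<lparr>carrier = j ` carrier M,
     monoid.mult = (\<lambda>u v. j (i u \<otimes>\<^bsub>M\<^esub> i v)),
     monoid.one = j \<one>\<^bsub>M\<^esub>,
     ring.zero = j \<zero>\<^bsub>M\<^esub>,
     ring.add = (\<lambda>u v. j (i u \<oplus>\<^bsub>M\<^esub> i v)),
     module.smult = (\<lambda>a v. j (a \<odot>\<^bsub>M\<^esub> i v))\<rparr>)"

lemma transport_module:
  assumes M: "module R M" and j: "inj_on j (carrier M)"
  shows "module R (transport_module j M)"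
    and "j \<in> module_homs R M (transport_module j M)"
    and "inv_into (carrier M) j \<in> module_homs R (transport_module j M) M"
proof -
  interpret module R M by fact
  note [simp] = transport_module_def Let_def inv_into_f_f[OF j]
  show "module R (transport_module j M)"
  proof (rule moduleI)
    show "abelian_group (transport_module j M)"
    proof (rule abelian_groupI)
      fix u assume "u \<in> carrier (transport_module j M)"
      then obtain v where v: "v \<in> carrier M" "u = j v" by auto
      show "\<exists>y\<in>carrier (transport_module j M). y \<oplus>\<^bsub>transport_module j M\<^esub> u = \<zero>\<^bsub>transport_module j M\<^esub>"
        using v by (auto simp: M.l_neg intro!: bexI[of _ "\<ominus>\<^bsub>M\<^esub> v"])
    qed (auto simp: M.a_ac)
  qed (auto simp: is_cring smult_l_distr smult_r_distr smult_assoc1)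
  show "j \<in> module_homs R M (transport_module j M)"
    by (auto simp: module_homs_def hom_def)
  show "inv_into (carrier M) j \<in> module_homs R (transport_module j M) M"
    by (auto simp: module_homs_def hom_def)
qed

lemma submodule_vimage:
  assumes "module R M" "module R N" "h \<in> module_homs R M N" "submodule P R N"
  shows "submodule {v \<in> carrier M. h v \<in> P} R M"
proof -
  interpret M: module R M by fact
  interpret N: module R N by fact
  have h: "\<And>v. v \<in> carrier M \<Longrightarrow> h v \<in> carrier N"
    "\<And>v w. v \<in> carrier M \<Longrightarrow> w \<in> carrier M \<Longrightarrow> h (v \<oplus>\<^bsub>M\<^esub> w) = h v \<oplus>\<^bsub>N\<^esub> h w"
    "\<And>a v. a \<in> carrier R \<Longrightarrow> v \<in> carrier M \<Longrightarrow> h (a \<odot>\<^bsub>M\<^esub> v) = a \<odot>\<^bsub>N\<^esub> h v"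
    using assms(3) by (auto simp: module_homs_def hom_def)
  note P = N.submoduleE[OF assms(4)]
  interpret P: submodule P R N by fact
  have neg: "h (\<ominus>\<^bsub>M\<^esub> v) = \<ominus>\<^bsub>N\<^esub> h v" if "v \<in> carrier M" for v
    using h(3)[of "\<ominus>\<^bsub>R\<^esub> \<one>\<^bsub>R\<^esub>" v] that M.smult_l_minus[of "\<one>\<^bsub>R\<^esub>" v] N.smult_l_minus[of "\<one>\<^bsub>R\<^esub>" "h v"] h(1)
    by simp
  have zero: "h \<zero>\<^bsub>M\<^esub> = \<zero>\<^bsub>N\<^esub>"
    using h(3)[of "\<zero>\<^bsub>R\<^esub>" "\<zero>\<^bsub>M\<^esub>"] h(1)[of "\<zero>\<^bsub>M\<^esub>"] by simp
  have z: "\<zero>\<^bsub>N\<^esub> \<in> P" using P.one_closed by simp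
  show ?thesis
    by (rule M.submoduleI) (use P h neg zero z in auto)
qed

lemma fin_gen_transport:
  assumes fg: "fin_gen_module R M" and j: "inj_on j (carrier M)"
  shows "fin_gen_module R (transport_module j M)"
proof -
  have M: "module R M" using fg by (simp add: fin_gen_module_def)
  let ?N = "transport_module j M"
  note t = transport_module[OF M j]
  obtain A where A: "finite A" "A \<subseteq> carrier M"
    "\<And>N. submodule N R M \<Longrightarrow> A \<subseteq> N \<Longrightarrow> N = carrier M"
    using fg unfolding fin_gen_module_def by blast
  have c: "carrier ?N = j ` carrier M" by (simp add: transport_module_def Let_def)
  have "P = carrier ?N" if P: "submodule P R ?N" "j ` A \<subseteq> P" for P
  proof -
    have "{v \<in> carrier M. j v \<in> P} = carrier M"
      using A(2) P(2) by (intro A(3) submodule_vimage[OF M t(1,2) P(1)]) auto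
    moreover have "P \<subseteq> carrier ?N" using module.submoduleE(1)[OF t(1) P(1)] .
    moreover have "carrier ?N \<subseteq> P"
    proof
      fix w assume "w \<in> carrier ?N"
      then obtain v where "v \<in> carrier M" "w = j v" unfolding c by (rule imageE)
      then show "w \<in> P" using calculation(1) by auto
    qed
    ultimately show ?thesis by (intro subset_antisym)
  qed
  moreover have "finite (j ` A)" "j ` A \<subseteq> carrier ?N" using A(1,2) unfolding c by auto
  ultimately show ?thesis unfolding fin_gen_module_def using t(1) by meson
qed

lemma minimal_free_resolution_iso:
  assumes M: "module R M" and N: "module R N"
    and h: "h \<in> module_homs R M N" "bij_betw h (carrier M) (carrier N)"
    and res: "minimal_free_resolution R M b d e"
  shows "minimal_free_resolution R N b d (h \<circ> e)"
proof -
  interpret M: module R M by fact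
  interpret N: module R N by fact
  let ?F = "free_module R (b 0)"
  have e: "e \<in> module_homs R ?F M" "e ` carrier ?F = carrier M"
    using res by (auto simp: minimal_free_resolution_def Let_def)
  have hh: "h v \<in> carrier N" "a \<in> carrier R \<Longrightarrow> h (a \<odot>\<^bsub>M\<^esub> v) = a \<odot>\<^bsub>N\<^esub> h v" if "v \<in> carrier M" for a v
    using h(1) that by (auto simp: module_homs_def hom_def)
  have zero: "h \<zero>\<^bsub>M\<^esub> = \<zero>\<^bsub>N\<^esub>"
    using hh(2)[of "\<zero>\<^bsub>M\<^esub>" "\<zero>\<^bsub>R\<^esub>"] hh(1)[of "\<zero>\<^bsub>M\<^esub>"] by simp
  have "h \<circ> e \<in> module_homs R ?F N"
    using e(1) h(1) by (auto simp: module_homs_def hom_def Pi_iff)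
  moreover have "(h \<circ> e) ` carrier ?F = carrier N"
    using e(2) h(2) by (metis bij_betw_imp_surj_on image_comp)
  moreover have "a_kernel ?F N (h \<circ> e) = a_kernel ?F M e"
  proof -
    have "h (e v) = \<zero>\<^bsub>N\<^esub> \<longleftrightarrow> e v = \<zero>\<^bsub>M\<^esub>" if "v \<in> carrier ?F" for v
      using that e(2) zero inj_on_eq_iff[OF bij_betw_imp_inj_on[OF h(2)], of "e v" "\<zero>\<^bsub>M\<^esub>"] by auto
    then show ?thesis by (auto simp: a_kernel_def')
  qed
  ultimately show ?thesis using res by (auto simp: minimal_free_resolution_def Let_def)
qed

lemma linearity_defect_transport:
  assumes M: "module R M" and j: "inj_on j (carrier M)"
  shows "linearity_defect R (transport_module j M) = linearity_defect R M"
proof -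
  let ?N = "transport_module j M"
  note t = transport_module[OF M j]
  interpret module R M by fact
  have c: "carrier ?N = j ` carrier M" "\<zero>\<^bsub>?N\<^esub> = j \<zero>\<^bsub>M\<^esub>"
    by (simp_all add: transport_module_def Let_def)
  have b: "bij_betw j (carrier M) (carrier ?N)" using j c by (simp add: bij_betw_def)
  have "(\<exists>e. minimal_free_resolution R ?N b d e) = (\<exists>e. minimal_free_resolution R M b d e)" for b d
    using minimal_free_resolution_iso[OF M t(1,2) b]
      minimal_free_resolution_iso[OF t(1) M t(3) bij_betw_inv_into[OF b]] by blast
  moreover have "carrier ?N = {\<zero>\<^bsub>?N\<^esub>} \<longleftrightarrow> carrier M = {\<zero>\<^bsub>M\<^esub>}"
    unfolding c using j inj_on_image_eq_iff[OF j, of "carrier M" "{\<zero>\<^bsub>M\<^esub>}"] by auto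
  ultimately show ?thesis by (simp add: linearity_defect_def)
qed

lemma absolutely_koszulD:
  fixes M :: "('a, 'c, 'm) module_scheme"
  assumes "absolutely_koszul R" "fin_gen_module R M"
  shows "linearity_defect R M \<noteq> \<infinity>"
proof -
  obtain j :: "'c \<Rightarrow> (nat \<Rightarrow> 'a) set" where j: "inj_on j (carrier M)"
    using fin_gen_module_inj[OF assms(2)] by blast
  have "linearity_defect R (transport_module j M) \<noteq> \<infinity>"
    using assms(1) fin_gen_transport[OF assms(2) j] by (auto simp: absolutely_koszul_def)
  then show ?thesis
    using linearity_defect_transport[of R M j] j assms(2) by (simp add: fin_gen_module_def)
qed

end

theory Submission
  imports Defs
begin

text \<open>
  Let \<open>S = R / (x)\<close>, let \<open>M\<close> be a finitely generated \<open>S\<close>-module and \<open>(G, d)\<close> its minimal free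
  resolution over \<open>S\<close>.  Lift \<open>d\<close> to a map \<open>\<delta>\<close> between free \<open>R\<close>-modules of the same ranks.  Since
  \<open>\<delta>\<^sup>2\<close> vanishes modulo \<open>x\<close>, it equals \<open>x t\<close> for some \<open>t\<close>.  On \<open>F\<^sub>i = R\<^bsup>b i\<^esup> \<oplus> R\<^bsup>b (i - 1)\<^esup>\<close> put
  \<open>D (g, u) = (\<delta> g - x u, t g - \<delta> u)\<close>.

  Then \<open>(F, D)\<close> is the minimal free resolution of \<open>M\<close> over \<open>R\<close>.  It is a complex and it is exact
  because \<open>x\<close> is a nonzerodivisor on \<open>R\<close>: \<open>x\<close> times the second component of \<open>D (g, u)\<close> is \<open>\<delta>\<close> of
  the first one, so only first components matter, and for these exactness is that of \<open>G\<close>.  It is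
  minimal because \<open>x t = \<delta>\<^sup>2\<close> has entries in \<open>\<mm>\<^sup>2\<close> and \<open>(\<mm>\<^sup>2 : x) = \<mm>\<close>.  (Lemma
  \<open>lifted_minimal_free_resolution\<close>.)

  The same computation works on linear parts: the projection \<open>(g, u) \<mapsto> g\<close> modulo \<open>x\<close> from the linear
  part of \<open>F\<close> to that of \<open>G\<close> is onto and its kernel is acyclic, as the initial form of \<open>x\<close> is a
  nonzerodivisor on the associated graded ring.  So the linear part of \<open>G\<close> is exact wherever that of \<open>F\<close>
  is (lemma \<open>linear_part_exact_section\<close>), and a finite linearity defect over \<open>R\<close> gives a finite
  one over \<open>S\<close>.

  All this is done with elements.  Exactness of the linear part in a positive degree means that a
  vector over \<open>\<mm>\<^sup>p\<close> whose boundary lies two steps deeper, in \<open>\<mm>\<^sup>p\<^sup>+\<^sup>2\<close>, is a boundary of a vector over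
  \<open>\<mm>\<^sup>p\<^sup>-\<^sup>1\<close> up to an error in \<open>\<mm>\<^sup>p\<^sup>+\<^sup>1\<close> (lemma \<open>lin_homology_trivial_iff\<close>); and regularity of the initial
  form of \<open>x\<close> enters as \<open>(\<mm>\<^sup>p\<^sup>+\<^sup>1 : x) = \<mm>\<^sup>p\<close> (lemma \<open>regular_initial_form_colon\<close>), which with Krull's
  intersection theorem also makes \<open>x\<close> a nonzerodivisor on \<open>R\<close>.  The linearity defect is defined
  by means of a chosen resolution, which calls for two more facts: resolutions exist over \<open>S\<close>
  (lemma \<open>minimal_free_resolution_exists\<close>), and any two of them have the same exactness
  properties (lemma \<open>linear_part_exact_independent\<close>).
\<close>

section \<open>Subtraction in abelian groups\<close>

lemma (in abelian_group) diff_zero: "v \<in> carrier G \<Longrightarrow> v \<ominus> \<zero> = v"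
  by (simp add: a_minus_def)

lemma (in abelian_group) diff_add_cancel: "v \<in> carrier G \<Longrightarrow> w \<in> carrier G \<Longrightarrow> v \<ominus> w \<oplus> w = v"
  by (simp add: a_minus_def a_assoc l_neg)

lemma (in abelian_group) diff_add_diff:
  "u \<in> carrier G \<Longrightarrow> v \<in> carrier G \<Longrightarrow> w \<in> carrier G \<Longrightarrow> (u \<ominus> v) \<oplus> (v \<ominus> w) = u \<ominus> w"
  by (simp add: a_minus_def a_assoc r_neg1)

lemma (in abelian_group) diff_eq_zero_iff:
  assumes "v \<in> carrier G" "w \<in> carrier G"
  shows "v \<ominus> w = \<zero> \<longleftrightarrow> v = w"
proof
  assume "v \<ominus> w = \<zero>"
  then show "v = w" using diff_add_cancel[OF assms] assms by simp
next
  assume "v = w"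
  then show "v \<ominus> w = \<zero>" using assms by (simp add: a_minus_def r_neg)
qed

lemma (in abelian_group) add_diff_cancel:
  assumes "v \<in> carrier G" "w \<in> carrier G"
  shows "(v \<oplus> w) \<ominus> w = v" "(v \<oplus> w) \<ominus> v = w" "v \<ominus> (v \<ominus> w) = w"
proof -
  have 1: "(v \<oplus> w) \<ominus> w = v" if "v \<in> carrier G" "w \<in> carrier G" for v w
    using that by (simp add: a_minus_def a_assoc r_neg)
  show "(v \<oplus> w) \<ominus> w = v" by (rule 1[OF assms])
  show "(v \<oplus> w) \<ominus> v = w" using 1[of w v] assms by (simp add: a_comm)
  show "v \<ominus> (v \<ominus> w) = w"
    using 1[of w "v \<ominus> w"] diff_add_cancel[of v w] a_comm[of w "v \<ominus> w"] assms by simp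
qed


section \<open>Homomorphisms out of free modules\<close>

lemma module_homsI:
  assumes "\<And>v. v \<in> carrier M \<Longrightarrow> h v \<in> carrier N"
    and "\<And>v w. v \<in> carrier M \<Longrightarrow> w \<in> carrier M \<Longrightarrow> h (v \<oplus>\<^bsub>M\<^esub> w) = h v \<oplus>\<^bsub>N\<^esub> h w"
    and "\<And>a v. a \<in> carrier R \<Longrightarrow> v \<in> carrier M \<Longrightarrow> h (a \<odot>\<^bsub>M\<^esub> v) = a \<odot>\<^bsub>N\<^esub> h v"
  shows "h \<in> module_homs R M N"
  using assms by (auto simp: module_homs_def hom_def)

lemma module_homsD:
  assumes "h \<in> module_homs R M N"
  shows "v \<in> carrier M \<Longrightarrow> h v \<in> carrier N"
    and "v \<in> carrier M \<Longrightarrow> w \<in> carrier M \<Longrightarrow> h (v \<oplus>\<^bsub>M\<^esub> w) = h v \<oplus>\<^bsub>N\<^esub> h w"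
    and "a \<in> carrier R \<Longrightarrow> v \<in> carrier M \<Longrightarrow> h (a \<odot>\<^bsub>M\<^esub> v) = a \<odot>\<^bsub>N\<^esub> h v"
  using assms by (auto simp: module_homs_def hom_def)

lemma module_homs_zero:
  assumes "module R M" "module R N" "h \<in> module_homs R M N"
  shows "h \<zero>\<^bsub>M\<^esub> = \<zero>\<^bsub>N\<^esub>"
proof -
  interpret M: module R M by fact
  interpret N: module R N by fact
  show ?thesis
    using module_homsD(3)[OF assms(3), of "\<zero>\<^bsub>R\<^esub>" "\<zero>\<^bsub>M\<^esub>"] module_homsD(1)[OF assms(3), of "\<zero>\<^bsub>M\<^esub>"]
    by simp
qed

lemma module_homs_minus:
  assumes "module R M" "module R N" "h \<in> module_homs R M N" "v \<in> carrier M"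
  shows "h (\<ominus>\<^bsub>M\<^esub> v) = \<ominus>\<^bsub>N\<^esub> h v"
proof -
  interpret M: module R M by fact
  interpret N: module R N by fact
  have "h (\<ominus>\<^bsub>R\<^esub> \<one>\<^bsub>R\<^esub> \<odot>\<^bsub>M\<^esub> v) = \<ominus>\<^bsub>R\<^esub> \<one>\<^bsub>R\<^esub> \<odot>\<^bsub>N\<^esub> h v"
    using module_homsD(3)[OF assms(3)] assms(4) by simp
  then show ?thesis
    using assms(4) module_homsD(1)[OF assms(3), of v] M.smult_l_minus[of "\<one>\<^bsub>R\<^esub>" v]
      N.smult_l_minus[of "\<one>\<^bsub>R\<^esub>" "h v"]
    by simp
qed

lemma module_homs_diff:
  assumes "module R M" "module R N" "h \<in> module_homs R M N" "v \<in> carrier M" "w \<in> carrier M"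
  shows "h (v \<ominus>\<^bsub>M\<^esub> w) = h v \<ominus>\<^bsub>N\<^esub> h w"
proof -
  interpret M: module R M by fact
  show ?thesis
    using module_homsD[OF assms(3)] module_homs_minus[OF assms(1-3)] assms(4,5)
    by (simp add: a_minus_def)
qed

lemma module_homs_comp:
  "h \<in> module_homs R M N \<Longrightarrow> k \<in> module_homs R N P \<Longrightarrow> (\<lambda>v. k (h v)) \<in> module_homs R M P"
  by (rule module_homsI) (auto simp: module_homsD)

lemma module_homs_sub:
  assumes N: "module R N" and h: "h \<in> module_homs R M N" and k: "k \<in> module_homs R M N"
  shows "(\<lambda>v. h v \<ominus>\<^bsub>N\<^esub> k v) \<in> module_homs R M N"
proof -
  interpret N: module R N by fact
  note [simp] = module_homsD[OF h] module_homsD[OF k]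
  show ?thesis
    by (rule module_homsI)
      (simp_all add: a_minus_def N.smult_r_distr N.smult_r_minus N.minus_add N.a_ac)
qed

lemma a_kernel_submodule:
  assumes M: "module R M" and N: "module R N" and h: "h \<in> module_homs R M N"
  shows "submodule (a_kernel M N h) R M"
proof -
  interpret M: module R M by fact
  interpret N: module R N by fact
  note [simp] = module_homsD[OF h] module_homs_minus[OF M N h] module_homs_zero[OF M N h]
  show ?thesis
    by (rule M.submoduleI) (auto simp: a_kernel_def')
qed

abbreviation vectors :: "nat \<Rightarrow> 'a set \<Rightarrow> (nat \<Rightarrow> 'a) set" where
  "vectors n I \<equiv> {..<n} \<rightarrow>\<^sub>E I"

lemma free_module_simps:
  "carrier (free_module R n) = vectors n (carrier R)"
  "\<zero>\<^bsub>free_module R n\<^esub> = (\<lambda>k\<in>{..<n}. \<zero>\<^bsub>R\<^esub>)"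
  "u \<oplus>\<^bsub>free_module R n\<^esub> v = (\<lambda>k\<in>{..<n}. u k \<oplus>\<^bsub>R\<^esub> v k)"
  "a \<odot>\<^bsub>free_module R n\<^esub> v = (\<lambda>k\<in>{..<n}. a \<otimes>\<^bsub>R\<^esub> v k)"
  by (simp_all add: free_module_def)

definition basis_vec :: "('a, 'r) ring_scheme \<Rightarrow> nat \<Rightarrow> nat \<Rightarrow> nat \<Rightarrow> 'a" where
  "basis_vec R n k = (\<lambda>i\<in>{..<n}. if i = k then \<one>\<^bsub>R\<^esub> else \<zero>\<^bsub>R\<^esub>)"

context cring
begin

lemma free_module_is_module: "module R (free_module R n)"
proof -
  have eqI: "u = v" if "u \<in> vectors n (carrier R)" "v \<in> vectors n (carrier R)" "\<And>k. k < n \<Longrightarrow> u k = v k" for u v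
    using that by (intro PiE_ext) auto
  have c: "u \<in> vectors n (carrier R) \<Longrightarrow> k < n \<Longrightarrow> u k \<in> carrier R" for u k by auto
  show ?thesis
  proof (rule moduleI)
    show "abelian_group (free_module R n)"
    proof (rule abelian_groupI, unfold free_module_simps)
      fix u assume u: "u \<in> vectors n (carrier R)"
      show "\<exists>y\<in>vectors n (carrier R). (\<lambda>k\<in>{..<n}. y k \<oplus> u k) = (\<lambda>k\<in>{..<n}. \<zero>)"
      proof (rule bexI)
        show "(\<lambda>k\<in>{..<n}. (\<lambda>k\<in>{..<n}. \<ominus> u k) k \<oplus> u k) = (\<lambda>k\<in>{..<n}. \<zero>)"
          by (rule restrict_ext) (simp add: c[OF u] l_neg)
        show "(\<lambda>k\<in>{..<n}. \<ominus> u k) \<in> vectors n (carrier R)" using c[OF u] by simp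
      qed
    qed (rule eqI; simp add: c a_ac; fail | simp add: c; fail)+
  qed (unfold free_module_simps, rule is_cring | rule eqI; simp add: c l_distr r_distr m_assoc; fail | simp add: c; fail)+
qed

lemma free_module_minus:
  assumes "v \<in> carrier (free_module R n)"
  shows "\<ominus>\<^bsub>free_module R n\<^esub> v = (\<lambda>k\<in>{..<n}. \<ominus> v k)"
proof (rule abelian_group.minus_equality[OF module.axioms(2)[OF free_module_is_module]])
  have c: "k < n \<Longrightarrow> v k \<in> carrier R" for k using assms by (auto simp: free_module_simps)
  show "v \<in> carrier (free_module R n)" by fact
  show "(\<lambda>k\<in>{..<n}. \<ominus> v k) \<in> carrier (free_module R n)"
    unfolding free_module_simps using c by simp
  show "(\<lambda>k\<in>{..<n}. \<ominus> v k) \<oplus>\<^bsub>free_module R n\<^esub> v = \<zero>\<^bsub>free_module R n\<^esub>"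
    unfolding free_module_simps by (rule restrict_ext) (simp add: c l_neg)
qed

lemma free_module_diff:
  assumes "v \<in> carrier (free_module R n)" "w \<in> carrier (free_module R n)"
  shows "v \<ominus>\<^bsub>free_module R n\<^esub> w = (\<lambda>k\<in>{..<n}. v k \<ominus> w k)"
  unfolding a_minus_def[of "free_module R n"] free_module_minus[OF assms(2)] free_module_simps
  by (rule restrict_ext) (simp add: a_minus_def)

lemma basis_vec_closed [simp]: "basis_vec R n k \<in> carrier (free_module R n)"
  by (auto simp: basis_vec_def free_module_simps)

text \<open>
  A vector is built up one coordinate at a time from its truncations; this replaces all
  computations with linear combinations of basis vectors.
\<close>

lemma free_module_induct:
  assumes v: "v \<in> vectors n I" and I: "I \<subseteq> carrier R" "\<zero> \<in> I"
    and zero: "P \<zero>\<^bsub>free_module R n\<^esub>"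
    and basis: "\<And>a k. a \<in> I \<Longrightarrow> k < n \<Longrightarrow> P (a \<odot>\<^bsub>free_module R n\<^esub> basis_vec R n k)"
    and add: "\<And>u w. u \<in> vectors n I \<Longrightarrow> w \<in> vectors n I \<Longrightarrow> P u \<Longrightarrow> P w \<Longrightarrow> P (u \<oplus>\<^bsub>free_module R n\<^esub> w)"
  shows "P v"
proof -
  let ?t = "\<lambda>j. \<lambda>i\<in>{..<n}. if i < j then v i else \<zero>"
  have vi: "i < n \<Longrightarrow> v i \<in> I" for i using v by auto
  have vc: "i < n \<Longrightarrow> v i \<in> carrier R" for i using vi I by auto
  have "P (?t j)" if "j \<le> n" for j
    using that
  proof (induction j)
    case 0
    have "?t 0 = \<zero>\<^bsub>free_module R n\<^esub>" unfolding free_module_simps by (rule restrict_ext) simp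
    then show ?case using zero by simp
  next
    case (Suc j)
    let ?b = "v j \<odot>\<^bsub>free_module R n\<^esub> basis_vec R n j"
    have eq: "?t (Suc j) = ?t j \<oplus>\<^bsub>free_module R n\<^esub> ?b"
      using Suc.prems vc by (auto simp: free_module_simps basis_vec_def restrict_def less_Suc_eq)
    have b: "?b = (\<lambda>i\<in>{..<n}. if i = j then v j else \<zero>)"
      using Suc.prems vc by (auto simp: free_module_simps basis_vec_def)
    show ?case unfolding eq
    proof (rule add)
      show "?t j \<in> vectors n I" using vi I(2) by auto
      show "?b \<in> vectors n I" unfolding b using vi I(2) Suc.prems by auto
      show "P (?t j)" by (rule Suc.IH) (use Suc.prems in simp)
      show "P ?b" by (rule basis) (use Suc.prems vi in simp_all)
    qed
  qed
  from this[of n] have "P (?t n)" by simp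
  moreover have "?t n = v" using v by (auto simp: fun_eq_iff PiE_iff extensional_def)
  ultimately show ?thesis by simp
qed

lemma free_module_hom_exists:
  assumes M: "module R M" and w: "\<And>k. k < n \<Longrightarrow> w k \<in> carrier M"
  obtains h where "h \<in> module_homs R (free_module R n) M" "\<And>k. k < n \<Longrightarrow> h (basis_vec R n k) = w k"
proof
  interpret M: module R M by fact
  let ?h = "\<lambda>v. \<Oplus>\<^bsub>M\<^esub>k\<in>{..<n}. v k \<odot>\<^bsub>M\<^esub> w k"
  have vc: "v \<in> carrier (free_module R n) \<Longrightarrow> k < n \<Longrightarrow> v k \<in> carrier R" for v k
    by (auto simp: free_module_simps)
  show "?h \<in> module_homs R (free_module R n) M"
  proof (rule module_homsI)
    fix v assume v: "v \<in> carrier (free_module R n)"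
    show "?h v \<in> carrier M" using vc[OF v] w by (auto intro!: M.M.finsum_closed)
    fix u assume u: "u \<in> carrier (free_module R n)"
    have "?h (v \<oplus>\<^bsub>free_module R n\<^esub> u) = (\<Oplus>\<^bsub>M\<^esub>k\<in>{..<n}. v k \<odot>\<^bsub>M\<^esub> w k \<oplus>\<^bsub>M\<^esub> u k \<odot>\<^bsub>M\<^esub> w k)"
      using vc[OF v] vc[OF u] w by (intro M.M.finsum_cong') (auto simp: free_module_simps M.smult_l_distr)
    also have "\<dots> = ?h v \<oplus>\<^bsub>M\<^esub> ?h u"
      using vc[OF v] vc[OF u] w by (intro M.M.finsum_addf) auto
    finally show "?h (v \<oplus>\<^bsub>free_module R n\<^esub> u) = ?h v \<oplus>\<^bsub>M\<^esub> ?h u" .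
  next
    fix a v assume a: "a \<in> carrier R" and v: "v \<in> carrier (free_module R n)"
    have "a \<odot>\<^bsub>M\<^esub> ?h v = (\<Oplus>\<^bsub>M\<^esub>k\<in>{..<n}. a \<odot>\<^bsub>M\<^esub> (v k \<odot>\<^bsub>M\<^esub> w k))"
      using a vc[OF v] w by (intro M.finsum_smult_ldistr) auto
    also have "\<dots> = ?h (a \<odot>\<^bsub>free_module R n\<^esub> v)"
      using a vc[OF v] w by (intro M.M.finsum_cong') (auto simp: free_module_simps M.smult_assoc1)
    finally show "?h (a \<odot>\<^bsub>free_module R n\<^esub> v) = a \<odot>\<^bsub>M\<^esub> ?h v" by simp
  qed
  fix k assume k: "k < n"
  have "?h (basis_vec R n k) = (\<Oplus>\<^bsub>M\<^esub>j\<in>{..<n}. if k = j then w j else \<zero>\<^bsub>M\<^esub>)"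
    using w k by (intro M.M.finsum_cong') (auto simp: basis_vec_def)
  also have "\<dots> = w k" using w k by (intro M.M.finsum_singleton) auto
  finally show "?h (basis_vec R n k) = w k" .
qed

lemma free_module_hom_eqI:
  assumes M: "module R M" and h: "h \<in> module_homs R (free_module R n) M"
    and h': "h' \<in> module_homs R (free_module R n) M"
    and eq: "\<And>k. k < n \<Longrightarrow> h (basis_vec R n k) = h' (basis_vec R n k)"
    and v: "v \<in> carrier (free_module R n)"
  shows "h v = h' v"
proof -
  note F = free_module_is_module[of n]
  have "v \<in> vectors n (carrier R)" using v by (simp add: free_module_simps)
  then show ?thesis
  proof (rule free_module_induct)
    show "h \<zero>\<^bsub>free_module R n\<^esub> = h' \<zero>\<^bsub>free_module R n\<^esub>"
      by (simp add: module_homs_zero[OF F M h] module_homs_zero[OF F M h'])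
  qed (auto simp: module_homsD[OF h] module_homsD[OF h'] eq free_module_simps(1)[symmetric])
qed

text \<open>
  Projectivity of free modules.  The maps between resolutions are obtained from it: comparison maps,
  homotopies, the lift of a differential from the quotient ring (with reduction modulo \<open>x\<close> as \<open>g\<close>),
  and division by \<open>x\<close> (with multiplication by \<open>x\<close> as \<open>g\<close>).
\<close>

lemma free_module_lift:
  assumes N: "module R N" and P: "module R P"
    and f: "f \<in> module_homs R (free_module R n) N" and g: "g \<in> module_homs R P N"
    and sub: "f ` carrier (free_module R n) \<subseteq> g ` carrier P"
  obtains h where "h \<in> module_homs R (free_module R n) P"
    "\<And>v. v \<in> carrier (free_module R n) \<Longrightarrow> g (h v) = f v"
proof -
  have "\<exists>p\<in>carrier P. g p = f (basis_vec R n k)" for k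
    using sub basis_vec_closed[of n k] by (metis imageE image_subset_iff)
  then obtain w where w: "\<And>k. w k \<in> carrier P" "\<And>k. g (w k) = f (basis_vec R n k)" by metis
  obtain h where h: "h \<in> module_homs R (free_module R n) P" "\<And>k. k < n \<Longrightarrow> h (basis_vec R n k) = w k"
    by (rule free_module_hom_exists[OF P, of n w]) (use w(1) in auto)
  have "g (h v) = f v" if "v \<in> carrier (free_module R n)" for v
    using free_module_hom_eqI[OF N module_homs_comp[OF h(1) g] f _ that] h(2) w(2) by simp
  with h(1) show thesis by (rule that)
qed

lemma ideal_smult_free_module:
  assumes I: "ideal I R"
  shows "ideal_smult I (free_module R n) = vectors n I"
proof
  interpret I: ideal I R by fact
  let ?X = "{a \<odot>\<^bsub>free_module R n\<^esub> v | a v. a \<in> I \<and> v \<in> carrier (free_module R n)}"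
  have Ic: "a \<in> I \<Longrightarrow> a \<in> carrier R" for a by (rule I.Icarr)
  have I1: "vectors n I \<subseteq> carrier (free_module R n)" 
    unfolding free_module_simps by (rule PiE_mono) (rule subsetI, erule Ic)
  have X: "?X \<subseteq> vectors n I" 
  proof (rule subsetI, elim CollectE exE conjE, hypsubst)
    fix a v assume "a \<in> I" "v \<in> carrier (free_module R n)"
    then show "a \<odot>\<^bsub>free_module R n\<^esub> v \<in> vectors n I"
      unfolding free_module_simps by (intro restrict_PiE_iff[THEN iffD2] ballI I.I_r_closed) auto
  qed
  show "ideal_smult I (free_module R n) \<subseteq> vectors n I"
  proof
    fix v assume "v \<in> ideal_smult I (free_module R n)"
    then have "v \<in> generate (add_monoid (free_module R n)) ?X" by (simp add: ideal_smult_def)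
    then show "v \<in> vectors n I"
    proof induction
      case one
      have "(\<lambda>k\<in>{..<n}. \<zero>) \<in> vectors n I" using I.zero_closed by (intro restrict_PiE_iff[THEN iffD2] ballI)
      then show ?case by (simp only: monoid.select_convs free_module_simps(2))
    next
      case (incl h)
      then show ?case using X by blast
    next
      case (inv h)
      then have h: "h \<in> vectors n I" using X by blast
      then have "inv\<^bsub>add_monoid (free_module R n)\<^esub> h = (\<lambda>k\<in>{..<n}. \<ominus> h k)"
        using free_module_minus[of h n] I1 by (auto simp: a_inv_def)
      moreover have "(\<lambda>k\<in>{..<n}. \<ominus> h k) \<in> vectors n I" using h by (simp add: PiE_iff)
      ultimately show ?case by (simp only:)
    next
      case (eng h1 h2)
      then have "(\<lambda>k\<in>{..<n}. h1 k \<oplus> h2 k) \<in> vectors n I"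
        by (simp add: PiE_iff)
      then show ?case by (simp only: monoid.select_convs free_module_simps(3))
    qed
  qed
  show "vectors n I \<subseteq> ideal_smult I (free_module R n)"
  proof
    fix v assume "v \<in> vectors n I"
    then have "v \<in> generate (add_monoid (free_module R n)) ?X"
    proof (rule free_module_induct)
      show "I \<subseteq> carrier R" using Ic by blast
      show "\<zero>\<^bsub>free_module R n\<^esub> \<in> generate (add_monoid (free_module R n)) ?X"
        using generate.one[of "add_monoid (free_module R n)"] by simp
      show "u \<oplus>\<^bsub>free_module R n\<^esub> w \<in> generate (add_monoid (free_module R n)) ?X"
        if "u \<in> generate (add_monoid (free_module R n)) ?X" "w \<in> generate (add_monoid (free_module R n)) ?X" for u w
        using generate.eng[OF that] by simp
      show "a \<odot>\<^bsub>free_module R n\<^esub> basis_vec R n k \<in> generate (add_monoid (free_module R n)) ?X"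
        if "a \<in> I" for a k
        using that basis_vec_closed by (intro generate.incl) blast
    qed simp
    then show "v \<in> ideal_smult I (free_module R n)" by (simp add: ideal_smult_def)
  qed
qed

text \<open>
  This covers the two ways in which a homomorphism acts on the filtration by powers of the maximal
  ideal: \<open>J\<close> is the whole ring for an arbitrary map, which preserves the filtration, and \<open>J\<close> is the
  maximal ideal for a minimal differential, which raises it.
\<close>

lemma module_homs_ideal_vectors:
  assumes h: "h \<in> module_homs R (free_module R n) (free_module R m)"
    and I: "ideal I R" and K: "ideal K R"
    and im: "h ` carrier (free_module R n) \<subseteq> vectors m J"
    and IJ: "\<And>a b. a \<in> I \<Longrightarrow> b \<in> J \<Longrightarrow> a \<otimes> b \<in> K"
    and v: "v \<in> vectors n I"
  shows "h v \<in> vectors m K"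
proof -
  interpret I: ideal I R by fact
  interpret K: ideal K R by fact
  have Ic: "I \<subseteq> carrier R" using I.Icarr by blast
  have IF: "u \<in> carrier (free_module R n)" if "u \<in> vectors n I" for u
    using that Ic by (auto simp: free_module_simps PiE_iff)
  show ?thesis using v Ic
  proof (rule free_module_induct)
    show "h \<zero>\<^bsub>free_module R n\<^esub> \<in> vectors m K"
      using module_homs_zero[OF free_module_is_module free_module_is_module h]
      by (auto simp: free_module_simps)
  next
    fix a k assume a: "a \<in> I" "k < n"
    have "h (basis_vec R n k) \<in> vectors m J" using im basis_vec_closed by blast
    then have "(\<lambda>i\<in>{..<m}. a \<otimes> h (basis_vec R n k) i) \<in> vectors m K"
      using IJ a by auto
    moreover have "h (a \<odot>\<^bsub>free_module R n\<^esub> basis_vec R n k) = (\<lambda>i\<in>{..<m}. a \<otimes> h (basis_vec R n k) i)"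
      using module_homsD(3)[OF h, of a] a Ic by (auto simp: free_module_simps(4)[of R m])
    ultimately show "h (a \<odot>\<^bsub>free_module R n\<^esub> basis_vec R n k) \<in> vectors m K" by simp
  next
    fix u w assume uw: "u \<in> vectors n I" "w \<in> vectors n I"
      "h u \<in> vectors m K" "h w \<in> vectors m K"
    have "h (u \<oplus>\<^bsub>free_module R n\<^esub> w) = (\<lambda>k\<in>{..<m}. h u k \<oplus> h w k)"
      using module_homsD(2)[OF h] IF uw(1,2) by (simp add: free_module_simps(3)[of R m])
    then show "h (u \<oplus>\<^bsub>free_module R n\<^esub> w) \<in> vectors m K"
      using uw(3,4) by (auto simp: PiE_iff)
  qed simp
qed

lemma free_module_apply:
  assumes "k < n"
  shows "\<zero>\<^bsub>free_module R n\<^esub> k = \<zero>"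
    and "(u \<oplus>\<^bsub>free_module R n\<^esub> v) k = u k \<oplus> v k"
    and "(a \<odot>\<^bsub>free_module R n\<^esub> v) k = a \<otimes> v k"
    and "v \<in> carrier (free_module R n) \<Longrightarrow> (\<ominus>\<^bsub>free_module R n\<^esub> v) k = \<ominus> v k"
    and "u \<in> carrier (free_module R n) \<Longrightarrow> v \<in> carrier (free_module R n) \<Longrightarrow>
           (u \<ominus>\<^bsub>free_module R n\<^esub> v) k = u k \<ominus> v k"
  using assms by (simp_all only: free_module_simps free_module_minus free_module_diff restrict_apply' lessThan_iff)

lemma free_module_eqI:
  assumes "u \<in> carrier (free_module R n)" "v \<in> carrier (free_module R n)" "\<And>k. k < n \<Longrightarrow> u k = v k"
  shows "u = v"
  using assms(3) by (intro PiE_ext[OF assms(1,2)[unfolded free_module_simps]]) simp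

lemma free_module_closed: "v \<in> carrier (free_module R n) \<Longrightarrow> k < n \<Longrightarrow> v k \<in> carrier R"
  by (auto simp: free_module_simps(1))

lemma ideal_vectorsI:
  "v \<in> carrier (free_module R n) \<Longrightarrow> (\<And>k. k < n \<Longrightarrow> v k \<in> I) \<Longrightarrow> v \<in> vectors n I"
  by (simp add: free_module_simps(1) PiE_iff)

lemma ideal_vectors_subset:
  assumes "ideal I R"
  shows "vectors n I \<subseteq> carrier (free_module R n)"
  unfolding free_module_simps by (rule PiE_mono) (auto simp: ideal.Icarr[OF assms])

lemma ideal_minus_closed:
  assumes "ideal I R" "a \<in> I" "b \<in> I"
  shows "a \<ominus> b \<in> I"
proof -
  interpret ideal I R by fact
  show ?thesis using assms(2,3) by (simp add: a_minus_def)
qed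

lemma ideal_vectors_closed:
  assumes I: "ideal I R" and u: "u \<in> vectors n I" and v: "v \<in> vectors n I"
  shows "u \<oplus>\<^bsub>free_module R n\<^esub> v \<in> vectors n I" "u \<ominus>\<^bsub>free_module R n\<^esub> v \<in> vectors n I"
    "\<ominus>\<^bsub>free_module R n\<^esub> v \<in> vectors n I" "\<zero>\<^bsub>free_module R n\<^esub> \<in> vectors n I"
proof -
  interpret I: ideal I R by fact
  have c: "u \<in> carrier (free_module R n)" "v \<in> carrier (free_module R n)"
    using u v ideal_vectors_subset[OF I] by auto
  have k: "k < n \<Longrightarrow> u k \<in> I" "k < n \<Longrightarrow> v k \<in> I" for k using u v by auto
  show "u \<oplus>\<^bsub>free_module R n\<^esub> v \<in> vectors n I"
    unfolding free_module_simps by (rule restrict_PiE_iff[THEN iffD2]) (simp add: k)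
  show "u \<ominus>\<^bsub>free_module R n\<^esub> v \<in> vectors n I"
    unfolding free_module_diff[OF c] by (rule restrict_PiE_iff[THEN iffD2]) (simp add: k ideal_minus_closed[OF I])
  show "\<ominus>\<^bsub>free_module R n\<^esub> v \<in> vectors n I"
    unfolding free_module_minus[OF c(2)] by (rule restrict_PiE_iff[THEN iffD2]) (simp add: k)
  show "\<zero>\<^bsub>free_module R n\<^esub> \<in> vectors n I"
    unfolding free_module_simps by (rule restrict_PiE_iff[THEN iffD2]) simp
qed


section \<open>Powers of ideals\<close>

lemma ideals_set_simps [simp]:
  "\<one>\<^bsub>ideals_set R\<^esub> = carrier R" "monoid.mult (ideals_set R) = ideal_prod R"
  by (simp_all add: ideals_set_def)

lemma ideal_pow_ideal:
  assumes "ideal I R"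
  shows "ideal (ideal_pow R I n) R"
proof -
  interpret S: comm_monoid "ideals_set R" by (rule ideals_set_is_comm_monoid)
  show ?thesis using S.nat_pow_closed[of I n] assms by (simp add: ideals_set_def)
qed

lemma ideal_pow_Suc: "ideal_pow R I (Suc n) = ideal_prod R (ideal_pow R I n) I"
proof -
  interpret S: comm_monoid "ideals_set R" by (rule ideals_set_is_comm_monoid)
  show ?thesis using S.nat_pow_Suc[of I n] by (simp add: ideals_set_def)
qed

lemma ideal_pow_Suc0 [simp]: "ideal I R \<Longrightarrow> ideal_pow R I (Suc 0) = I"
  using ideal_prod_one[of I] ideal_prod_commute[OF oneideal, of I] by (simp add: ideal_pow_Suc)

lemma ideal_pow_carrier: "ideal I R \<Longrightarrow> ideal_pow R I n \<subseteq> carrier R"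
  using ideal.Icarr[OF ideal_pow_ideal] by (rule subsetI)

lemma ideal_pow_antimono:
  assumes "ideal I R" "m \<le> n"
  shows "ideal_pow R I n \<subseteq> ideal_pow R I m"
  using assms(2)
proof (induction n rule: dec_induct)
  case (step n)
  then show ?case
    using ideal_prod_inter[OF ideal_pow_ideal[OF assms(1)] assms(1), of n] by (auto simp: ideal_pow_Suc)
qed simp

lemma ideal_pow_mult:
  assumes "ideal I R" "a \<in> ideal_pow R I p" "b \<in> ideal_pow R I q"
  shows "a \<otimes> b \<in> ideal_pow R I (p + q)"
proof -
  interpret S: comm_monoid "ideals_set R" by (rule ideals_set_is_comm_monoid)
  have "ideal_pow R I (p + q) = ideal_prod R (ideal_pow R I p) (ideal_pow R I q)"
    using S.nat_pow_mult[of I p q] assms(1) by (simp add: ideals_set_def)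
  then show ?thesis using assms(2,3) by (auto intro: ideal_prod.prod)
qed

lemma ideal_prod_least:
  assumes K: "ideal K R" and "\<And>a b. a \<in> I \<Longrightarrow> b \<in> J \<Longrightarrow> a \<otimes> b \<in> K"
  shows "ideal_prod R I J \<subseteq> K"
proof
  interpret K: ideal K R by fact
  fix s assume "s \<in> ideal_prod R I J"
  then show "s \<in> K" by induction (auto simp: assms(2))
qed

lemma ideal_pow_mono:
  assumes "ideal I R" "ideal J R" "I \<subseteq> J"
  shows "ideal_pow R I n \<subseteq> ideal_pow R J n"
proof (induction n)
  case (Suc n)
  have "ideal (ideal_prod R (ideal_pow R J n) J) R"
    by (intro ideal_prod_is_ideal ideal_pow_ideal assms)
  then have "ideal_prod R (ideal_pow R I n) I \<subseteq> ideal_prod R (ideal_pow R J n) J"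
    by (rule ideal_prod_least) (use Suc assms in \<open>blast intro: ideal_prod.prod\<close>)
  then show ?case by (simp only: ideal_pow_Suc)
qed simp

lemma ideal_pow_pow:
  assumes "ideal I R"
  shows "ideal_pow R (ideal_pow R I m) n = ideal_pow R I (m * n)"
proof -
  interpret S: comm_monoid "ideals_set R" by (rule ideals_set_is_comm_monoid)
  show ?thesis using S.nat_pow_pow[of I m n] assms by (simp add: ideals_set_def)
qed

text \<open>The ideal \<open>L + R y\<close>.\<close>

definition adjoin :: "'a set \<Rightarrow> 'a \<Rightarrow> 'a set" where
  "adjoin L y = {l \<oplus> r \<otimes> y | l r. l \<in> L \<and> r \<in> carrier R}"

lemma adjoin_ideal:
  assumes L: "ideal L R" and y: "y \<in> carrier R"
  shows "ideal (adjoin L y) R" "L \<subseteq> adjoin L y" "y \<in> adjoin L y"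
proof -
  interpret L: ideal L R by fact
  have "adjoin L y = L <+> PIdl y"
    unfolding adjoin_def set_add_def' cgenideal_def by blast
  then show "ideal (adjoin L y) R"
    using add_ideals[OF L cgenideal_ideal[OF y]] by simp
  show "L \<subseteq> adjoin L y"
  proof
    fix l assume l: "l \<in> L"
    then have "l = l \<oplus> \<zero> \<otimes> y" using y L.Icarr by simp
    with l show "l \<in> adjoin L y" unfolding adjoin_def by blast
  qed
  have "y = \<zero> \<oplus> \<one> \<otimes> y" using y by simp
  then show "y \<in> adjoin L y" unfolding adjoin_def using L.zero_closed by blast
qed

text \<open>
  In the product of two ideals \<open>I + R y\<close> and \<open>J + R z\<close> there are four kinds of terms.
\<close>

lemma adjoin_prod:
  assumes L: "ideal L R" and I: "ideal I R" and J: "ideal J R"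
    and yz: "y \<in> carrier R" "z \<in> carrier R" "w \<in> carrier R"
    and IJ: "\<And>a b. a \<in> I \<Longrightarrow> b \<in> J \<Longrightarrow> a \<otimes> b \<in> adjoin L w"
    and Iz: "\<And>a. a \<in> I \<Longrightarrow> a \<otimes> z \<in> adjoin L w"
    and Jy: "\<And>b. b \<in> J \<Longrightarrow> y \<otimes> b \<in> adjoin L w"
    and yzw: "y \<otimes> z \<in> adjoin L w"
  shows "ideal_prod R (adjoin I y) (adjoin J z) \<subseteq> adjoin L w"
proof (rule ideal_prod_least)
  show K: "ideal (adjoin L w) R" using L yz(3) by (rule adjoin_ideal)
  interpret K: ideal "adjoin L w" R by (rule K)
  fix a b assume "a \<in> adjoin I y" "b \<in> adjoin J z"
  then obtain i r j s where a: "a = i \<oplus> r \<otimes> y" "i \<in> I" "r \<in> carrier R"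
    and b: "b = j \<oplus> s \<otimes> z" "j \<in> J" "s \<in> carrier R" unfolding adjoin_def by blast
  have c: "i \<in> carrier R" "j \<in> carrier R"
    using a(2) b(2) ideal.Icarr[OF I] ideal.Icarr[OF J] by auto
  have "a \<otimes> b = (i \<otimes> j \<oplus> s \<otimes> (i \<otimes> z)) \<oplus> (r \<otimes> (y \<otimes> j) \<oplus> (r \<otimes> s) \<otimes> (y \<otimes> z))"
    unfolding a(1) b(1) using a(3) b(3) c yz by algebra
  moreover have "\<dots> \<in> adjoin L w"
    using a b by (intro K.a_closed K.I_l_closed IJ Iz Jy yzw) auto
  ultimately show "a \<otimes> b \<in> adjoin L w" by simp
qed

text \<open>
  This and the next lemma bound \<open>(J + R y)\<^sup>n\<^sup>k\<close> without a binomial formula: if \<open>J\<^sup>n \<subseteq> L\<close> then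
  \<open>(J + R y)\<^sup>n \<subseteq> L + R y\<close>, and \<open>(L + R y)\<^sup>k \<subseteq> L + R y\<^sup>k\<close>.
\<close>

lemma ideal_pow_adjoin:
  assumes J: "ideal J R" and y: "y \<in> carrier R"
  shows "ideal_pow R (adjoin J y) n \<subseteq> adjoin (ideal_pow R J n) y"
proof (induction n)
  case 0
  show ?case using adjoin_ideal(2)[OF oneideal y] by simp
next
  case (Suc n)
  let ?K = "adjoin (ideal_pow R J (Suc n)) y"
  note Jn = ideal_pow_ideal[OF J]
  note K = adjoin_ideal[OF Jn y, of "Suc n"]
  have y_in: "y \<otimes> c \<in> ?K" "c \<otimes> y \<in> ?K" if "c \<in> carrier R" for c
    using K(3) ideal.I_l_closed[OF K(1)] ideal.I_r_closed[OF K(1)] that by auto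
  have "ideal_prod R (adjoin (ideal_pow R J n) y) (adjoin J y) \<subseteq> ?K"
    by (rule adjoin_prod[OF Jn Jn J y y y])
      (use K(2) y y_in ideal.Icarr[OF Jn] ideal.Icarr[OF J] in \<open>auto simp: ideal_pow_Suc intro: ideal_prod.prod\<close>)
  moreover have "ideal_prod R (ideal_pow R (adjoin J y) n) (adjoin J y)
      \<subseteq> ideal_prod R (adjoin (ideal_pow R J n) y) (adjoin J y)"
    by (rule ideal_prod_least)
      (use Suc in \<open>auto intro: ideal_prod.prod ideal_prod_is_ideal adjoin_ideal(1)[OF Jn y] adjoin_ideal(1)[OF J y]\<close>)
  ultimately show ?case by (simp add: ideal_pow_Suc)
qed

lemma ideal_pow_adjoin_power:
  assumes L: "ideal L R" and y: "y \<in> carrier R"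
  shows "ideal_pow R (adjoin L y) k \<subseteq> adjoin L (y [^] k)"
proof (induction k)
  case 0
  show ?case using adjoin_ideal(3)[OF L one_closed] ideal.one_imp_carrier[OF adjoin_ideal(1)[OF L one_closed]] by simp
next
  case (Suc k)
  have yk: "y [^] k \<in> carrier R" "y [^] Suc k \<in> carrier R" using y by auto
  note K = adjoin_ideal[OF L yk(2)]
  interpret L: ideal L R by fact
  have "ideal_prod R (adjoin L (y [^] k)) (adjoin L y) \<subseteq> adjoin L (y [^] Suc k)"
  proof (rule adjoin_prod[OF L L L yk(1) y yk(2)])
    show "a \<otimes> b \<in> adjoin L (y [^] Suc k)" if "a \<in> L" "b \<in> L" for a b
      by (rule subsetD[OF K(2) L.I_l_closed[OF that(2) L.Icarr[OF that(1)]]])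
    show "a \<otimes> y \<in> adjoin L (y [^] Suc k)" if "a \<in> L" for a
      by (rule subsetD[OF K(2) L.I_r_closed[OF that y]])
    show "y [^] k \<otimes> b \<in> adjoin L (y [^] Suc k)" if "b \<in> L" for b
      by (rule subsetD[OF K(2) L.I_l_closed[OF that yk(1)]])
    show "y [^] k \<otimes> y \<in> adjoin L (y [^] Suc k)" using K(3) by simp
  qed
  moreover have "ideal_prod R (ideal_pow R (adjoin L y) k) (adjoin L y)
      \<subseteq> ideal_prod R (adjoin L (y [^] k)) (adjoin L y)"
    by (rule ideal_prod_least)
      (use Suc in \<open>auto intro: ideal_prod.prod ideal_prod_is_ideal adjoin_ideal(1)[OF L] yk y\<close>)
  ultimately show ?case by (simp add: ideal_pow_Suc)
qed

end

section \<open>Noetherian local rings\<close>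

lemma (in noetherian_ring) exists_maximal_member:
  assumes "S \<noteq> {}" "\<And>I. I \<in> S \<Longrightarrow> ideal I R"
  obtains L where "L \<in> S" "\<And>J. J \<in> S \<Longrightarrow> L \<subseteq> J \<Longrightarrow> J = L"
proof -
  have "\<exists>L\<in>S. \<forall>J\<in>S. L \<subseteq> J \<longrightarrow> J = L"
  proof (rule subset_Zorn_nonempty)
    fix C assume C: "C \<noteq> {}" "subset.chain S C"
    then have "subset.chain {I. ideal I R} C" using assms(2) by (auto simp: subset_chain_def)
    then show "(\<Union>C) \<in> S" using ideal_chain_is_trivial[OF C(1)] C(2) by (auto simp: subset_chain_def)
  qed fact
  then show thesis using that by blast
qed

lemma noetherian_local_ringD:
  assumes "noetherian_local_ring R"
  shows "cring R" "noetherian_ring R" "maximalideal (max_ideal R) R" "ideal (max_ideal R) R"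
    "maximalideal I R \<Longrightarrow> I = max_ideal R"
proof -
  have *: "\<exists>!I. maximalideal I R" using assms by (simp add: noetherian_local_ring_def)
  show "cring R" "noetherian_ring R" using assms by (auto simp: noetherian_local_ring_def)
  show m: "maximalideal (max_ideal R) R" unfolding max_ideal_def by (rule theI'[OF *])
  then show "ideal (max_ideal R) R" by (rule maximalideal.axioms)
  show "maximalideal I R \<Longrightarrow> I = max_ideal R" using * m by blast
qed

lemma (in noetherian_ring) proper_ideal_le_maximal:
  assumes I: "ideal I R" "I \<noteq> carrier R"
  obtains L where "maximalideal L R" "I \<subseteq> L"
proof -
  obtain L where L: "ideal L R" "I \<subseteq> L" "L \<noteq> carrier R"
    and max: "\<And>J. ideal J R \<Longrightarrow> I \<subseteq> J \<Longrightarrow> J \<noteq> carrier R \<Longrightarrow> L \<subseteq> J \<Longrightarrow> J = L"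
    by (rule exists_maximal_member[of "{L. ideal L R \<and> I \<subseteq> L \<and> L \<noteq> carrier R}"]) (use I in auto)
  have "maximalideal L R"
    by (rule maximalidealI) (use L max in blast)+
  then show thesis using L(2) by (rule that)
qed

lemma unit_if_not_in_max_ideal:
  fixes R (structure)
  assumes R: "noetherian_local_ring R" and y: "y \<in> carrier R" "y \<notin> max_ideal R"
  obtains z where "z \<in> carrier R" "z \<otimes>\<^bsub>R\<^esub> y = \<one>\<^bsub>R\<^esub>"
proof -
  note D = noetherian_local_ringD[OF R]
  interpret cring R by (rule D)
  interpret noetherian_ring R by (rule D)
  note P = cgenideal_ideal[OF y(1)]
  have "PIdl y = carrier R"
  proof (rule ccontr)
    assume "PIdl y \<noteq> carrier R"
    then obtain L where "maximalideal L R" "PIdl y \<subseteq> L" using proper_ideal_le_maximal[OF P] by blast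
    then show False using y(2) D(5) cgenideal_self[OF y(1)] by blast
  qed
  then have "\<one> \<in> PIdl y" by simp
  then show thesis using that unfolding cgenideal_def by (smt (verit) mem_Collect_eq)
qed

text \<open>
  The form of Nakayama's lemma that is needed: \<open>1 - y\<close> is a unit.
\<close>

lemma in_ideal_if_one_minus_max:
  fixes R (structure)
  assumes R: "noetherian_local_ring R" and y: "y \<in> max_ideal R" and L: "ideal L R"
    and a: "a \<in> carrier R" "a \<ominus>\<^bsub>R\<^esub> y \<otimes>\<^bsub>R\<^esub> a \<in> L"
  shows "a \<in> L"
proof -
  note D = noetherian_local_ringD[OF R]
  interpret cring R by (rule D)
  interpret m: maximalideal "max_ideal R" R by (rule D)
  interpret L: ideal L R by fact
  have yc: "y \<in> carrier R" using y by (rule m.Icarr)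
  have "\<one> \<ominus> y \<notin> max_ideal R"
  proof
    assume "\<one> \<ominus> y \<in> max_ideal R"
    then have "(\<one> \<ominus> y) \<oplus> y \<in> max_ideal R" using y by simp
    moreover have "(\<one> \<ominus> y) \<oplus> y = \<one>" using yc by algebra
    ultimately show False using m.one_imp_carrier m.I_notcarr by auto
  qed
  then obtain z where z: "z \<in> carrier R" "z \<otimes> (\<one> \<ominus> y) = \<one>"
    using unit_if_not_in_max_ideal[OF R, of "\<one> \<ominus> y"] yc by auto
  have "z \<otimes> (a \<ominus> y \<otimes> a) = (z \<otimes> (\<one> \<ominus> y)) \<otimes> a" using z(1) a(1) yc by algebra
  then have "z \<otimes> (a \<ominus> y \<otimes> a) = a" using z a by simp
  then show ?thesis using L.I_l_closed[OF a(2) z(1)] by simp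
qed

text \<open>
  Let \<open>L\<close> be an ideal maximal among those that do not contain the given element \<open>a\<close>.  Maximality
  and Nakayama give \<open>\<mm> a \<subseteq> L\<close>, and from this every \<open>y \<in> \<mm>\<close> has a power in \<open>L\<close>.  Hence a power of
  \<open>\<mm>\<close> lies in \<open>L\<close>, so \<open>a\<close> is not in that power.
\<close>

theorem krull_intersection:
  fixes R (structure)
  assumes R: "noetherian_local_ring R" and a: "\<And>k. a \<in> ideal_pow R (max_ideal R) k"
  shows "a = \<zero>\<^bsub>R\<^esub>"
proof (rule ccontr)
  assume a0: "a \<noteq> \<zero>\<^bsub>R\<^esub>"
  note D = noetherian_local_ringD[OF R]
  let ?m = "max_ideal R"
  interpret cring R by (rule D)
  interpret noetherian_ring R by (rule D)
  have ac: "a \<in> carrier R" using a[of 0] by simp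
  obtain L where L: "ideal L R" "a \<notin> L" and max: "\<And>J. ideal J R \<Longrightarrow> a \<notin> J \<Longrightarrow> L \<subseteq> J \<Longrightarrow> J = L"
    by (rule exists_maximal_member[of "{L. ideal L R \<and> a \<notin> L}"]) (use zeroideal a0 in auto)
  interpret L: ideal L R by (rule L)
  interpret m: ideal ?m R by (rule D)
  have step: "\<exists>l\<in>L. \<exists>r\<in>carrier R. a = l \<oplus> r \<otimes> y" if "y \<in> carrier R" "y \<notin> L" for y
  proof -
    have "adjoin L y \<noteq> L" using that adjoin_ideal(3)[OF L(1)] by blast
    then have "a \<in> adjoin L y" using max adjoin_ideal[OF L(1) that(1)] by blast
    then show ?thesis unfolding adjoin_def by blast
  qed
  have ma: "y \<otimes> a \<in> L" if y: "y \<in> ?m" for y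
  proof (rule ccontr)
    assume "y \<otimes> a \<notin> L"
    moreover have yc: "y \<in> carrier R" using y by (rule m.Icarr)
    ultimately obtain l r where l: "l \<in> L" "r \<in> carrier R" "a = l \<oplus> r \<otimes> (y \<otimes> a)"
      using step[of "y \<otimes> a"] ac by auto
    have "a \<ominus> (r \<otimes> y) \<otimes> a = l"
    proof -
      have "(l \<oplus> r \<otimes> (y \<otimes> a)) \<ominus> (r \<otimes> y) \<otimes> a = l" using l(1,2) L.Icarr yc ac by algebra
      then show ?thesis using l(3) by simp
    qed
    then show False
      using in_ideal_if_one_minus_max[OF R _ L(1) ac, of "r \<otimes> y"] l m.I_l_closed[OF y l(2)] L(2) by simp
  qed
  have yk: "\<exists>k. y [^] (k::nat) \<in> L" if y: "y \<in> ?m" for y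
  proof (rule ccontr)
    assume no: "\<nexists>k. y [^] (k::nat) \<in> L"
    have yc: "y \<in> carrier R" using y by (rule m.Icarr)
    \<comment> \<open>The chain of ideals \<open>(L : y\<^sup>k)\<close> becomes stationary.\<close>
    define Q where "Q k = {r \<in> carrier R. r \<otimes> y [^] (k::nat) \<in> L}" for k
    have Q: "ideal (Q k) R" for k
    proof -
      have mult: "x \<otimes> r \<in> Q k" "r \<otimes> x \<in> Q k" if r: "r \<in> Q k" "x \<in> carrier R" for r x
      proof -
        have "(x \<otimes> r) \<otimes> y [^] k = x \<otimes> (r \<otimes> y [^] k)"
          using that yc by (simp add: Q_def m_assoc)
        then show "x \<otimes> r \<in> Q k" using that L.I_l_closed by (simp add: Q_def)
        then show "r \<otimes> x \<in> Q k" using that by (simp add: Q_def m_comm)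
      qed
      show ?thesis
      proof (rule idealI)
      show "subgroup (Q k) (add_monoid R)"
      proof
        fix r assume r: "r \<in> Q k"
        then have "(\<ominus> r) \<otimes> y [^] k = \<ominus> (r \<otimes> y [^] k)" using yc by (simp add: Q_def l_minus)
        with r show "inv\<^bsub>add_monoid R\<^esub> r \<in> Q k" by (simp add: Q_def a_inv_def[symmetric])
      qed (use yc in \<open>auto simp: Q_def l_distr\<close>)
      qed (auto simp: ring_axioms mult)
    qed
    have mono: "Q k \<subseteq> Q (Suc k)" for k
      using L.I_r_closed yc by (auto simp: Q_def m_assoc[symmetric])
    obtain K where K: "K \<in> range Q" "\<And>J. J \<in> range Q \<Longrightarrow> K \<subseteq> J \<Longrightarrow> J = K"
      by (rule exists_maximal_member[of "range Q"]) (use Q in auto)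
    then obtain k where k: "K = Q k" by blast
    then have eq: "Q (Suc k) = Q k" using K(2)[of "Q (Suc k)"] mono by auto
    obtain l r where l: "l \<in> L" "r \<in> carrier R" "a = l \<oplus> r \<otimes> y [^] k"
      using step[of "y [^] k"] no yc by auto
    \<comment> \<open>Multiplying by \<open>y\<close> moves \<open>a\<close> into \<open>L\<close>, so \<open>r \<in> (L : y\<^sup>k\<^sup>+\<^sup>1) = (L : y\<^sup>k)\<close>.\<close>
    have "r \<otimes> y [^] Suc k = y \<otimes> a \<ominus> y \<otimes> l"
      using l(1,2) L.Icarr yc nat_pow_closed[OF yc, of k] unfolding l(3) nat_pow_Suc by algebra
    moreover have "y \<otimes> a \<ominus> y \<otimes> l \<in> L" using ma[OF y] L.I_l_closed[OF l(1) yc] ideal_minus_closed[OF L(1)] by simp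
    ultimately have "r \<in> Q (Suc k)" using l(2) by (simp add: Q_def)
    then have "r \<otimes> y [^] k \<in> L" unfolding eq by (simp add: Q_def)
    then have "a \<in> L" unfolding l(3) using l(1) by simp
    then show False using L(2) by blast
  qed
  \<comment> \<open>A largest ideal inside \<open>\<mm>\<close> with a power in \<open>L\<close> absorbs every \<open>y \<in> \<mm>\<close>.\<close>
  let ?S = "{J. ideal J R \<and> J \<subseteq> ?m \<and> (\<exists>n. ideal_pow R J n \<subseteq> L)}"
  have "ideal_pow R {\<zero>} (Suc 0) \<subseteq> L"
    unfolding ideal_pow_Suc0[OF zeroideal] using L.zero_closed by simp
  then have "{\<zero>} \<in> ?S" using zeroideal m.zero_closed by blast
  then obtain J where J': "J \<in> ?S" and Jmax: "\<And>J'. J' \<in> ?S \<Longrightarrow> J \<subseteq> J' \<Longrightarrow> J' = J"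
    using exists_maximal_member[of ?S] by blast
  then have J: "ideal J R" "J \<subseteq> ?m" "\<exists>n. ideal_pow R J n \<subseteq> L" by auto
  obtain n where n: "ideal_pow R J n \<subseteq> L" using J(3) by blast
  have "?m \<subseteq> J"
  proof
    fix y assume y: "y \<in> ?m"
    have yc: "y \<in> carrier R" using y by (rule m.Icarr)
    obtain k where k: "y [^] (k::nat) \<in> L" using yk[OF y] by blast
    note Jy = adjoin_ideal[OF J(1) yc]
    have "adjoin J y \<subseteq> ?m" unfolding adjoin_def using J(2) y by (auto intro!: m.a_closed m.I_l_closed)
    moreover have "ideal_pow R (adjoin J y) (n * k) \<subseteq> L"
    proof -
      have "ideal_pow R (adjoin J y) (n * k) = ideal_pow R (ideal_pow R (adjoin J y) n) k"
        by (rule ideal_pow_pow[OF Jy(1), symmetric])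
      also have "\<dots> \<subseteq> ideal_pow R (adjoin L y) k"
      proof (rule ideal_pow_mono[OF ideal_pow_ideal[OF Jy(1)] adjoin_ideal(1)[OF L(1) yc]])
        show "ideal_pow R (adjoin J y) n \<subseteq> adjoin L y"
          using ideal_pow_adjoin[OF J(1) yc, of n] n unfolding adjoin_def by blast
      qed
      also have "\<dots> \<subseteq> adjoin L (y [^] k)" by (rule ideal_pow_adjoin_power[OF L(1) yc])
      also have "\<dots> \<subseteq> L" unfolding adjoin_def using k by (auto intro!: L.a_closed L.I_l_closed)
      finally show ?thesis .
    qed
    ultimately have "adjoin J y = J" using Jmax Jy(1,2) by blast
    then show "y \<in> J" using Jy(3) by simp
  qed
  then have "ideal_pow R ?m n \<subseteq> L" using ideal_pow_mono[OF D(4) J(1), of n] n by blast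
  then show False using a L(2) by blast
qed

section \<open>Regular initial forms\<close>

text \<open>Successor powers of ideals occur as moduli and are to stay folded from here on.\<close>

declare Group.nat_pow_Suc [simp del]

context cring
begin

lemma rcoset_mult_ideal_pow:
  assumes I: "ideal I R" and c: "c \<in> ideal_pow R I i" "c' \<in> ideal_pow R I j"
    and cc': "c \<otimes> c' \<in> ideal_pow R I (Suc (i + j))"
  shows "rcoset_mult R (ideal_pow R I (Suc (i + j))) (ideal_pow R I (Suc i) +> c) (ideal_pow R I (Suc j) +> c')
    = ideal_pow R I (Suc (i + j))"
proof -
  let ?K = "ideal_pow R I (Suc (i + j))"
  note P = ideal_pow_ideal[OF I]
  interpret K: ideal ?K R by (rule P)
  interpret Ki: ideal "ideal_pow R I (Suc i)" R by (rule P)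
  interpret Kj: ideal "ideal_pow R I (Suc j)" R by (rule P)
  note car = subsetD[OF ideal_pow_carrier[OF I]]
  have mem: "a \<otimes> b \<in> ?K" if ab: "a \<in> ideal_pow R I (Suc i) +> c" "b \<in> ideal_pow R I (Suc j) +> c'" for a b
  proof -
    obtain k k' where k: "k \<in> ideal_pow R I (Suc i)" "a = k \<oplus> c"
      and k': "k' \<in> ideal_pow R I (Suc j)" "b = k' \<oplus> c'"
      using ab by (auto simp: a_r_coset_def' simp del: nat_pow_Suc)
    have k1: "k' \<in> ideal_pow R I j"
      using k'(1) ideal_pow_antimono[OF I, of j "Suc j"] by (metis le_SucI le_refl subsetD)
    have "a \<otimes> b = (k \<otimes> k' \<oplus> k \<otimes> c') \<oplus> (c \<otimes> k' \<oplus> c \<otimes> c')"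
      unfolding k(2) k'(2) using car[OF k(1)] car[OF k'(1)] car[OF c(1)] car[OF c(2)] by algebra
    moreover have "k \<otimes> k' \<in> ?K" "k \<otimes> c' \<in> ?K" "c \<otimes> k' \<in> ?K"
      using ideal_pow_mult[OF I k(1) k1] ideal_pow_mult[OF I k(1) c(2)] ideal_pow_mult[OF I c(1) k'(1)]
      by (simp_all only: add_Suc add_Suc_right)
    ultimately show ?thesis using cc' by simp
  qed
  have ne: "ideal_pow R I (Suc i) +> c \<noteq> {}" "ideal_pow R I (Suc j) +> c' \<noteq> {}"
    using Ki.a_rcos_self[OF car[OF c(1)]] Kj.a_rcos_self[OF car[OF c(2)]] by blast+
  have "?K +> a \<otimes> b = ?K" if "a \<in> ideal_pow R I (Suc i) +> c" "b \<in> ideal_pow R I (Suc j) +> c'" for a b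
    using mem[OF that] by (rule K.a_rcos_const)
  then show ?thesis unfolding rcoset_mult_def using ne by blast
qed

text \<open>
  If the initial form of \<open>x\<close> were to kill the class of \<open>r\<close> in \<open>I\<^sup>p / I\<^sup>p\<^sup>+\<^sup>1\<close>, then this class
  would be zero; so an element \<open>r\<close> of \<open>(I\<^sup>p\<^sup>+\<^sup>1 : x)\<close> climbs through the powers of \<open>I\<close> up to \<open>I\<^sup>p\<close>.
\<close>

lemma regular_initial_form_colon:
  assumes I: "ideal I R" and x: "x \<in> I"
    and reg: "nonzerodivisor (assoc_graded_ring R I) (degree_one_class R I x)"
    and r: "r \<in> carrier R" and xr: "x \<otimes> r \<in> ideal_pow R I (Suc p)"
  shows "r \<in> ideal_pow R I p"
  using xr
proof (induction p)
  case 0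
  show ?case using r by simp
next
  case (Suc p)
  note P = ideal_pow_ideal[OF I]
  note car = subsetD[OF ideal_pow_carrier[OF I]]
  have "x \<otimes> r \<in> ideal_pow R I (Suc p)"
    using Suc.prems ideal_pow_antimono[OF I, of "Suc p" "Suc (Suc p)"] by auto
  then have rp: "r \<in> ideal_pow R I p" by (rule Suc.IH)
  have zero: "\<zero> \<in> ideal_pow R I i" for i
    using additive_subgroup.zero_closed[OF ideal.axioms(1)[OF P]] .
  \<comment> \<open>\<open>?f\<close> is the class of \<open>r\<close>, homogeneous of degree \<open>p\<close>, in the associated graded ring.\<close>
  let ?c = "\<lambda>i. if i = p then r else \<zero>" and ?d = "\<lambda>i. if i = 1 then x else \<zero>"
  let ?f = "\<lambda>i. ideal_pow R I (Suc i) +> ?c i"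
  have c: "?c i \<in> ideal_pow R I i" for i using rp zero by simp
  have d: "?d i \<in> ideal_pow R I i" for i using x zero ideal_pow_Suc0[OF I] by simp
  let ?G = "assoc_graded_ring R I"
  have "?f i = ideal_pow R I (Suc i)" if "i \<noteq> p" for i
    using that a_coset_add_zero[OF ideal_pow_carrier[OF I]] by simp
  then have "{i. ?f i \<noteq> ideal_pow R I (Suc i)} \<subseteq> {p}" by blast
  then have fin: "finite {i. ?f i \<noteq> ideal_pow R I (Suc i)}" by (rule finite_subset) simp
  have mem: "?f i \<in> (\<lambda>a. ideal_pow R I (Suc i) +> a) ` ideal_pow R I i" for i
    by (rule imageI, rule c)
  have fG: "?f \<in> carrier ?G"
    unfolding assoc_graded_ring_def partial_object.select_convs mem_Collect_eq
    by (intro conjI allI mem fin)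
  have "(degree_one_class R I x \<otimes>\<^bsub>?G\<^esub> ?f) n = \<zero>\<^bsub>?G\<^esub> n" for n
  proof -
    let ?K = "ideal_pow R I (Suc n)"
    interpret K: ideal ?K R by (rule P)
    interpret Q: ring "R Quot ?K" by (rule K.quotient_is_ring)
    have "rcoset_mult R ?K (degree_one_class R I x i) (?f (n - i)) = ?K" if i: "i \<le> n" for i
    proof -
      have "?d i \<otimes> ?c (n - i) \<in> ?K"
      proof (cases "i = 1 \<and> n - i = p")
        case True
        then have "n = Suc p" using i by auto
        then show ?thesis using True Suc.prems by simp
      next
        case False
        have "x \<in> carrier R" using ideal.Icarr[OF I x] .
        with False have "?d i \<otimes> ?c (n - i) = \<zero>" using r by auto
        then show ?thesis using zero by simp
      qed
      then show ?thesis
        using rcoset_mult_ideal_pow[OF I d[of i] c[of "n - i"]] i by (simp add: degree_one_class_def)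
    qed
    then have "finsum (R Quot ?K) (\<lambda>i. rcoset_mult R ?K (degree_one_class R I x i) (?f (n - i))) {..n}
        = \<zero>\<^bsub>R Quot ?K\<^esub>"
      by (intro Q.add.finprod_one_eqI) (simp add: FactRing_def)
    then show ?thesis by (simp add: assoc_graded_ring_def FactRing_def)
  qed
  then have "degree_one_class R I x \<otimes>\<^bsub>?G\<^esub> ?f = \<zero>\<^bsub>?G\<^esub>" by (rule ext)
  then have "?f = \<zero>\<^bsub>?G\<^esub>" using reg fG by (simp add: nonzerodivisor_def)
  then have "?f p = \<zero>\<^bsub>?G\<^esub> p" by (rule fun_cong)
  then have "ideal_pow R I (Suc p) +> r = ideal_pow R I (Suc p)" by (simp add: assoc_graded_ring_def)
  then show ?case using ideal.rcos_const_imp_mem[OF P r] by simp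
qed

end

text \<open>
  If \<open>x r = 0\<close>, then \<open>r\<close> lies in \<open>(\<mm>\<^sup>k\<^sup>+\<^sup>1 : x) = \<mm>\<^sup>k\<close> for every \<open>k\<close>.
\<close>

lemma regular_initial_form_imp_cancel:
  fixes R (structure)
  assumes R: "noetherian_local_ring R" and x: "x \<in> max_ideal R"
    and reg: "nonzerodivisor (assoc_graded_ring R (max_ideal R)) (degree_one_class R (max_ideal R) x)"
    and r: "r \<in> carrier R" "x \<otimes> r = \<zero>"
  shows "r = \<zero>"
proof -
  note D = noetherian_local_ringD[OF R]
  interpret cring R by (rule D)
  have "\<zero> \<in> ideal_pow R (max_ideal R) k" for k
    using additive_subgroup.zero_closed[OF ideal.axioms(1)[OF ideal_pow_ideal[OF D(4)]]] .
  then have "r \<in> ideal_pow R (max_ideal R) k" for k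
    using regular_initial_form_colon[OF D(4) x reg r(1)] r(2) by simp
  then show ?thesis by (rule krull_intersection[OF R])
qed


section \<open>Surjections of local rings\<close>

locale surjective_ring_hom = ring_hom_cring R S h for R (structure) and S (structure) and h +
  assumes surj: "h ` carrier R = carrier S"
begin

lemma preimage_ideal: "ideal J S \<Longrightarrow> ideal {r \<in> carrier R. h r \<in> J} R"
  by (rule ring.ideal_vimage)

lemma image_ideal:
  assumes I: "ideal I R"
  shows "ideal (h ` I) S"
proof -
  interpret I: ideal I R by fact
  have lr: "b \<otimes>\<^bsub>S\<^esub> h a \<in> h ` I" "h a \<otimes>\<^bsub>S\<^esub> b \<in> h ` I" if a: "a \<in> I" and b: "b \<in> carrier S" for a b
  proof -
    obtain s where s: "s \<in> carrier R" "b = h s" using b surj by blast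
    have "b \<otimes>\<^bsub>S\<^esub> h a = h (s \<otimes> a)" "h a \<otimes>\<^bsub>S\<^esub> b = h (a \<otimes> s)" using s I.Icarr[OF a] by simp_all
    then show "b \<otimes>\<^bsub>S\<^esub> h a \<in> h ` I" "h a \<otimes>\<^bsub>S\<^esub> b \<in> h ` I"
      using I.I_l_closed[OF a s(1)] I.I_r_closed[OF a s(1)] by auto
  qed
  show ?thesis
  proof (rule idealI)
    show "subgroup (h ` I) (add_monoid S)"
    proof
      show "h ` I \<subseteq> carrier (add_monoid S)" using I.Icarr by auto
      fix u v assume "u \<in> h ` I" "v \<in> h ` I"
      then obtain a b where ab: "a \<in> I" "b \<in> I" "u = h a" "v = h b" by blast
      have "u \<oplus>\<^bsub>S\<^esub> v = h (a \<oplus> b)" using ab I.Icarr by simp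
      moreover have "h (a \<oplus> b) \<in> h ` I" by (rule imageI) (simp add: ab)
      ultimately show "u \<otimes>\<^bsub>add_monoid S\<^esub> v \<in> h ` I" by (simp only: monoid.select_convs)
      have "\<ominus>\<^bsub>S\<^esub> u = h (\<ominus> a)" using ab I.Icarr by simp
      moreover have "h (\<ominus> a) \<in> h ` I" by (rule imageI) (simp add: ab)
      ultimately show "inv\<^bsub>add_monoid S\<^esub> u \<in> h ` I" by (simp only: a_inv_def[symmetric])
    next
      have "h \<zero> \<in> h ` I" by (rule imageI) simp
      then show "\<one>\<^bsub>add_monoid S\<^esub> \<in> h ` I" by (simp only: monoid.select_convs hom_zero)
    qed
  qed (use lr S.ring_axioms in auto)
qed

lemma image_preimage: "J \<subseteq> carrier S \<Longrightarrow> h ` {r \<in> carrier R. h r \<in> J} = J"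
  using surj by (auto simp: image_iff)

lemma image_ideal_prod:
  assumes I: "ideal I R" and J: "ideal J R"
  shows "h ` ideal_prod R I J = ideal_prod S (h ` I) (h ` J)"
proof
  note Ic = ideal.Icarr[OF I] and Jc = ideal.Icarr[OF J]
  show "h ` ideal_prod R I J \<subseteq> ideal_prod S (h ` I) (h ` J)"
  proof
    fix v assume "v \<in> h ` ideal_prod R I J"
    then obtain s where s: "s \<in> ideal_prod R I J" "v = h s" by blast
    from s(1) have "s \<in> carrier R \<and> h s \<in> ideal_prod S (h ` I) (h ` J)"
      by induction (auto simp: Ic Jc intro: ideal_prod.intros)
    then show "v \<in> ideal_prod S (h ` I) (h ` J)" using s(2) by simp
  qed
  show "ideal_prod S (h ` I) (h ` J) \<subseteq> h ` ideal_prod R I J"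
  proof (rule S.ideal_prod_least)
    show "ideal (h ` ideal_prod R I J) S" by (intro image_ideal R.ideal_prod_is_ideal I J)
    fix u v assume "u \<in> h ` I" "v \<in> h ` J"
    then obtain a b where ab: "a \<in> I" "b \<in> J" "u = h a" "v = h b" by blast
    then have "u \<otimes>\<^bsub>S\<^esub> v = h (a \<otimes> b)" using Ic Jc by simp
    moreover have "h (a \<otimes> b) \<in> h ` ideal_prod R I J" by (intro imageI ideal_prod.prod ab)
    ultimately show "u \<otimes>\<^bsub>S\<^esub> v \<in> h ` ideal_prod R I J" by simp
  qed
qed

lemma image_ideal_pow:
  assumes I: "ideal I R"
  shows "h ` ideal_pow R I n = ideal_pow S (h ` I) n"
proof (induction n)
  case 0
  show ?case using surj by simp
next
  case (Suc n)
  then show ?case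
    by (simp only: R.ideal_pow_Suc S.ideal_pow_Suc image_ideal_prod[OF R.ideal_pow_ideal[OF I] I])
qed

lemma noetherian_image:
  assumes "noetherian_ring R"
  shows "noetherian_ring S"
proof (rule S.noetherian_ringI)
  fix J assume J: "ideal J S"
  interpret J: ideal J S by fact
  obtain A where A: "A \<subseteq> carrier R" "finite A" "{r \<in> carrier R. h r \<in> J} = Idl A"
    using noetherian_ring.finetely_gen[OF assms preimage_ideal[OF J]] by blast
  have AJ: "h ` A \<subseteq> J" using R.genideal_self[OF A(1)] A(3) by auto
  have hA: "h ` A \<subseteq> carrier S" using AJ J.Icarr by blast
  have "J \<subseteq> Idl\<^bsub>S\<^esub> (h ` A)"
  proof -
    have "A \<subseteq> {r \<in> carrier R. h r \<in> Idl\<^bsub>S\<^esub> (h ` A)}" using A(1) S.genideal_self[OF hA] by auto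
    then have "Idl A \<subseteq> {r \<in> carrier R. h r \<in> Idl\<^bsub>S\<^esub> (h ` A)}"
      by (intro R.genideal_minimal preimage_ideal S.genideal_ideal hA)
    then have "h ` {r \<in> carrier R. h r \<in> J} \<subseteq> Idl\<^bsub>S\<^esub> (h ` A)" unfolding A(3) by blast
    moreover have "h ` {r \<in> carrier R. h r \<in> J} = J" using J.Icarr by (intro image_preimage) blast
    ultimately show ?thesis by simp
  qed
  moreover have "Idl\<^bsub>S\<^esub> (h ` A) \<subseteq> J" by (rule S.genideal_minimal[OF J AJ])
  ultimately show "\<exists>A\<subseteq>carrier S. finite A \<and> J = Idl\<^bsub>S\<^esub> A" using A(2) hA by blast
qed

text \<open>
  The preimage of a maximal ideal of \<open>S\<close> is proper, hence contained in the maximal ideal of \<open>R\<close>;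
  so every maximal ideal of \<open>S\<close> is contained in the image of the latter.  The kernel has to lie in
  the maximal ideal for that image to be proper.
\<close>

lemma local_image:
  assumes R: "noetherian_local_ring R" and ker: "\<And>r. r \<in> carrier R \<Longrightarrow> h r = \<zero>\<^bsub>S\<^esub> \<Longrightarrow> r \<in> max_ideal R"
  shows "noetherian_local_ring S" "max_ideal S = h ` max_ideal R"
proof -
  note D = noetherian_local_ringD[OF R]
  interpret m: maximalideal "max_ideal R" R by (rule D)
  interpret NR: noetherian_ring R by (rule D)
  note n = image_ideal[OF D(4)]
  interpret NS: noetherian_ring S by (rule noetherian_image[OF D(2)])
  have proper: "h ` max_ideal R \<noteq> carrier S"
  proof
    assume "h ` max_ideal R = carrier S"
    then obtain r where r: "r \<in> max_ideal R" "h r = \<one>\<^bsub>S\<^esub>" by (metis S.one_closed imageE)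
    have rc: "r \<in> carrier R" using r(1) by (rule m.Icarr)
    have "h (\<one> \<ominus> r) = \<zero>\<^bsub>S\<^esub>" using r rc by (simp add: R.minus_eq S.r_neg)
    then have "\<one> \<ominus> r \<in> max_ideal R" using rc by (intro ker) auto
    then have "(\<one> \<ominus> r) \<oplus> r \<in> max_ideal R" using r(1) by simp
    moreover have "(\<one> \<ominus> r) \<oplus> r = \<one>" using rc by algebra
    ultimately show False using m.one_imp_carrier m.I_notcarr by auto
  qed
  have uniq: "J = h ` max_ideal R" if J: "maximalideal J S" for J
  proof -
    interpret J: maximalideal J S by fact
    let ?P = "{r \<in> carrier R. h r \<in> J}"
    have "?P \<noteq> carrier R"
    proof
      assume "?P = carrier R"
      then have "\<one> \<in> ?P" by simp
      then have "\<one>\<^bsub>S\<^esub> \<in> J" by simp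
      then show False using J.one_imp_carrier J.I_notcarr by auto
    qed
    then obtain L where "maximalideal L R" "?P \<subseteq> L"
      using NR.proper_ideal_le_maximal[OF preimage_ideal[OF J.is_ideal]] by blast
    then have "?P \<subseteq> max_ideal R" using D(5) by simp
    then have "h ` ?P \<subseteq> h ` max_ideal R" by (rule image_mono)
    moreover have "h ` ?P = J" using J.Icarr by (intro image_preimage) blast
    ultimately have "J \<subseteq> h ` max_ideal R" by simp
    moreover have "h ` max_ideal R \<subseteq> carrier S" using m.Icarr by auto
    ultimately show ?thesis using J.I_maximal[OF n] proper by blast
  qed
  obtain L where L: "maximalideal L S" using NS.proper_ideal_le_maximal[OF n proper] by blast
  then have ex: "\<exists>!J. maximalideal J S" using uniq by blast
  then show "noetherian_local_ring S"
    unfolding noetherian_local_ring_def using S.is_cring NS.noetherian_ring_axioms by simp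
  then show "max_ideal S = h ` max_ideal R" using uniq noetherian_local_ringD(3) by blast
qed

end

section \<open>Vanishing of the homology of the linear part\<close>

lemma subquotient:
  assumes M: "abelian_group M" and H: "additive_subgroup H M" and K: "additive_subgroup K M"
    and KH: "K \<subseteq> H"
  defines "Q \<equiv> (add_monoid M)\<lparr>carrier := H\<rparr> Mod K"
  shows "group Q" "carrier Q = (\<lambda>a. K +>\<^bsub>M\<^esub> a) ` H" "\<one>\<^bsub>Q\<^esub> = K"
    "a \<in> H \<Longrightarrow> b \<in> H \<Longrightarrow> (K +>\<^bsub>M\<^esub> a) \<otimes>\<^bsub>Q\<^esub> (K +>\<^bsub>M\<^esub> b) = K +>\<^bsub>M\<^esub> (a \<oplus>\<^bsub>M\<^esub> b)"
proof -
  interpret M: abelian_group M by fact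
  have sub: "subgroup H (add_monoid M)" "subgroup K (add_monoid M)"
    using H K by (auto simp: additive_subgroup_def)
  have cg: "comm_group ((add_monoid M)\<lparr>carrier := H\<rparr>)"
    by (rule group.group_comm_groupI[OF group.subgroup_imp_group[OF M.a_group sub(1)]])
      (use M.a_comm additive_subgroup.a_Hcarr[OF H] in auto)
  have "subgroup K ((add_monoid M)\<lparr>carrier := H\<rparr>)"
    using M.a_group sub(2,1) KH by (rule group.subgroup_incl)
  then have N: "K \<lhd> (add_monoid M)\<lparr>carrier := H\<rparr>" by (rule comm_group.subgroup_imp_normal[OF cg])
  show "group Q" unfolding Q_def by (rule normal.factorgroup_is_group[OF N])
  have rc: "K #>\<^bsub>(add_monoid M)\<lparr>carrier := H\<rparr>\<^esub> a = K +>\<^bsub>M\<^esub> a" for a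
    by (simp add: r_coset_def a_r_coset_def)
  show "carrier Q = (\<lambda>a. K +>\<^bsub>M\<^esub> a) ` H"
    unfolding Q_def FactGroup_def RCOSETS_def rc by auto
  show "\<one>\<^bsub>Q\<^esub> = K" by (simp add: Q_def FactGroup_def)
  show "(K +>\<^bsub>M\<^esub> a) \<otimes>\<^bsub>Q\<^esub> (K +>\<^bsub>M\<^esub> b) = K +>\<^bsub>M\<^esub> (a \<oplus>\<^bsub>M\<^esub> b)" if "a \<in> H" "b \<in> H"
    using normal.rcos_sum[OF N, of a b] that unfolding Q_def FactGroup_def rc by simp
qed

lemma coset_eq_iff:
  assumes M: "abelian_group M" and K: "additive_subgroup K M" and ab: "a \<in> carrier M" "b \<in> carrier M"
  shows "K +>\<^bsub>M\<^esub> a = K +>\<^bsub>M\<^esub> b \<longleftrightarrow> a \<ominus>\<^bsub>M\<^esub> b \<in> K"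
proof -
  interpret M: abelian_group M by fact
  interpret abelian_subgroup K M using K M by (rule abelian_subgroupI3)
  have "a \<ominus>\<^bsub>M\<^esub> b \<in> K \<longleftrightarrow> a \<in> K +>\<^bsub>M\<^esub> b" using a_rcos_module[OF ab(2,1)] by (simp add: M.minus_eq)
  also have "\<dots> \<longleftrightarrow> K +>\<^bsub>M\<^esub> a = K +>\<^bsub>M\<^esub> b"
    using a_repr_independence'[OF _ ab(2), of a] a_rcos_self[OF ab(1)] by auto
  finally show ?thesis by simp
qed

text \<open>
  Exactness of the linear part in degree \<open>i + 1\<close>, in terms of elements; only positive degrees are
  considered, which suffices for finiteness of the linearity defect.  The truncated exponents are
  those of the filtration; for \<open>n < i + 1\<close> the condition holds with \<open>c = 0\<close>.
\<close>

definition linear_part_exact ::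
  "('a, 'r) ring_scheme \<Rightarrow> (nat \<Rightarrow> nat) \<Rightarrow> (nat \<Rightarrow> (nat \<Rightarrow> 'a) \<Rightarrow> (nat \<Rightarrow> 'a)) \<Rightarrow> nat \<Rightarrow> bool"
where
  "linear_part_exact R b d i \<longleftrightarrow>
    (\<forall>n. \<forall>a \<in> vectors (b (Suc i)) (ideal_pow R (max_ideal R) (n - Suc i)).
       d (Suc i) a \<in> vectors (b i) (ideal_pow R (max_ideal R) (Suc n - i)) \<longrightarrow>
       (\<exists>c \<in> vectors (b (Suc (Suc i))) (ideal_pow R (max_ideal R) (n - Suc (Suc i))).
          a \<ominus>\<^bsub>free_module R (b (Suc i))\<^esub> d (Suc (Suc i)) c
            \<in> vectors (b (Suc i)) (ideal_pow R (max_ideal R) (Suc n - Suc i))))"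

locale minimal_complex = cring +
  fixes b :: "nat \<Rightarrow> nat" and d
  assumes ideal_m: "ideal (max_ideal R) R"
    and d_hom: "d (Suc i) \<in> module_homs R (free_module R (b (Suc i))) (free_module R (b i))"
    and d_min: "d (Suc i) ` carrier (free_module R (b (Suc i))) \<subseteq> vectors (b i) (max_ideal R)"
begin

abbreviation "F \<equiv> \<lambda>i. free_module R (b i)"
abbreviation "G n i \<equiv> vectors (b i) (ideal_pow R (max_ideal R) (n - i))"
abbreviation "cls n i a \<equiv> G (Suc n) i +>\<^bsub>F i\<^esub> a"
abbreviation "C \<equiv> lin_part R F"
abbreviation "D \<equiv> lin_diff R F d"

lemma G_filt_eq: "G_filt R F n i = G n i"
  unfolding G_filt_def by (rule ideal_smult_free_module[OF ideal_pow_ideal[OF ideal_m]])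

lemma F_abelian: "abelian_group (F i)"
  by (rule module.axioms(2)[OF free_module_is_module])

lemma G_carrier: "G n i \<subseteq> carrier (F i)"
  by (rule ideal_vectors_subset[OF ideal_pow_ideal[OF ideal_m]])

lemma G_additive_subgroup: "additive_subgroup (G n i) (F i)"
proof (rule additive_subgroup.intro, rule group.subgroupI)
  note I = ideal_pow_ideal[OF ideal_m, of "n - i"]
  show "group (add_monoid (F i))" by (rule abelian_group.a_group[OF F_abelian])
  show "G n i \<subseteq> carrier (add_monoid (F i))" using G_carrier by simp
  have "\<zero>\<^bsub>F i\<^esub> \<in> G n i" 
    unfolding free_module_simps using additive_subgroup.zero_closed[OF ideal.axioms(1)[OF I]]
    by (intro restrict_PiE_iff[THEN iffD2] ballI)
  then show "G n i \<noteq> {}" by blast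
  show "inv\<^bsub>add_monoid (F i)\<^esub> u \<in> G n i" if "u \<in> G n i" for u
    using ideal_vectors_closed(3)[OF I that that] by (simp only: a_inv_def)
  show "u \<otimes>\<^bsub>add_monoid (F i)\<^esub> v \<in> G n i" if "u \<in> G n i" "v \<in> G n i" for u v
    using ideal_vectors_closed(1)[OF I that] by (simp only: monoid.select_convs)
qed

lemma G_decreasing: "G (Suc n) i \<subseteq> G n i"
  using ideal_pow_antimono[OF ideal_m, of "n - i" "Suc n - i"] by (intro PiE_mono) simp

lemma d_G:
  assumes "v \<in> G n (Suc i)"
  shows "d (Suc i) v \<in> G n i"
proof (rule module_homs_ideal_vectors[OF d_hom _ _ d_min _ assms])
  fix a c assume "a \<in> ideal_pow R (max_ideal R) (n - Suc i)" "c \<in> max_ideal R"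
  then have "a \<otimes> c \<in> ideal_pow R (max_ideal R) (n - Suc i + Suc 0)"
    using ideal_pow_mult[OF ideal_m, of a "n - Suc i" c "Suc 0"] ideal_m by simp
  then show "a \<otimes> c \<in> ideal_pow R (max_ideal R) (n - i)"
    by (rule subsetD[OF ideal_pow_antimono[OF ideal_m], rotated]) simp
qed (rule ideal_pow_ideal[OF ideal_m])+

lemma d_closed: "v \<in> carrier (F (Suc i)) \<Longrightarrow> d (Suc i) v \<in> carrier (F i)"
  by (rule module_homsD(1)[OF d_hom])

lemma d_diff:
  "u \<in> carrier (F (Suc i)) \<Longrightarrow> v \<in> carrier (F (Suc i)) \<Longrightarrow>
    d (Suc i) (u \<ominus>\<^bsub>F (Suc i)\<^esub> v) = d (Suc i) u \<ominus>\<^bsub>F i\<^esub> d (Suc i) v"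
  by (rule module_homs_diff[OF free_module_is_module free_module_is_module d_hom])

lemmas cls_eq_iff = coset_eq_iff[OF F_abelian G_additive_subgroup]

lemma cls_zero_iff: "a \<in> carrier (F i) \<Longrightarrow> cls n i a = G (Suc n) i \<longleftrightarrow> a \<in> G (Suc n) i"
proof
  note S = abelian_subgroupI3[OF G_additive_subgroup F_abelian, of i "Suc n"]
  show "cls n i a = G (Suc n) i" if "a \<in> G (Suc n) i" by (rule abelian_subgroup.a_rcos_const[OF S that])
  show "a \<in> G (Suc n) i" if "a \<in> carrier (F i)" "cls n i a = G (Suc n) i"
    using abelian_subgroup.a_rcos_self[OF S that(1)] that(2) by simp
qed

lemma subquotient_G:
  defines "Q n i \<equiv> (add_monoid (F i))\<lparr>carrier := G n i\<rparr> Mod G (Suc n) i"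
  shows "group (Q n i)" "carrier (Q n i) = cls n i ` G n i" "\<one>\<^bsub>Q n i\<^esub> = G (Suc n) i"
    "a \<in> G n i \<Longrightarrow> a' \<in> G n i \<Longrightarrow> cls n i a \<otimes>\<^bsub>Q n i\<^esub> cls n i a' = cls n i (a \<oplus>\<^bsub>F i\<^esub> a')"
  unfolding Q_def
  by (rule subquotient[OF F_abelian G_additive_subgroup G_additive_subgroup G_decreasing]; assumption)+

lemma lin_part_eq: "C i = sum_group UNIV (\<lambda>n. (add_monoid (F i))\<lparr>carrier := G n i\<rparr> Mod G (Suc n) i)"
  by (simp add: lin_part_def G_filt_eq)

lemma lin_part_group: "group (C i)"
  unfolding lin_part_eq by (rule sum_group) (rule subquotient_G)

lemma lin_part_carrier:
  "u \<in> carrier (C i) \<longleftrightarrow> (\<forall>n. u n \<in> cls n i ` G n i) \<and> finite {n. u n \<noteq> G (Suc n) i}"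
  unfolding lin_part_eq carrier_sum_group[OF subquotient_G(1)] subquotient_G(2,3)
  by (simp add: PiE_UNIV_domain Pi_iff)

lemma lin_part_carrierI:
  "(\<And>n. a n \<in> G n i) \<Longrightarrow> finite {n. cls n i (a n) \<noteq> G (Suc n) i} \<Longrightarrow> (\<lambda>n. cls n i (a n)) \<in> carrier (C i)"
  unfolding lin_part_carrier by (intro conjI allI imageI)

lemma lin_part_carrierE:
  assumes "u \<in> carrier (C i)"
  obtains a where "\<forall>n. a n \<in> G n i" "u = (\<lambda>n. cls n i (a n))" "finite {n. u n \<noteq> G (Suc n) i}"
proof -
  have "\<exists>a. a \<in> G n i \<and> u n = cls n i a" for n
    using assms unfolding lin_part_carrier by (elim conjE allE[of _ n] imageE) (rule exI, rule conjI)
  then obtain a where "\<And>n. a n \<in> G n i \<and> u n = cls n i (a n)" by metis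
  then show thesis using that[of a] assms unfolding lin_part_carrier by (simp add: fun_eq_iff)
qed

lemma lin_part_one: "\<one>\<^bsub>C i\<^esub> = (\<lambda>n. G (Suc n) i)"
  unfolding lin_part_eq one_sum_group subquotient_G(3) by (rule restrict_UNIV)

lemma lin_part_mult:
  assumes "\<And>n. a n \<in> G n i" "\<And>n. a' n \<in> G n i"
  shows "(\<lambda>n. cls n i (a n)) \<otimes>\<^bsub>C i\<^esub> (\<lambda>n. cls n i (a' n)) = (\<lambda>n. cls n i (a n \<oplus>\<^bsub>F i\<^esub> a' n))"
  unfolding lin_part_eq mult_sum_group subquotient_G(4)[OF assms] by (rule restrict_UNIV)

text \<open>
  The classes whose union forms the value of the induced differential coincide, because the
  differential respects the filtration.
\<close>

lemma lin_diff_cls: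
  assumes a: "a \<in> carrier (F (Suc i))"
  shows "(\<Union>a'\<in>cls n (Suc i) a. G (Suc n) i +>\<^bsub>F i\<^esub> d (Suc i) a') = cls n i (d (Suc i) a)"
proof -
  note S = abelian_subgroupI3[OF G_additive_subgroup F_abelian, of "Suc i" "Suc n"]
  have "G (Suc n) i +>\<^bsub>F i\<^esub> d (Suc i) a' = cls n i (d (Suc i) a)" if a': "a' \<in> cls n (Suc i) a" for a'
  proof -
    have c: "a' \<in> carrier (F (Suc i))" using abelian_subgroup.a_elemrcos_carrier[OF S a a'] .
    have "a' \<ominus>\<^bsub>F (Suc i)\<^esub> a \<in> G (Suc n) (Suc i)"
      using abelian_subgroup.a_rcos_module_imp[OF S a a'] by (simp only: a_minus_def)
    then have "d (Suc i) a' \<ominus>\<^bsub>F i\<^esub> d (Suc i) a \<in> G (Suc n) i"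
      using d_G d_diff[OF c a] by metis
    then show ?thesis using cls_eq_iff[OF d_closed[OF c] d_closed[OF a]] by simp
  qed
  then show ?thesis using abelian_subgroup.a_rcos_self[OF S a] by blast
qed

lemma lin_diff_apply:
  assumes "\<And>n. a n \<in> carrier (F (Suc i))"
  shows "D (Suc i) (\<lambda>n. cls n (Suc i) (a n)) = (\<lambda>n. cls n i (d (Suc i) (a n)))"
  unfolding lin_diff_def G_filt_eq using lin_diff_cls[OF assms] by simp

lemma lin_diff_hom: "D (Suc i) \<in> hom (C (Suc i)) (C i)"
proof (rule homI)
  fix u assume "u \<in> carrier (C (Suc i))"
  then obtain a where a': "\<forall>n. a n \<in> G n (Suc i)" "u = (\<lambda>n. cls n (Suc i) (a n))"
    and fin: "finite {n. u n \<noteq> G (Suc n) (Suc i)}"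
    by (rule lin_part_carrierE)
  note a = a'(1)[rule_format] a'(2)
  have ac: "a n \<in> carrier (F (Suc i))" for n using a(1) G_carrier by blast
  have du: "D (Suc i) u = (\<lambda>n. cls n i (d (Suc i) (a n)))" unfolding a(2) by (rule lin_diff_apply[OF ac])
  have "D (Suc i) u n = G (Suc n) i" if "u n = G (Suc n) (Suc i)" for n
  proof -
    have "a n \<in> G (Suc n) (Suc i)" using that cls_zero_iff[OF ac] unfolding a(2) by simp
    then show ?thesis unfolding du using d_G cls_zero_iff[OF d_closed[OF ac]] by simp
  qed
  then have "{n. D (Suc i) u n \<noteq> G (Suc n) i} \<subseteq> {n. u n \<noteq> G (Suc n) (Suc i)}" by blast
  then have "finite {n. D (Suc i) u n \<noteq> G (Suc n) i}" using fin by (rule finite_subset)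
  then show "D (Suc i) u \<in> carrier (C i)"
    unfolding du by (intro lin_part_carrierI d_G a(1))
  fix v assume "v \<in> carrier (C (Suc i))"
  then obtain a' where v: "\<forall>n. a' n \<in> G n (Suc i)" "v = (\<lambda>n. cls n (Suc i) (a' n))"
    by (rule lin_part_carrierE)
  note a' = v(1)[rule_format] v(2)
  have a'c: "a' n \<in> carrier (F (Suc i))" for n using a'(1) G_carrier by blast
  have dv: "D (Suc i) v = (\<lambda>n. cls n i (d (Suc i) (a' n)))" unfolding a'(2) by (rule lin_diff_apply[OF a'c])
  have sum: "a n \<oplus>\<^bsub>F (Suc i)\<^esub> a' n \<in> carrier (F (Suc i))" for n
    using abelian_monoid.a_closed[OF abelian_group.axioms(1)[OF F_abelian] ac a'c] .
  have "D (Suc i) (u \<otimes>\<^bsub>C (Suc i)\<^esub> v) = (\<lambda>n. cls n i (d (Suc i) (a n \<oplus>\<^bsub>F (Suc i)\<^esub> a' n)))"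
    unfolding a(2) a'(2) lin_part_mult[OF a(1) a'(1)] by (rule lin_diff_apply[OF sum])
  also have "\<dots> = (\<lambda>n. cls n i (d (Suc i) (a n) \<oplus>\<^bsub>F i\<^esub> d (Suc i) (a' n)))"
    using module_homsD(2)[OF d_hom ac a'c] by simp
  also have "\<dots> = D (Suc i) u \<otimes>\<^bsub>C i\<^esub> D (Suc i) v"
    unfolding du dv by (rule lin_part_mult[OF d_G[OF a(1)] d_G[OF a'(1)], symmetric])
  finally show "D (Suc i) (u \<otimes>\<^bsub>C (Suc i)\<^esub> v) = D (Suc i) u \<otimes>\<^bsub>C i\<^esub> D (Suc i) v" .
qed

lemma lin_homology_trivial_iff_kernel:
  "carrier (lin_homology R F d (Suc i)) = {\<one>\<^bsub>lin_homology R F d (Suc i)\<^esub>} \<longleftrightarrow>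
     (\<forall>u \<in> carrier (C (Suc i)). D (Suc i) u = \<one>\<^bsub>C i\<^esub> \<longrightarrow> u \<in> D (Suc (Suc i)) ` carrier (C (Suc (Suc i))))"
proof -
  let ?H = "D (Suc (Suc i)) ` carrier (C (Suc (Suc i)))"
  let ?K = "kernel (C (Suc i)) (C i) (D (Suc i))"
  interpret C: group "C (Suc i)" by (rule lin_part_group)
  have H: "subgroup ?H (C (Suc i))"
    by (rule group_hom.img_is_subgroup) (simp add: group_hom_def group_hom_axioms_def lin_part_group lin_diff_hom)
  have "carrier (lin_homology R F d (Suc i)) = (\<lambda>u. ?H #>\<^bsub>C (Suc i)\<^esub> u) ` ?K"
    by (auto simp: lin_homology_def homology_of_def FactGroup_def RCOSETS_def r_coset_def)
  moreover have "\<one>\<^bsub>lin_homology R F d (Suc i)\<^esub> = ?H"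
    by (simp add: lin_homology_def homology_of_def FactGroup_def)
  moreover have ne: "\<one>\<^bsub>C (Suc i)\<^esub> \<in> ?K"
    using group_hom.hom_one[of "C (Suc i)" "C i" "D (Suc i)"]
    by (simp add: kernel_def group_hom_def group_hom_axioms_def lin_part_group lin_diff_hom)
  moreover have "?H #>\<^bsub>C (Suc i)\<^esub> u = ?H \<longleftrightarrow> u \<in> ?H" if "u \<in> carrier (C (Suc i))" for u
    using C.coset_join1[OF _ that H] C.coset_join2[OF that H] by blast
  moreover have "(\<lambda>u. ?H #>\<^bsub>C (Suc i)\<^esub> u) ` ?K = {?H} \<longleftrightarrow> (\<forall>u \<in> ?K. ?H #>\<^bsub>C (Suc i)\<^esub> u = ?H)"
    using ne by blast
  ultimately show ?thesis unfolding kernel_def by (simp add: Ball_def imp_conjL)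
qed

text \<open>
  Graded pieces may be treated one at a time, since a homogeneous class is an element of the
  direct sum, and since a boundary can be chosen to be zero wherever the cycle is.
\<close>

lemma lin_homology_trivial_iff:
  "carrier (lin_homology R F d (Suc i)) = {\<one>\<^bsub>lin_homology R F d (Suc i)\<^esub>} \<longleftrightarrow> linear_part_exact R b d i"
  unfolding lin_homology_trivial_iff_kernel
proof
  assume ex: "linear_part_exact R b d i"
  show "\<forall>u \<in> carrier (C (Suc i)). D (Suc i) u = \<one>\<^bsub>C i\<^esub> \<longrightarrow> u \<in> D (Suc (Suc i)) ` carrier (C (Suc (Suc i)))"
  proof (intro ballI impI)
    fix u assume u: "u \<in> carrier (C (Suc i))" and du: "D (Suc i) u = \<one>\<^bsub>C i\<^esub>"
    obtain a where a': "\<forall>n. a n \<in> G n (Suc i)" "u = (\<lambda>n. cls n (Suc i) (a n))"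
      and fin: "finite {n. u n \<noteq> G (Suc n) (Suc i)}"
      using u by (rule lin_part_carrierE)
    note a = a'(1)[rule_format] a'(2)
    have ac: "a n \<in> carrier (F (Suc i))" for n using a(1) G_carrier by blast
    have "cls n i (d (Suc i) (a n)) = G (Suc n) i" for n
      using du unfolding a(2) lin_diff_apply[OF ac] lin_part_one by (rule fun_cong)
    then have da: "d (Suc i) (a n) \<in> G (Suc n) i" for n using cls_zero_iff[OF d_closed[OF ac]] by simp
    have "\<exists>c \<in> G n (Suc (Suc i)). cls n (Suc i) (d (Suc (Suc i)) c) = u n
        \<and> (u n = G (Suc n) (Suc i) \<longrightarrow> c = \<zero>\<^bsub>F (Suc (Suc i))\<^esub>)" for n
    proof (cases "u n = G (Suc n) (Suc i)")
      case True
      have "d (Suc (Suc i)) \<zero>\<^bsub>F (Suc (Suc i))\<^esub> = \<zero>\<^bsub>F (Suc i)\<^esub>"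
        by (rule module_homs_zero[OF free_module_is_module free_module_is_module d_hom])
      moreover have "cls n (Suc i) \<zero>\<^bsub>F (Suc i)\<^esub> = G (Suc n) (Suc i)"
        by (rule abelian_group.a_coset_add_zero[OF F_abelian G_carrier])
      ultimately show ?thesis
        using True additive_subgroup.zero_closed[OF G_additive_subgroup] by metis
    next
      case False
      obtain c where c: "c \<in> G n (Suc (Suc i))" "a n \<ominus>\<^bsub>F (Suc i)\<^esub> d (Suc (Suc i)) c \<in> G (Suc n) (Suc i)"
        using ex[unfolded linear_part_exact_def] a(1) da by blast
      have cc: "c \<in> carrier (F (Suc (Suc i)))" using c(1) G_carrier by blast
      have "cls n (Suc i) (d (Suc (Suc i)) c) = u n"
        unfolding a(2) by (rule sym, rule cls_eq_iff[OF ac d_closed[OF cc], THEN iffD2]) (rule c(2))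
      then show ?thesis using c(1) False by blast
    qed
    then obtain c where c: "\<And>n. c n \<in> G n (Suc (Suc i))" "\<And>n. cls n (Suc i) (d (Suc (Suc i)) (c n)) = u n"
      "\<And>n. u n = G (Suc n) (Suc i) \<Longrightarrow> c n = \<zero>\<^bsub>F (Suc (Suc i))\<^esub>"
      by metis
    have cc: "c n \<in> carrier (F (Suc (Suc i)))" for n using c(1) G_carrier by blast
    let ?w = "\<lambda>n. cls n (Suc (Suc i)) (c n)"
    have "?w n = G (Suc n) (Suc (Suc i))" if "u n = G (Suc n) (Suc i)" for n
      unfolding c(3)[OF that] by (rule abelian_group.a_coset_add_zero[OF F_abelian G_carrier])
    then have "{n. ?w n \<noteq> G (Suc n) (Suc (Suc i))} \<subseteq> {n. u n \<noteq> G (Suc n) (Suc i)}" by blast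
    then have "finite {n. ?w n \<noteq> G (Suc n) (Suc (Suc i))}" using fin by (rule finite_subset)
    then have "?w \<in> carrier (C (Suc (Suc i)))" by (intro lin_part_carrierI c(1))
    moreover have "D (Suc (Suc i)) ?w = u" using lin_diff_apply[OF cc] c(2) by simp
    ultimately show "u \<in> D (Suc (Suc i)) ` carrier (C (Suc (Suc i)))" by blast
  qed
next
  assume ker: "\<forall>u \<in> carrier (C (Suc i)). D (Suc i) u = \<one>\<^bsub>C i\<^esub> \<longrightarrow> u \<in> D (Suc (Suc i)) ` carrier (C (Suc (Suc i)))"
  show "linear_part_exact R b d i"
    unfolding linear_part_exact_def
  proof (intro allI ballI impI)
    fix n a assume a: "a \<in> G n (Suc i)" and da: "d (Suc i) a \<in> G (Suc n) i"
    let ?z = "\<zero>\<^bsub>F (Suc i)\<^esub>"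
    have zz: "?z \<in> G k (Suc i)" for k by (rule additive_subgroup.zero_closed[OF G_additive_subgroup])
    have zcls: "cls k j \<zero>\<^bsub>F j\<^esub> = G (Suc k) j" for k j
      by (rule abelian_group.a_coset_add_zero[OF F_abelian G_carrier])
    let ?a = "\<lambda>k. if k = n then a else ?z"
    let ?u = "\<lambda>k. cls k (Suc i) (?a k)"
    have aG: "?a k \<in> G k (Suc i)" for k using a zz by simp
    have ac: "?a k \<in> carrier (F (Suc i))" for k using aG G_carrier by blast
    have "?u k = G (Suc k) (Suc i)" if "k \<noteq> n" for k
      using that by (simp only: if_False) (rule zcls)
    then have "{k. ?u k \<noteq> G (Suc k) (Suc i)} \<subseteq> {n}" by blast
    then have "finite {k. ?u k \<noteq> G (Suc k) (Suc i)}" by (rule finite_subset) simp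
    then have u: "?u \<in> carrier (C (Suc i))" by (intro lin_part_carrierI aG)
    have "cls k i (d (Suc i) (?a k)) = G (Suc k) i" for k
    proof (cases "k = n")
      case True
      then show ?thesis using da by (subst cls_zero_iff[OF d_closed[OF ac]]) simp
    next
      case False
      have "d (Suc i) ?z = \<zero>\<^bsub>F i\<^esub>"
        by (rule module_homs_zero[OF free_module_is_module free_module_is_module d_hom])
      then show ?thesis using False zcls by (simp only: if_False)
    qed
    then have "D (Suc i) ?u = \<one>\<^bsub>C i\<^esub>" unfolding lin_diff_apply[OF ac] lin_part_one by simp
    then obtain w where w: "w \<in> carrier (C (Suc (Suc i)))" "D (Suc (Suc i)) w = ?u"
      using ker u by (metis (no_types, lifting) imageE)
    obtain c where c': "\<forall>k. c k \<in> G k (Suc (Suc i))" "w = (\<lambda>k. cls k (Suc (Suc i)) (c k))"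
      using w(1) by (rule lin_part_carrierE)
    note c = c'(1)[rule_format] c'(2)
    have cc: "c k \<in> carrier (F (Suc (Suc i)))" for k using c(1) G_carrier by blast
    have "(\<lambda>k. cls k (Suc i) (d (Suc (Suc i)) (c k))) = ?u"
      using w(2) unfolding c(2) lin_diff_apply[OF cc] .
    then have "cls n (Suc i) (d (Suc (Suc i)) (c n)) = ?u n" by (rule fun_cong)
    then have "cls n (Suc i) a = cls n (Suc i) (d (Suc (Suc i)) (c n))" by simp
    then have "a \<ominus>\<^bsub>F (Suc i)\<^esub> d (Suc (Suc i)) (c n) \<in> G (Suc n) (Suc i)"
      by (rule cls_eq_iff[OF _ d_closed[OF cc], THEN iffD1, rotated]) (use ac[of n] in simp)
    then show "\<exists>c \<in> G n (Suc (Suc i)). a \<ominus>\<^bsub>F (Suc i)\<^esub> d (Suc (Suc i)) c \<in> G (Suc n) (Suc i)"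
      using c(1) by blast
  qed
qed

end

section \<open>Comparison of minimal free resolutions\<close>

lemma (in cring) minimal_free_resolutionD:
  assumes m: "ideal (max_ideal R) R" and res: "minimal_free_resolution R M b d e"
  defines "F \<equiv> \<lambda>i. free_module R (b i)"
  shows "d (Suc i) \<in> module_homs R (F (Suc i)) (F i)"
    and "e \<in> module_homs R (F 0) M"
    and "e ` carrier (F 0) = carrier M"
    and "d (Suc 0) ` carrier (F (Suc 0)) = a_kernel (F 0) M e"
    and "d (Suc (Suc i)) ` carrier (F (Suc (Suc i))) = a_kernel (F (Suc i)) (F i) (d (Suc i))"
    and "minimal_complex R b d"
proof -
  note r = res[unfolded minimal_free_resolution_def Let_def One_nat_def]
  note r2 = r[THEN conjunct2] note r3 = r2[THEN conjunct2] note r4 = r3[THEN conjunct2]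
  note r5 = r4[THEN conjunct2]
  show d: "d (Suc i) \<in> module_homs R (F (Suc i)) (F i)" for i
    unfolding F_def by (rule r[THEN conjunct1, rule_format])
  show "e \<in> module_homs R (F 0) M" unfolding F_def by (rule r2[THEN conjunct1])
  show "e ` carrier (F 0) = carrier M" unfolding F_def by (rule r3[THEN conjunct1])
  show "d (Suc 0) ` carrier (F (Suc 0)) = a_kernel (F 0) M e" unfolding F_def by (rule r4[THEN conjunct1])
  show "d (Suc (Suc i)) ` carrier (F (Suc (Suc i))) = a_kernel (F (Suc i)) (F i) (d (Suc i))"
    unfolding F_def by (rule r5[THEN conjunct1, rule_format])
  have "d (Suc i) ` carrier (F (Suc i)) \<subseteq> ideal_smult (max_ideal R) (F i)" for i
    unfolding F_def by (rule r5[THEN conjunct2, rule_format])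
  then show "minimal_complex R b d"
    unfolding F_def ideal_smult_free_module[OF m]
    by (intro minimal_complex.intro minimal_complex_axioms.intro is_cring m d[unfolded F_def])
qed

text \<open>
  The induction carries along that boundaries are mapped to boundaries, so that the next map can be
  obtained by lifting.
\<close>

lemma (in cring) resolution_chain_map:
  assumes m: "ideal (max_ideal R) R" and M: "module R M"
    and res: "minimal_free_resolution R M b d e" and res': "minimal_free_resolution R M b' d' e'"
  obtains f where "\<forall>i. f i \<in> module_homs R (free_module R (b i)) (free_module R (b' i))"
    "\<forall>v \<in> carrier (free_module R (b 0)). e' (f 0 v) = e v"
    "\<forall>i. \<forall>v \<in> carrier (free_module R (b (Suc i))). d' (Suc i) (f (Suc i) v) = f i (d (Suc i) v)"
proof -
  let ?F = "\<lambda>i. free_module R (b i)" and ?F' = "\<lambda>i. free_module R (b' i)"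
  note D = minimal_free_resolutionD[OF m res] and D' = minimal_free_resolutionD[OF m res']
  note mF = free_module_is_module
  define P where "P n h \<longleftrightarrow> h \<in> module_homs R (?F n) (?F' n) \<and>
      (\<forall>w \<in> carrier (?F (Suc n)). h (d (Suc n) w) \<in> d' (Suc n) ` carrier (?F' (Suc n))) \<and>
      (n = 0 \<longrightarrow> (\<forall>v \<in> carrier (?F 0). e' (h v) = e v))" for n h
  define Q where "Q n h h' \<longleftrightarrow> (\<forall>v \<in> carrier (?F (Suc n)). d' (Suc n) (h' v) = h (d (Suc n) v))" for n h h'
  have "\<exists>f. \<forall>n. P n (f n) \<and> Q n (f n) (f (Suc n))"
  proof (rule dependent_nat_choice)
    have "e ` carrier (?F 0) \<subseteq> e' ` carrier (?F' 0)" using D(3) D'(3) by simp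
    then obtain h where h: "h \<in> module_homs R (?F 0) (?F' 0)"
      "\<And>v. v \<in> carrier (?F 0) \<Longrightarrow> e' (h v) = e v"
      using free_module_lift[OF M mF D(2) D'(2)] by metis
    have "h (d (Suc 0) w) \<in> d' (Suc 0) ` carrier (?F' (Suc 0))" if "w \<in> carrier (?F (Suc 0))" for w
    proof -
      have "d (Suc 0) w \<in> a_kernel (?F 0) M e" using D(4) that by blast
      then have "d (Suc 0) w \<in> carrier (?F 0)" "e (d (Suc 0) w) = \<zero>\<^bsub>M\<^esub>" by (auto simp: a_kernel_def')
      then show ?thesis unfolding D'(4) using h module_homsD(1)[OF h(1)] by (simp add: a_kernel_def')
    qed
    then show "\<exists>h. P 0 h" using h unfolding P_def by blast
  next
    fix h n assume h: "P n h"
    then have h1: "h \<in> module_homs R (?F n) (?F' n)" unfolding P_def by blast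
    have "(\<lambda>v. h (d (Suc n) v)) ` carrier (?F (Suc n)) \<subseteq> d' (Suc n) ` carrier (?F' (Suc n))"
      using h unfolding P_def by blast
    then obtain h' where h': "h' \<in> module_homs R (?F (Suc n)) (?F' (Suc n))"
      "\<And>v. v \<in> carrier (?F (Suc n)) \<Longrightarrow> d' (Suc n) (h' v) = h (d (Suc n) v)"
      using free_module_lift[OF mF mF module_homs_comp[OF D(1) h1] D'(1)] by metis
    have "h' (d (Suc (Suc n)) w) \<in> d' (Suc (Suc n)) ` carrier (?F' (Suc (Suc n)))"
      if "w \<in> carrier (?F (Suc (Suc n)))" for w
    proof -
      have "d (Suc (Suc n)) w \<in> a_kernel (?F (Suc n)) (?F n) (d (Suc n))" using D(5) that by blast
      then have "d (Suc (Suc n)) w \<in> carrier (?F (Suc n))" "d (Suc n) (d (Suc (Suc n)) w) = \<zero>\<^bsub>?F n\<^esub>"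
        by (auto simp: a_kernel_def')
      then show ?thesis
        unfolding D'(5) using h' module_homsD(1)[OF h'(1)] module_homs_zero[OF mF mF h1]
        by (simp add: a_kernel_def')
    qed
    then show "\<exists>h'. P (Suc n) h' \<and> Q n h h'" using h' unfolding P_def Q_def by blast
  qed
  then obtain f where f: "\<And>n. P n (f n)" "\<And>n. Q n (f n) (f (Suc n))" by blast
  show thesis
  proof (rule that)
    show "\<forall>i. f i \<in> module_homs R (?F i) (?F' i)" using f(1) unfolding P_def by blast
    show "\<forall>v \<in> carrier (?F 0). e' (f 0 v) = e v" using f(1)[of 0] unfolding P_def by blast
    show "\<forall>i. \<forall>v \<in> carrier (?F (Suc i)). d' (Suc i) (f (Suc i) v) = f i (d (Suc i) v)"
      using f(2) unfolding Q_def by blast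
  qed
qed

text \<open>
  The maps \<open>s\<close> are built degree by degree.  The induction carries along that \<open>d s\<close> and \<open>k\<close> agree on
  boundaries, which makes \<open>k - s d\<close> in the next degree take values in the cycles.
\<close>

lemma (in cring) resolution_null_homotopy:
  assumes m: "ideal (max_ideal R) R" and M: "module R M"
    and res: "minimal_free_resolution R M b d e"
    and k: "\<And>i. k i \<in> module_homs R (free_module R (b i)) (free_module R (b i))"
    and ek: "\<And>v. v \<in> carrier (free_module R (b 0)) \<Longrightarrow> e (k 0 v) = \<zero>\<^bsub>M\<^esub>"
    and dk: "\<And>i v. v \<in> carrier (free_module R (b (Suc i))) \<Longrightarrow> d (Suc i) (k (Suc i) v) = k i (d (Suc i) v)"
  obtains s where "\<forall>i. s i \<in> module_homs R (free_module R (b i)) (free_module R (b (Suc i)))"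
    "\<forall>i. \<forall>v \<in> carrier (free_module R (b (Suc i))).
       k (Suc i) v = d (Suc (Suc i)) (s (Suc i) v) \<oplus>\<^bsub>free_module R (b (Suc i))\<^esub> s i (d (Suc i) v)"
proof -
  let ?F = "\<lambda>i. free_module R (b i)"
  note D = minimal_free_resolutionD[OF m res]
  note mF = free_module_is_module
  note [simp] = module_homsD(1)[OF D(1)] module_homsD(1)[OF k]
  have ag: "abelian_group (?F i)" for i by (rule module.axioms(2)[OF mF])
  have dd: "d (Suc n) (d (Suc (Suc n)) w) = \<zero>\<^bsub>?F n\<^esub>" if "w \<in> carrier (?F (Suc (Suc n)))" for n w
    using D(5)[of n] that by (auto simp: a_kernel_def')
  define P where "P n s \<longleftrightarrow> s \<in> module_homs R (?F n) (?F (Suc n)) \<and>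
      (\<forall>w \<in> carrier (?F (Suc n)). d (Suc n) (s (d (Suc n) w)) = k n (d (Suc n) w))" for n s
  define Q where "Q n s s' \<longleftrightarrow> (\<forall>v \<in> carrier (?F (Suc n)).
      k (Suc n) v = d (Suc (Suc n)) (s' v) \<oplus>\<^bsub>?F (Suc n)\<^esub> s (d (Suc n) v))" for n s s'
  have "\<exists>s. \<forall>n. P n (s n) \<and> Q n (s n) (s (Suc n))"
  proof (rule dependent_nat_choice)
    have "k 0 ` carrier (?F 0) \<subseteq> d (Suc 0) ` carrier (?F (Suc 0))"
      unfolding D(4) using ek by (auto simp: a_kernel_def')
    then obtain s where s: "s \<in> module_homs R (?F 0) (?F (Suc 0))"
      "\<And>v. v \<in> carrier (?F 0) \<Longrightarrow> d (Suc 0) (s v) = k 0 v"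
      using free_module_lift[OF mF mF k D(1)] by metis
    then show "\<exists>s. P 0 s" unfolding P_def by auto
  next
    fix s n assume s: "P n s"
    then have s1: "s \<in> module_homs R (?F n) (?F (Suc n))"
      and s2: "\<And>w. w \<in> carrier (?F (Suc n)) \<Longrightarrow> d (Suc n) (s (d (Suc n) w)) = k n (d (Suc n) w)"
      unfolding P_def by blast+
    note [simp] = module_homsD(1)[OF s1]
    let ?p = "\<lambda>v. k (Suc n) v \<ominus>\<^bsub>?F (Suc n)\<^esub> s (d (Suc n) v)"
    have p: "?p \<in> module_homs R (?F (Suc n)) (?F (Suc n))"
      by (rule module_homs_sub[OF mF k module_homs_comp[OF D(1) s1]])
    have "d (Suc n) (?p v) = \<zero>\<^bsub>?F n\<^esub>" if "v \<in> carrier (?F (Suc n))" for v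
      using that abelian_group.r_neg[OF ag, of "k n (d (Suc n) v)" n]
      by (simp add: module_homs_diff[OF mF mF D(1)] dk s2 a_minus_def[of "?F n"])
    then have "?p ` carrier (?F (Suc n)) \<subseteq> d (Suc (Suc n)) ` carrier (?F (Suc (Suc n)))"
      unfolding D(5) using module_homsD(1)[OF p] by (auto simp: a_kernel_def')
    then obtain s' where s': "s' \<in> module_homs R (?F (Suc n)) (?F (Suc (Suc n)))"
      "\<And>v. v \<in> carrier (?F (Suc n)) \<Longrightarrow> d (Suc (Suc n)) (s' v) = ?p v"
      using free_module_lift[OF mF mF p D(1)] by metis
    have "d (Suc (Suc n)) (s' (d (Suc (Suc n)) w)) = k (Suc n) (d (Suc (Suc n)) w)"
      if "w \<in> carrier (?F (Suc (Suc n)))" for w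
      using that dd[OF that] by (simp add: s'(2) module_homs_zero[OF mF mF s1] abelian_group.diff_zero[OF ag])
    moreover have "k (Suc n) v = ?p v \<oplus>\<^bsub>?F (Suc n)\<^esub> s (d (Suc n) v)" if v: "v \<in> carrier (?F (Suc n))" for v
      by (rule abelian_group.diff_add_cancel[OF ag, symmetric]) (use v in simp_all)
    ultimately show "\<exists>s'. P (Suc n) s' \<and> Q n s s'" using s' unfolding P_def Q_def by auto
  qed
  then obtain s where s: "\<And>n. P n (s n)" "\<And>n. Q n (s n) (s (Suc n))" by blast
  show thesis
  proof (rule that)
    show "\<forall>i. s i \<in> module_homs R (?F i) (?F (Suc i))" using s(1) unfolding P_def by blast
    show "\<forall>i. \<forall>v \<in> carrier (?F (Suc i)).
        k (Suc i) v = d (Suc (Suc i)) (s (Suc i) v) \<oplus>\<^bsub>?F (Suc i)\<^esub> s i (d (Suc i) v)"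
      using s(2) unfolding Q_def by blast
  qed
qed

text \<open>
  The linear part of a minimal free resolution does not depend on the resolution: a composition
  of comparison maps is homotopic to the identity, and since the differentials are minimal, the
  homotopy \<open>d s + s d\<close> raises the filtration degree by one, so it disappears in the linear part.
\<close>

lemma (in cring) linear_part_exact_independent:
  assumes m: "ideal (max_ideal R) R" and M: "module R M"
    and res: "minimal_free_resolution R M b d e" and res': "minimal_free_resolution R M b' d' e'"
    and exact: "linear_part_exact R b d i"
  shows "linear_part_exact R b' d' i"
  unfolding linear_part_exact_def
proof (intro allI ballI impI)
  let ?F = "\<lambda>i. free_module R (b i)" and ?F' = "\<lambda>i. free_module R (b' i)"
  let ?pw = "\<lambda>p. ideal_pow R (max_ideal R) p"
  note D = minimal_free_resolutionD[OF m res] and D' = minimal_free_resolutionD[OF m res']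
  note mF = free_module_is_module
  have ag: "abelian_group (?F' i)" for i by (rule module.axioms(2)[OF mF])
  obtain f where f': "\<forall>i. f i \<in> module_homs R (?F i) (?F' i)"
    "\<forall>v \<in> carrier (?F 0). e' (f 0 v) = e v"
    "\<forall>i. \<forall>v \<in> carrier (?F (Suc i)). d' (Suc i) (f (Suc i) v) = f i (d (Suc i) v)"
    by (rule resolution_chain_map[OF m M res res'])
  note f = f'(1)[rule_format] f'(2)[rule_format] f'(3)[rule_format]
  obtain g where g': "\<forall>i. g i \<in> module_homs R (?F' i) (?F i)"
    "\<forall>v \<in> carrier (?F' 0). e (g 0 v) = e' v"
    "\<forall>i. \<forall>v \<in> carrier (?F' (Suc i)). d (Suc i) (g (Suc i) v) = g i (d' (Suc i) v)"
    by (rule resolution_chain_map[OF m M res' res])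
  note g = g'(1)[rule_format] g'(2)[rule_format] g'(3)[rule_format]
  note [simp] = module_homsD(1)[OF f(1)] module_homsD(1)[OF g(1)] module_homsD(1)[OF D(1)] module_homsD(1)[OF D'(1)]
  define k where "k i v = v \<ominus>\<^bsub>?F' i\<^esub> f i (g i v)" for i v
  have k: "k i \<in> module_homs R (?F' i) (?F' i)" for i
    unfolding k_def by (rule module_homs_sub[OF mF _ module_homs_comp[OF g(1) f(1)]]) (rule module_homsI; simp)
  have ek: "e' (k 0 v) = \<zero>\<^bsub>M\<^esub>" if "v \<in> carrier (?F' 0)" for v
    using that module_homsD(1)[OF D'(2) that] abelian_group.r_neg[OF module.axioms(2)[OF M], of "e' v"]
    by (simp add: k_def module_homs_diff[OF mF M D'(2)] f(2) g(2) a_minus_def[of M])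
  have dk: "d' (Suc i) (k (Suc i) v) = k i (d' (Suc i) v)" if "v \<in> carrier (?F' (Suc i))" for i v
    using that by (simp add: k_def module_homs_diff[OF mF mF D'(1)] f(3) g(3))
  obtain s where s': "\<forall>i. s i \<in> module_homs R (?F' i) (?F' (Suc i))"
    "\<forall>i. \<forall>v \<in> carrier (?F' (Suc i)).
       k (Suc i) v = d' (Suc (Suc i)) (s (Suc i) v) \<oplus>\<^bsub>?F' (Suc i)\<^esub> s i (d' (Suc i) v)"
    by (rule resolution_null_homotopy[where k = k, OF m M res' k ek dk])
  note s = s'(1)[rule_format] s'(2)[rule_format]
  have pres: "h v \<in> vectors r' (?pw p)"
    if h: "h \<in> module_homs R (free_module R r) (free_module R r')" and v: "v \<in> vectors r (?pw p)" for h r r' p v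
  proof (rule module_homs_ideal_vectors[OF h _ _ _ _ v])
    show "h ` carrier (free_module R r) \<subseteq> vectors r' (carrier R)"
      using module_homsD(1)[OF h] by (auto simp: free_module_simps(1))
    show "a \<otimes> c \<in> ?pw p" if "a \<in> ?pw p" "c \<in> carrier R" for a c
      using ideal.I_r_closed[OF ideal_pow_ideal[OF m]] that .
  qed (rule ideal_pow_ideal[OF m])+
  have up: "p \<le> q \<Longrightarrow> vectors r (?pw q) \<subseteq> vectors r (?pw p)" for p q r
    by (intro PiE_mono ideal_pow_antimono[OF m])
  fix n a assume a: "a \<in> vectors (b' (Suc i)) (?pw (n - Suc i))"
    and da: "d' (Suc i) a \<in> vectors (b' i) (?pw (Suc n - i))"
  have ac: "a \<in> carrier (?F' (Suc i))" using a ideal_vectors_subset[OF ideal_pow_ideal[OF m]] by blast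
  have "d (Suc i) (g (Suc i) a) \<in> vectors (b i) (?pw (Suc n - i))"
    using pres[OF g(1) da] g(3)[OF ac] by simp
  then obtain c where c: "c \<in> vectors (b (Suc (Suc i))) (?pw (n - Suc (Suc i)))"
    and gc: "g (Suc i) a \<ominus>\<^bsub>?F (Suc i)\<^esub> d (Suc (Suc i)) c \<in> vectors (b (Suc i)) (?pw (Suc n - Suc i))"
    using exact[unfolded linear_part_exact_def] pres[OF g(1) a] by blast
  have cc: "c \<in> carrier (?F (Suc (Suc i)))" using c ideal_vectors_subset[OF ideal_pow_ideal[OF m]] by blast
  let ?I = "vectors (b' (Suc i)) (?pw (Suc n - Suc i))"
  have "s (Suc i) a \<in> vectors (b' (Suc (Suc i))) (?pw (Suc n - Suc (Suc i)))"
    using pres[OF s(1) a] by simp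
  then have "d' (Suc (Suc i)) (s (Suc i) a) \<in> ?I" by (rule minimal_complex.d_G[OF D'(6)])
  moreover have "s i (d' (Suc i) a) \<in> ?I" by (rule subsetD[OF up, rotated, OF pres[OF s(1) da]]) simp
  ultimately have 1: "k (Suc i) a \<in> ?I"
    unfolding s(2)[OF ac] by (rule ideal_vectors_closed(1)[OF ideal_pow_ideal[OF m]])
  have 2: "f (Suc i) (g (Suc i) a \<ominus>\<^bsub>?F (Suc i)\<^esub> d (Suc (Suc i)) c) \<in> ?I" by (rule pres[OF f(1) gc])
  have "a \<ominus>\<^bsub>?F' (Suc i)\<^esub> d' (Suc (Suc i)) (f (Suc (Suc i)) c)
      = k (Suc i) a \<oplus>\<^bsub>?F' (Suc i)\<^esub> f (Suc i) (g (Suc i) a \<ominus>\<^bsub>?F (Suc i)\<^esub> d (Suc (Suc i)) c)"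
    using ac cc abelian_group.diff_add_diff[OF ag]
    by (simp add: k_def module_homs_diff[OF mF mF f(1)] f(3))
  then have "a \<ominus>\<^bsub>?F' (Suc i)\<^esub> d' (Suc (Suc i)) (f (Suc (Suc i)) c) \<in> ?I"
    using ideal_vectors_closed(1)[OF ideal_pow_ideal[OF m] 1 2] by simp
  then show "\<exists>c\<in>vectors (b' (Suc (Suc i))) (?pw (n - Suc (Suc i))).
      a \<ominus>\<^bsub>?F' (Suc i)\<^esub> d' (Suc (Suc i)) c \<in> ?I"
    using pres[OF f(1) c] by blast
qed

section \<open>Existence of minimal free resolutions\<close>

lemma submodule_diff:
  assumes M: "module R M" and K: "submodule K R M" and uv: "u \<in> K" "v \<in> K"
  shows "u \<ominus>\<^bsub>M\<^esub> v \<in> K"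
proof -
  interpret M: module R M by fact
  show ?thesis using M.submoduleE(3,5)[OF K] uv by (simp add: a_minus_def)
qed

lemma submodule_zero:
  assumes M: "module R M" and K: "submodule K R M"
  shows "\<zero>\<^bsub>M\<^esub> \<in> K"
  using subgroup.one_closed[OF submodule.axioms(1)[OF K]] by simp

lemma submodule_inter:
  assumes M: "module R M" and K: "submodule K R M" "submodule P R M"
  shows "submodule (K \<inter> P) R M"
proof -
  interpret M: module R M by fact
  show ?thesis
    using M.submoduleE[OF K(1)] M.submoduleE[OF K(2)] submodule_zero[OF M K(1)] submodule_zero[OF M K(2)]
    by (intro M.submoduleI) auto
qed

context cring
begin

lemma coordinate_ideal:
  assumes K: "submodule K R (free_module R n)" and j: "j < n"
  shows "ideal ((\<lambda>v. v j) ` K) R"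
proof -
  let ?F = "free_module R n"
  note mF = free_module_is_module
  note E = module.submoduleE[OF mF K]
  have c: "v \<in> K \<Longrightarrow> v j \<in> carrier R" for v using E(1) free_module_closed[of v n j] j by blast
  have sm: "a \<otimes> v j \<in> (\<lambda>v. v j) ` K" if "a \<in> carrier R" "v \<in> K" for a v
    using E(4)[OF that] free_module_apply(3)[OF j, of a v] by (metis imageI)
  show ?thesis
  proof (rule idealI)
    show "subgroup ((\<lambda>v. v j) ` K) (add_monoid R)"
    proof
      show "(\<lambda>v. v j) ` K \<subseteq> carrier (add_monoid R)" using c by auto
      show "\<one>\<^bsub>add_monoid R\<^esub> \<in> (\<lambda>v. v j) ` K"
        using submodule_zero[OF mF K] free_module_apply(1)[OF j] by (metis imageI monoid.select_convs(2))
    next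
      fix a a' assume "a \<in> (\<lambda>v. v j) ` K" "a' \<in> (\<lambda>v. v j) ` K"
      then obtain v v' where v: "v \<in> K" "a = v j" "v' \<in> K" "a' = v' j" by blast
      then show "a \<otimes>\<^bsub>add_monoid R\<^esub> a' \<in> (\<lambda>v. v j) ` K"
        using E(5)[of v v'] free_module_apply(2)[OF j, of v v'] by (metis imageI monoid.select_convs(1))
    next
      fix a assume "a \<in> (\<lambda>v. v j) ` K"
      then obtain v where v: "v \<in> K" "a = v j" by blast
      moreover have "v \<in> carrier ?F" using E(1) v(1) by blast
      ultimately show "inv\<^bsub>add_monoid R\<^esub> a \<in> (\<lambda>v. v j) ` K"
        using E(3)[of v] free_module_apply(4)[OF j, of v] by (metis imageI a_inv_def)
    qed
  qed (use sm c ring_axioms m_comm in \<open>auto simp: m_comm\<close>)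
qed

text \<open>
  Coordinates are killed one after the other: the possible values of the last nonzero coordinate
  form an ideal, and correcting that coordinate by generators leaves a smaller problem.
\<close>

lemma noetherian_free_module:
  assumes noeth: "noetherian_ring R" and K: "submodule K R (free_module R n)"
  obtains A where "finite A" "A \<subseteq> K" "\<forall>P. submodule P R (free_module R n) \<and> A \<subseteq> P \<longrightarrow> K \<subseteq> P"
proof -
  let ?F = "free_module R n"
  note mF = free_module_is_module
  have "\<exists>A. finite A \<and> A \<subseteq> K \<and> (\<forall>P. submodule P R ?F \<and> A \<subseteq> P \<longrightarrow> K \<subseteq> P)"
    if "j \<le> n" "submodule K R ?F" "\<And>v k. v \<in> K \<Longrightarrow> j \<le> k \<Longrightarrow> k < n \<Longrightarrow> v k = \<zero>" for j K
    using that
  proof (induction j arbitrary: K)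
    case 0
    have "K \<subseteq> P" if P: "submodule P R ?F" for P
    proof
      fix v assume v: "v \<in> K"
      have "v = \<zero>\<^bsub>?F\<^esub>"
        using v 0(3) module.submoduleE(1)[OF mF 0(2)] module.submoduleE(1)[OF mF P] submodule_zero[OF mF P]
        by (intro free_module_eqI[of _ n]) (auto simp: free_module_apply)
      then show "v \<in> P" using submodule_zero[OF mF P] by simp
    qed
    then show ?case by (intro exI[of _ "{}"]) auto
  next
    case (Suc j)
    note E = module.submoduleE[OF mF Suc.prems(2)]
    have j: "j < n" using Suc.prems(1) by simp
    obtain T where T: "finite T" "T \<subseteq> carrier R" "(\<lambda>v. v j) ` K = Idl T"
      using noetherian_ring.finetely_gen[OF noeth coordinate_ideal[OF Suc.prems(2) j]] by metis
    have "\<forall>t\<in>T. \<exists>v\<in>K. v j = t" using genideal_self[OF T(2)] unfolding T(3)[symmetric] by auto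
    then obtain g where g: "\<And>t. t \<in> T \<Longrightarrow> g t \<in> K" "\<And>t. t \<in> T \<Longrightarrow> g t j = t" by metis
    let ?K' = "{v \<in> K. v j = \<zero>}"
    have K': "submodule ?K' R ?F"
    proof (rule module.submoduleI[OF mF])
      show "?K' \<subseteq> carrier ?F" using E(1) by auto
      show "\<zero>\<^bsub>?F\<^esub> \<in> ?K'" using submodule_zero[OF mF Suc.prems(2)] free_module_apply(1)[OF j] by simp
      show "\<ominus>\<^bsub>?F\<^esub> v \<in> ?K'" if "v \<in> ?K'" for v
        using that E(1,3) free_module_apply(4)[OF j, of v] by auto
      show "v \<oplus>\<^bsub>?F\<^esub> w \<in> ?K'" if "v \<in> ?K'" "w \<in> ?K'" for v w
        using that E(5) free_module_apply(2)[OF j, of v w] by auto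
      show "a \<odot>\<^bsub>?F\<^esub> v \<in> ?K'" if "a \<in> carrier R" "v \<in> ?K'" for a v
        using that E(4) free_module_apply(3)[OF j, of a v] by auto
    qed
    have "v k = \<zero>" if "v \<in> ?K'" "j \<le> k" "k < n" for v k
      using that Suc.prems(3)[of v k] by (cases "k = j") auto
    then obtain A' where A': "finite A'" "A' \<subseteq> ?K'" "\<And>P. submodule P R ?F \<Longrightarrow> A' \<subseteq> P \<Longrightarrow> ?K' \<subseteq> P"
      using Suc.IH[OF _ K'] j by (metis (no_types, lifting) less_imp_le)
    have "K \<subseteq> P" if P: "submodule P R ?F" "A' \<union> g ` T \<subseteq> P" for P
    proof
      fix v assume v: "v \<in> K"
      have KP: "submodule (K \<inter> P) R ?F" by (rule submodule_inter[OF mF Suc.prems(2) P(1)])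
      have "T \<subseteq> (\<lambda>v. v j) ` (K \<inter> P)"
      proof
        fix t assume t: "t \<in> T"
        then have "g t \<in> K \<inter> P" using g(1) P(2) by blast
        then have "g t j \<in> (\<lambda>v. v j) ` (K \<inter> P)" by (rule imageI)
        then show "t \<in> (\<lambda>v. v j) ` (K \<inter> P)" using g(2)[OF t] by simp
      qed
      then have "Idl T \<subseteq> (\<lambda>v. v j) ` (K \<inter> P)" by (rule genideal_minimal[OF coordinate_ideal[OF KP j]])
      then have "v j \<in> (\<lambda>v. v j) ` (K \<inter> P)" using v unfolding T(3)[symmetric] by auto
      then obtain w where w: "w \<in> K" "w \<in> P" "v j = w j" by auto
      have c: "v \<in> carrier ?F" "w \<in> carrier ?F" using v w(1) E(1) by auto
      have "v \<ominus>\<^bsub>?F\<^esub> w \<in> ?K'"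
        using submodule_diff[OF mF Suc.prems(2) v w(1)] free_module_apply(5)[OF j c] w(3)
          free_module_closed[OF c(2) j] by (simp add: minus_eq r_neg)
      then have "v \<ominus>\<^bsub>?F\<^esub> w \<in> P" using A'(3)[OF P(1)] P(2) by blast
      then have "(v \<ominus>\<^bsub>?F\<^esub> w) \<oplus>\<^bsub>?F\<^esub> w \<in> P" using module.submoduleE(5)[OF mF P(1)] w(2) by blast
      then show "v \<in> P"
        by (simp only: abelian_group.diff_add_cancel[OF module.axioms(2)[OF mF] c])
    qed
    moreover have "finite (A' \<union> g ` T)" "A' \<union> g ` T \<subseteq> K" using A'(1,2) T(1) g(1) by auto
    ultimately show ?case by blast
  qed
  from this[of n K] K that show thesis by auto
qed

lemma hom_image_submodule:
  assumes M: "module R M" and N: "module R N" and h: "h \<in> module_homs R M N"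
  shows "submodule (h ` carrier M) R N"
proof -
  interpret M: module R M by fact
  interpret N: module R N by fact
  note [simp] = module_homsD(1)[OF h]
  have i: "h v \<oplus>\<^bsub>N\<^esub> h w \<in> h ` carrier M" "\<ominus>\<^bsub>N\<^esub> h v \<in> h ` carrier M"
    "a \<in> carrier R \<Longrightarrow> a \<odot>\<^bsub>N\<^esub> h v \<in> h ` carrier M"
    if "v \<in> carrier M" "w \<in> carrier M" for a v w
    using module_homsD(2)[OF h that] module_homs_minus[OF M N h that(1)] module_homsD(3)[OF h, of a v] that
    by (metis M.a_closed M.a_inv_closed M.smult_closed imageI)+
  show ?thesis
  proof (rule N.submoduleI)
    show "\<zero>\<^bsub>N\<^esub> \<in> h ` carrier M" using module_homs_zero[OF M N h] by (metis M.zero_closed imageI)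
  qed (use i in auto)
qed

lemma free_cover_exists:
  assumes M: "module R M" and K: "submodule K R M"
    and A: "finite A" "A \<subseteq> K" "\<And>P. submodule P R M \<Longrightarrow> A \<subseteq> P \<Longrightarrow> K \<subseteq> P"
  obtains n h where "h \<in> module_homs R (free_module R n) M" "h ` carrier (free_module R n) = K"
proof -
  note mF = free_module_is_module
  note E = module.submoduleE[OF M K]
  obtain n and g :: "nat \<Rightarrow> 'c" where g: "A = g ` {k. k < n}"
    using finite_imp_nat_seg_image_inj_on[OF A(1)] by blast
  have gK: "k < n \<Longrightarrow> g k \<in> K" for k using g A(2) by blast
  obtain h where h: "h \<in> module_homs R (free_module R n) M" "\<And>k. k < n \<Longrightarrow> h (basis_vec R n k) = g k"
    by (rule free_module_hom_exists[OF M, of n g]) (use gK E(1) in auto)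
  have "h v \<in> K" if "v \<in> carrier (free_module R n)" for v
  proof -
    have "v \<in> vectors n (carrier R)" using that by (simp only: free_module_simps(1))
    then show ?thesis
    proof (rule free_module_induct)
      show "h \<zero>\<^bsub>free_module R n\<^esub> \<in> K"
        using module_homs_zero[OF mF M h(1)] submodule_zero[OF M K] by simp
      show "h (a \<odot>\<^bsub>free_module R n\<^esub> basis_vec R n k) \<in> K" if "a \<in> carrier R" "k < n" for a k
        using module_homsD(3)[OF h(1) that(1) basis_vec_closed] h(2)[OF that(2)] E(4)[OF that(1) gK[OF that(2)]]
        by simp
      show "h (u \<oplus>\<^bsub>free_module R n\<^esub> w) \<in> K"
        if "u \<in> vectors n (carrier R)" "w \<in> vectors n (carrier R)" "h u \<in> K" "h w \<in> K" for u w
        using module_homsD(2)[OF h(1), of u w] that E(5) by (simp add: free_module_simps(1))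
    qed simp_all
  qed
  moreover have "K \<subseteq> h ` carrier (free_module R n)"
  proof (rule A(3)[OF hom_image_submodule[OF mF M h(1)]])
    show "A \<subseteq> h ` carrier (free_module R n)"
    proof
      fix a assume "a \<in> A"
      then obtain k where "k < n" "a = g k" using g by auto
      then have "a = h (basis_vec R n k)" using h(2) by simp
      then show "a \<in> h ` carrier (free_module R n)" using basis_vec_closed by (rule image_eqI)
    qed
  qed
  ultimately show thesis using that[OF h(1)] by blast
qed

text \<open>
  If a relation \<open>v\<close> has a unit as its \<open>k\<close>-th coordinate, the \<open>k\<close>-th generator is a combination of the
  others: subtracting a multiple of \<open>v\<close> makes the \<open>k\<close>-th coordinate of any vector zero.
\<close>

lemma free_cover_drop_generator:
  assumes M: "module R M" and h: "h \<in> module_homs R (free_module R (Suc p)) M"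
    and v: "v \<in> carrier (free_module R (Suc p))" "h v = \<zero>\<^bsub>M\<^esub>"
    and k: "k < Suc p" and z: "z \<in> carrier R" "z \<otimes> v k = \<one>"
  obtains h' where "h' \<in> module_homs R (free_module R p) M"
    "h' ` carrier (free_module R p) = h ` carrier (free_module R (Suc p))"
proof -
  let ?F = "free_module R (Suc p)" and ?F' = "free_module R p"
  note mF = free_module_is_module
  \<comment> \<open>\<open>\<iota>\<close> inserts a zero as the \<open>k\<close>-th coordinate.\<close>
  define \<iota> where "\<iota> u = (\<lambda>i\<in>{..<Suc p}. if i < k then u i else if i = k then \<zero> else u (i - 1))" for u :: "nat \<Rightarrow> 'a"
  have ap: "\<iota> u i = (if i < k then u i else if i = k then \<zero> else u (i - 1))" if "i < Suc p" for u i
    using that by (simp add: \<iota>_def)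
  have idx: "i < k \<Longrightarrow> i < p" "i < Suc p \<Longrightarrow> \<not> i < k \<Longrightarrow> i \<noteq> k \<Longrightarrow> i - 1 < p" for i using k by auto
  have closed: "\<iota> u \<in> carrier ?F" if "u \<in> carrier ?F'" for u
    unfolding \<iota>_def free_module_simps(1)
    by (rule restrict_PiE_iff[THEN iffD2]) (use idx free_module_closed[OF that] in auto)
  have \<iota>: "\<iota> \<in> module_homs R ?F' ?F"
  proof (rule module_homsI)
    fix u w assume u: "u \<in> carrier ?F'" and w: "w \<in> carrier ?F'"
    have uw: "u \<oplus>\<^bsub>?F'\<^esub> w \<in> carrier ?F'" "\<iota> u \<oplus>\<^bsub>?F\<^esub> \<iota> w \<in> carrier ?F"
      using u w closed abelian_monoid.a_closed[OF abelian_group.axioms(1)[OF module.axioms(2)[OF mF]]] by auto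
    show "\<iota> (u \<oplus>\<^bsub>?F'\<^esub> w) = \<iota> u \<oplus>\<^bsub>?F\<^esub> \<iota> w"
      by (rule free_module_eqI[OF closed[OF uw(1)] uw(2)]) (use idx in \<open>simp add: ap free_module_apply\<close>)
  next
    fix a u assume a: "a \<in> carrier R" and u: "u \<in> carrier ?F'"
    have au: "a \<odot>\<^bsub>?F'\<^esub> u \<in> carrier ?F'" "a \<odot>\<^bsub>?F\<^esub> \<iota> u \<in> carrier ?F"
      using a u closed module.smult_closed[OF mF] by auto
    show "\<iota> (a \<odot>\<^bsub>?F'\<^esub> u) = a \<odot>\<^bsub>?F\<^esub> \<iota> u"
      by (rule free_module_eqI[OF closed[OF au(1)] au(2)]) (use idx a in \<open>simp add: ap free_module_apply\<close>)
  qed (rule closed)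
  have "h u \<in> (\<lambda>w. h (\<iota> w)) ` carrier ?F'" if u: "u \<in> carrier ?F" for u
  proof -
    let ?c = "(u k \<otimes> z) \<odot>\<^bsub>?F\<^esub> v" 
    let ?u = "u \<ominus>\<^bsub>?F\<^esub> ?c"
    have uk: "u k \<in> carrier R" "v k \<in> carrier R" using free_module_closed[OF _ k] u v(1) by auto
    have c: "?c \<in> carrier ?F" using module.smult_closed[OF mF] uk z(1) v(1) by blast
    have uc: "?u \<in> carrier ?F" using abelian_group.minus_closed[OF module.axioms(2)[OF mF] u c] .
    have "h ?c = (u k \<otimes> z) \<odot>\<^bsub>M\<^esub> \<zero>\<^bsub>M\<^esub>"
      using module_homsD(3)[OF h, of "u k \<otimes> z" v] uk z(1) v by simp
    then have "h ?c = \<zero>\<^bsub>M\<^esub>" using module.smult_r_null[OF M, of "u k \<otimes> z"] uk z(1) by simp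
    then have hu: "h ?u = h u"
      using module_homs_diff[OF mF M h u c] module_homsD(1)[OF h u]
        abelian_group.diff_zero[OF module.axioms(2)[OF M]] by simp
    have "?u k = u k \<ominus> (u k \<otimes> z) \<otimes> v k" using free_module_apply(5)[OF k u c] free_module_apply(3)[OF k] by simp
    also have "\<dots> = \<zero>" using uk z by (simp add: m_assoc minus_eq r_neg)
    finally have uk0: "?u k = \<zero>" .
    let ?w = "\<lambda>i\<in>{..<p}. if i < k then ?u i else ?u (Suc i)"
    have w: "?w \<in> carrier ?F'"
      unfolding free_module_simps(1)
      by (rule restrict_PiE_iff[THEN iffD2]) (use free_module_closed[OF uc] in auto)
    have "\<iota> ?w = ?u"
    proof (rule free_module_eqI[OF closed[OF w] uc])
      fix i assume i: "i < Suc p"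
      consider "i < k" | "i = k" | "k < i" by linarith
      then show "\<iota> ?w i = ?u i"
        by cases (use i idx uk0 in \<open>auto simp: ap\<close>)
    qed
    then have "h u = h (\<iota> ?w)" using hu by simp
    then show ?thesis using w by (rule image_eqI)
  qed
  then have "(\<lambda>w. h (\<iota> w)) ` carrier ?F' = h ` carrier ?F" using closed by blast
  then show thesis by (rule that[OF module_homs_comp[OF \<iota> h]])
qed

end

text \<open>
  With the least possible number of generators no relation has a unit coordinate.
\<close>

lemma minimal_cover_exists:
  fixes R (structure)
  assumes R: "noetherian_local_ring R" and M: "module R M" and K: "submodule K R M"
    and A: "finite A" "A \<subseteq> K" "\<And>P. submodule P R M \<Longrightarrow> A \<subseteq> P \<Longrightarrow> K \<subseteq> P"
  obtains n h where "h \<in> module_homs R (free_module R n) M" "h ` carrier (free_module R n) = K"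
    "a_kernel (free_module R n) M h \<subseteq> vectors n (max_ideal R)"
proof -
  note D = noetherian_local_ringD[OF R]
  interpret cring R by (rule D)
  define Q where "Q n \<longleftrightarrow> (\<exists>h \<in> module_homs R (free_module R n) M. h ` carrier (free_module R n) = K)" for n
  obtain n' h' where "h' \<in> module_homs R (free_module R n') M" "h' ` carrier (free_module R n') = K"
    by (rule free_cover_exists[OF M K A])
  then have ex: "\<exists>n. Q n" unfolding Q_def by blast
  define n where "n = (LEAST n. Q n)"
  have "Q n" unfolding n_def using ex by (rule LeastI_ex)
  then obtain h where h: "h \<in> module_homs R (free_module R n) M" "h ` carrier (free_module R n) = K"
    unfolding Q_def by (rule bexE)
  have "v \<in> vectors n (max_ideal R)" if "v \<in> a_kernel (free_module R n) M h" for v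
  proof (rule ideal_vectorsI)
    show v: "v \<in> carrier (free_module R n)" using that by (simp add: a_kernel_def')
    fix k assume k: "k < n"
    show "v k \<in> max_ideal R"
    proof (rule ccontr)
      assume "v k \<notin> max_ideal R"
      then obtain z where z: "z \<in> carrier R" "z \<otimes> v k = \<one>"
        using unit_if_not_in_max_ideal[OF R free_module_closed[OF v k]] by metis
      obtain p where p: "n = Suc p" using k by (cases n) auto
      have hv: "h v = \<zero>\<^bsub>M\<^esub>" using that by (simp add: a_kernel_def')
      obtain h' where "h' \<in> module_homs R (free_module R p) M"
        "h' ` carrier (free_module R p) = h ` carrier (free_module R (Suc p))"
        by (rule free_cover_drop_generator[OF M h(1)[unfolded p] v[unfolded p] hv k[unfolded p] z])
      then have "Q p" unfolding Q_def using h(2)[unfolded p] by (intro bexI[of _ h']) simp_all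
      then have "n \<le> p" unfolding n_def by (rule Least_le)
      then show False using p by simp
    qed
  qed
  then show thesis using that[OF h] by blast
qed

text \<open>
  Covering the successive syzygies minimally produces the resolution; the relations of a minimal
  cover are again finitely generated because the ring is noetherian.
\<close>

theorem minimal_free_resolution_exists:
  fixes R (structure)
  assumes R: "noetherian_local_ring R" and fg: "fin_gen_module R M"
  obtains b d e where "minimal_free_resolution R M b d e"
proof -
  note D = noetherian_local_ringD[OF R]
  interpret cring R by (rule D)
  note mF = free_module_is_module
  have M: "module R M" using fg by (simp add: fin_gen_module_def)
  obtain A where A: "finite A" "A \<subseteq> carrier M" "\<forall>P. submodule P R M \<and> A \<subseteq> P \<longrightarrow> P = carrier M"
    using fg unfolding fin_gen_module_def by (elim conjE exE) (rule that)
  obtain b0 e where e: "e \<in> module_homs R (free_module R b0) M" "e ` carrier (free_module R b0) = carrier M"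
    "a_kernel (free_module R b0) M e \<subseteq> vectors b0 (max_ideal R)"
    by (rule minimal_cover_exists[OF R M module.carrier_is_submodule[OF M] A(1,2)]) (use A(3) in auto)
  \<comment> \<open>A state is a rank together with the module of syzygies inside the free module of that rank.\<close>
  define P where "P i s \<longleftrightarrow> submodule (snd s) R (free_module R (fst s)) \<and> snd s \<subseteq> vectors (fst s) (max_ideal R) \<and>
      (i = 0 \<longrightarrow> s = (b0, a_kernel (free_module R b0) M e))" for i :: nat and s
  define Q where "Q s s' \<longleftrightarrow> (\<exists>h. h \<in> module_homs R (free_module R (fst s')) (free_module R (fst s)) \<and>
      h ` carrier (free_module R (fst s')) = snd s \<and>
      a_kernel (free_module R (fst s')) (free_module R (fst s)) h = snd s')" for s s'
  have "\<exists>f. \<forall>i. P i (f i) \<and> Q (f i) (f (Suc i))"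
  proof (rule dependent_nat_choice)
    have "P 0 (b0, a_kernel (free_module R b0) M e)"
      using a_kernel_submodule[OF mF M e(1)] e(3) by (simp add: P_def)
    then show "\<exists>s. P 0 s" by blast
  next
    fix s i assume "P i s"
    then have s: "submodule (snd s) R (free_module R (fst s))" by (simp add: P_def)
    obtain B where B: "finite B" "B \<subseteq> snd s" "\<forall>P. submodule P R (free_module R (fst s)) \<and> B \<subseteq> P \<longrightarrow> snd s \<subseteq> P"
      by (rule noetherian_free_module[OF D(2) s])
    obtain n h where h: "h \<in> module_homs R (free_module R n) (free_module R (fst s))"
      "h ` carrier (free_module R n) = snd s"
      "a_kernel (free_module R n) (free_module R (fst s)) h \<subseteq> vectors n (max_ideal R)"
      by (rule minimal_cover_exists[OF R mF s B(1,2)]) (use B(3) in auto)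
    let ?s = "(n, a_kernel (free_module R n) (free_module R (fst s)) h)"
    have "P (Suc i) ?s" using a_kernel_submodule[OF mF mF h(1)] h(3) by (simp add: P_def)
    moreover have "Q s ?s" unfolding Q_def using h(1,2) by auto
    ultimately show "\<exists>s'. P (Suc i) s' \<and> Q s s'" by blast
  qed
  then obtain f where f: "\<And>i. P i (f i)" "\<And>i. Q (f i) (f (Suc i))" by blast
  define b where "b i = fst (f i)" for i
  have "\<forall>i. \<exists>h. h \<in> module_homs R (free_module R (b (Suc i))) (free_module R (b i)) \<and>
      h ` carrier (free_module R (b (Suc i))) = snd (f i) \<and>
      a_kernel (free_module R (b (Suc i))) (free_module R (b i)) h = snd (f (Suc i))"
    using f(2) unfolding Q_def b_def by simp
  then obtain h where h: "\<And>i. h i \<in> module_homs R (free_module R (b (Suc i))) (free_module R (b i))"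
    "\<And>i. h i ` carrier (free_module R (b (Suc i))) = snd (f i)"
    "\<And>i. a_kernel (free_module R (b (Suc i))) (free_module R (b i)) (h i) = snd (f (Suc i))"
    by metis
  have f0: "b 0 = b0" "snd (f 0) = a_kernel (free_module R b0) M e" using f(1)[of 0] by (simp_all add: P_def b_def)
  have sub: "snd (f i) \<subseteq> vectors (b i) (max_ideal R)" for i using f(1)[of i] by (simp add: P_def b_def)
  have "minimal_free_resolution R M b (\<lambda>i. h (i - 1)) e"
    unfolding minimal_free_resolution_def Let_def ideal_smult_free_module[OF D(4)]
    using h e(1,2) f0 sub by simp
  then show thesis by (rule that)
qed

section \<open>Finiteness of the linearity defect\<close>

lemma Sup_enat_finite_iff: "Sup {enat i | i. P i} \<noteq> \<infinity> \<longleftrightarrow> finite {i. P i}"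
proof -
  have eq: "{enat i | i. P i} = enat ` {i. P i}" by blast
  have fin: "finite {enat i | i. P i} \<longleftrightarrow> finite {i. P i}"
    unfolding eq by (rule finite_image_iff) (simp add: inj_on_def)
  show ?thesis
  proof (cases "{i. P i} = {}")
    case True
    then show ?thesis unfolding Sup_enat_def eq by simp
  next
    case False
    then have ne: "{enat i | i. P i} \<noteq> {}" unfolding eq by simp
    show ?thesis
    proof (cases "finite {i. P i}")
      case True
      then have "Max {enat i | i. P i} \<in> {enat i | i. P i}" using fin ne by (intro Max_in) auto
      then have "Max {enat i | i. P i} \<noteq> \<infinity>" by auto
      moreover have "Sup {enat i | i. P i} = Max {enat i | i. P i}"
        unfolding Sup_enat_def using True fin ne by (simp only: if_False if_True)
      ultimately show ?thesis using True by simp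
    next
      case False
      then show ?thesis using fin ne unfolding Sup_enat_def by simp
    qed
  qed
qed

text \<open>
  The resolution chosen in the definition of the linearity defect may be replaced by any other one.
  Homology in degree zero does not affect finiteness.
\<close>

lemma linearity_defect_finite_iff:
  fixes R (structure)
  assumes R: "noetherian_local_ring R" and M: "module R M" and nz: "carrier M \<noteq> {\<zero>\<^bsub>M\<^esub>}"
    and res: "minimal_free_resolution R M b d e"
  shows "linearity_defect R M \<noteq> \<infinity> \<longleftrightarrow> finite {i. \<not> linear_part_exact R b d i}"
proof -
  note D = noetherian_local_ringD[OF R]
  interpret cring R by (rule D)
  let ?P = "\<lambda>(b, d). \<exists>e. minimal_free_resolution R M b d e"
  obtain b' d' where bd: "(SOME bd. ?P bd) = (b', d')" by (cases "SOME bd. ?P bd")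
  have "?P (b, d)" using res by auto
  then have "?P (SOME bd. ?P bd)" by (rule someI)
  then obtain e' where res': "minimal_free_resolution R M b' d' e'" unfolding bd by auto
  let ?H = "lin_homology R (\<lambda>i. free_module R (b' i)) d'"
  have "carrier (?H (Suc i)) \<noteq> {\<one>\<^bsub>?H (Suc i)\<^esub>} \<longleftrightarrow> \<not> linear_part_exact R b d i" for i
    using minimal_complex.lin_homology_trivial_iff[OF minimal_free_resolutionD(6)[OF D(4) res'], of i]
      iffI[OF linear_part_exact_independent[OF D(4) M res res', of i]
        linear_part_exact_independent[OF D(4) M res' res, of i]]
    by simp
  then have "Suc -` {i. carrier (?H i) \<noteq> {\<one>\<^bsub>?H i\<^esub>}} = {i. \<not> linear_part_exact R b d i}"
    by (simp only: vimage_Collect_eq)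
  then have "finite {i. carrier (?H i) \<noteq> {\<one>\<^bsub>?H i\<^esub>}} \<longleftrightarrow> finite {i. \<not> linear_part_exact R b d i}"
    using finite_vimage_Suc_iff[of "{i. carrier (?H i) \<noteq> {\<one>\<^bsub>?H i\<^esub>}}"] by (simp only:)
  moreover have "linearity_defect R M = Sup {enat i | i. carrier (?H i) \<noteq> {\<one>\<^bsub>?H i\<^esub>}}"
    using nz bd unfolding linearity_defect_def Let_def by simp
  ultimately show ?thesis by (simp only: Sup_enat_finite_iff)
qed


section \<open>Blocks of coordinates\<close>

definition fst_part :: "nat \<Rightarrow> (nat \<Rightarrow> 'a) \<Rightarrow> nat \<Rightarrow> 'a" where
  "fst_part n w = (\<lambda>k\<in>{..<n}. w k)"

definition snd_part :: "nat \<Rightarrow> nat \<Rightarrow> (nat \<Rightarrow> 'a) \<Rightarrow> nat \<Rightarrow> 'a" where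
  "snd_part n m w = (\<lambda>k\<in>{..<m}. w (n + k))"

definition join_parts :: "nat \<Rightarrow> nat \<Rightarrow> (nat \<Rightarrow> 'a) \<Rightarrow> (nat \<Rightarrow> 'a) \<Rightarrow> nat \<Rightarrow> 'a" where
  "join_parts n m u v = (\<lambda>k\<in>{..<n + m}. if k < n then u k else v (k - n))"

lemma parts_vectors:
  "w \<in> vectors (n + m) I \<Longrightarrow> fst_part n w \<in> vectors n I"
  "w \<in> vectors (n + m) I \<Longrightarrow> snd_part n m w \<in> vectors m I"
  "u \<in> vectors n I \<Longrightarrow> v \<in> vectors m I \<Longrightarrow> join_parts n m u v \<in> vectors (n + m) I"
proof -
  show "fst_part n w \<in> vectors n I" if "w \<in> vectors (n + m) I"
    unfolding fst_part_def
    by (rule restrict_PiE_iff[THEN iffD2], rule ballI, rule PiE_mem[OF that]) simp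
  show "snd_part n m w \<in> vectors m I" if "w \<in> vectors (n + m) I"
    unfolding snd_part_def
    by (rule restrict_PiE_iff[THEN iffD2], rule ballI, rule PiE_mem[OF that]) simp
  show "join_parts n m u v \<in> vectors (n + m) I" if uv: "u \<in> vectors n I" "v \<in> vectors m I"
    unfolding join_parts_def
  proof (rule restrict_PiE_iff[THEN iffD2], rule ballI)
    fix k assume "k \<in> {..<n + m}"
    then show "(if k < n then u k else v (k - n)) \<in> I"
      using PiE_mem[OF uv(1), of k] PiE_mem[OF uv(2), of "k - n"] by (cases "k < n") simp_all
  qed
qed

lemma fst_part_join [simp]: "u \<in> vectors n I \<Longrightarrow> fst_part n (join_parts n m u v) = u"
  by (rule PiE_ext[of _ "{..<n}" "\<lambda>_. UNIV"]) (auto simp: fst_part_def join_parts_def PiE_iff)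

lemma snd_part_join [simp]: "v \<in> vectors m I \<Longrightarrow> snd_part n m (join_parts n m u v) = v"
  by (rule PiE_ext[of _ "{..<m}" "\<lambda>_. UNIV"]) (auto simp: snd_part_def join_parts_def PiE_iff)

lemma join_parts_eta: "w \<in> vectors (n + m) I \<Longrightarrow> join_parts n m (fst_part n w) (snd_part n m w) = w"
  by (rule PiE_ext[of _ "{..<n + m}" "\<lambda>_. UNIV"]) (auto simp: fst_part_def snd_part_def join_parts_def PiE_iff)

lemma parts_apply:
  "k < n \<Longrightarrow> fst_part n w k = w k"
  "k < m \<Longrightarrow> snd_part n m w k = w (n + k)"
  "k < n + m \<Longrightarrow> join_parts n m u v k = (if k < n then u k else v (k - n))"
  by (simp_all add: fst_part_def snd_part_def join_parts_def)

context cring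
begin

lemma free_module_closures:
  "\<zero>\<^bsub>free_module R n\<^esub> \<in> carrier (free_module R n)"
  "u \<in> carrier (free_module R n) \<Longrightarrow> v \<in> carrier (free_module R n) \<Longrightarrow> u \<oplus>\<^bsub>free_module R n\<^esub> v \<in> carrier (free_module R n)"
  "u \<in> carrier (free_module R n) \<Longrightarrow> v \<in> carrier (free_module R n) \<Longrightarrow> u \<ominus>\<^bsub>free_module R n\<^esub> v \<in> carrier (free_module R n)"
  "a \<in> carrier R \<Longrightarrow> v \<in> carrier (free_module R n) \<Longrightarrow> a \<odot>\<^bsub>free_module R n\<^esub> v \<in> carrier (free_module R n)"
  using module.smult_closed[OF free_module_is_module] abelian_group.minus_closed[OF module.axioms(2)[OF free_module_is_module]]
    abelian_monoid.zero_closed[OF abelian_group.axioms(1)[OF module.axioms(2)[OF free_module_is_module]]]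
    abelian_monoid.a_closed[OF abelian_group.axioms(1)[OF module.axioms(2)[OF free_module_is_module]]]
  by (assumption | simp only:)+

lemma parts_closed:
  "w \<in> carrier (free_module R (n + m)) \<Longrightarrow> fst_part n w \<in> carrier (free_module R n)"
  "w \<in> carrier (free_module R (n + m)) \<Longrightarrow> snd_part n m w \<in> carrier (free_module R m)"
  "u \<in> carrier (free_module R n) \<Longrightarrow> v \<in> carrier (free_module R m) \<Longrightarrow>
     join_parts n m u v \<in> carrier (free_module R (n + m))"
  unfolding free_module_simps(1) by (erule parts_vectors; assumption?)+

lemma fst_part_hom: "fst_part n \<in> module_homs R (free_module R (n + m)) (free_module R n)"
proof (rule module_homsI)
  note [simp] = free_module_closures parts_closed(1)[where m = m]
  show "fst_part n (u \<oplus>\<^bsub>free_module R (n + m)\<^esub> w) = fst_part n u \<oplus>\<^bsub>free_module R n\<^esub> fst_part n w"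
    if "u \<in> carrier (free_module R (n + m))" "w \<in> carrier (free_module R (n + m))" for u w
    by (rule free_module_eqI[of _ n]) (use that in \<open>simp_all add: parts_apply free_module_apply\<close>)
  show "fst_part n (a \<odot>\<^bsub>free_module R (n + m)\<^esub> w) = a \<odot>\<^bsub>free_module R n\<^esub> fst_part n w"
    if "a \<in> carrier R" "w \<in> carrier (free_module R (n + m))" for a w
    by (rule free_module_eqI[of _ n]) (use that in \<open>simp_all add: parts_apply free_module_apply\<close>)
qed (rule parts_closed(1)[where m = m])

lemma snd_part_hom: "snd_part n m \<in> module_homs R (free_module R (n + m)) (free_module R m)"
proof (rule module_homsI)
  note [simp] = free_module_closures parts_closed(2)
  show "snd_part n m (u \<oplus>\<^bsub>free_module R (n + m)\<^esub> w) = snd_part n m u \<oplus>\<^bsub>free_module R m\<^esub> snd_part n m w"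
    if "u \<in> carrier (free_module R (n + m))" "w \<in> carrier (free_module R (n + m))" for u w
    by (rule free_module_eqI[of _ m]) (use that in \<open>simp_all add: parts_apply free_module_apply\<close>)
  show "snd_part n m (a \<odot>\<^bsub>free_module R (n + m)\<^esub> w) = a \<odot>\<^bsub>free_module R m\<^esub> snd_part n m w"
    if "a \<in> carrier R" "w \<in> carrier (free_module R (n + m))" for a w
    by (rule free_module_eqI[of _ m]) (use that in \<open>simp_all add: parts_apply free_module_apply\<close>)
qed (rule parts_closed(2))

lemma join_parts_hom:
  assumes p: "p \<in> module_homs R M (free_module R n)" and q: "q \<in> module_homs R M (free_module R m)"
  shows "(\<lambda>w. join_parts n m (p w) (q w)) \<in> module_homs R M (free_module R (n + m))"
proof (rule module_homsI)
  note [simp] = module_homsD[OF p] module_homsD[OF q] free_module_closures parts_closed(3)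
  show "join_parts n m (p w) (q w) \<in> carrier (free_module R (n + m))" if "w \<in> carrier M" for w
    using that by simp
  show "join_parts n m (p (u \<oplus>\<^bsub>M\<^esub> w)) (q (u \<oplus>\<^bsub>M\<^esub> w))
      = join_parts n m (p u) (q u) \<oplus>\<^bsub>free_module R (n + m)\<^esub> join_parts n m (p w) (q w)"
    if "u \<in> carrier M" "w \<in> carrier M" for u w
    by (rule free_module_eqI[of _ "n + m"]) (use that in \<open>simp_all add: parts_apply free_module_apply\<close>)
  show "join_parts n m (p (a \<odot>\<^bsub>M\<^esub> w)) (q (a \<odot>\<^bsub>M\<^esub> w))
      = a \<odot>\<^bsub>free_module R (n + m)\<^esub> join_parts n m (p w) (q w)"
    if "a \<in> carrier R" "w \<in> carrier M" for a w
    by (rule free_module_eqI[of _ "n + m"]) (use that in \<open>simp_all add: parts_apply free_module_apply\<close>)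
qed

lemma smult_hom:
  assumes "x \<in> carrier R"
  shows "(\<lambda>v. x \<odot>\<^bsub>free_module R n\<^esub> v) \<in> module_homs R (free_module R n) (free_module R n)"
  using assms module.smult_r_distr[OF free_module_is_module] module.smult_assoc1[OF free_module_is_module, symmetric]
  by (intro module_homsI) (auto simp: free_module_closures m_comm)

lemma zero_hom: "(\<lambda>v. \<zero>\<^bsub>free_module R n\<^esub>) \<in> module_homs R M (free_module R n)"
proof (rule module_homsI)
  note mF = free_module_is_module[of n]
  note am = abelian_group.axioms(1)[OF module.axioms(2)[OF mF]]
  show "\<zero>\<^bsub>free_module R n\<^esub> = \<zero>\<^bsub>free_module R n\<^esub> \<oplus>\<^bsub>free_module R n\<^esub> \<zero>\<^bsub>free_module R n\<^esub>"
    using abelian_monoid.l_zero[OF am free_module_closures(1)] by simp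
  show "\<zero>\<^bsub>free_module R n\<^esub> = a \<odot>\<^bsub>free_module R n\<^esub> \<zero>\<^bsub>free_module R n\<^esub>" if "a \<in> carrier R" for a
    using module.smult_r_null[OF mF that] by simp
qed (rule free_module_closures)

end

section \<open>Reduction modulo a regular element\<close>

definition restrict_scalars :: "('a \<Rightarrow> 's) \<Rightarrow> ('s, 'c, 'm) module_scheme \<Rightarrow> ('a, 'c) module" where
  "restrict_scalars h N =
    \<lparr>carrier = carrier N, monoid.mult = monoid.mult N, monoid.one = monoid.one N,
     ring.zero = ring.zero N, ring.add = ring.add N, module.smult = (\<lambda>r. module.smult N (h r))\<rparr>"

lemma restrict_scalars_simps [simp]:
  "carrier (restrict_scalars h N) = carrier N"
  "ring.zero (restrict_scalars h N) = ring.zero N"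
  "ring.add (restrict_scalars h N) = ring.add N"
  "module.smult (restrict_scalars h N) r = module.smult N (h r)"
  by (simp_all add: restrict_scalars_def)

lemma minus_restrict_scalars [simp]: "a_inv (restrict_scalars h N) = a_inv N"
  by (simp add: a_inv_def fun_eq_iff m_inv_def)

lemma restrict_scalars_homs:
  "h \<in> carrier R \<rightarrow> carrier S \<Longrightarrow> f \<in> module_homs S N P \<Longrightarrow>
    f \<in> module_homs R (restrict_scalars h N) (restrict_scalars h P)"
  by (auto simp: module_homs_def hom_def Pi_iff)

context surjective_ring_hom
begin

lemma restrict_scalars_module:
  assumes "module S N"
  shows "module R (restrict_scalars h N)"
proof -
  interpret N: module S N by fact
  show ?thesis
  proof (rule moduleI)
    show "abelian_group (restrict_scalars h N)"
    proof (rule abelian_groupI)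
      fix u assume "u \<in> carrier (restrict_scalars h N)"
      then show "\<exists>v\<in>carrier (restrict_scalars h N).
          v \<oplus>\<^bsub>restrict_scalars h N\<^esub> u = \<zero>\<^bsub>restrict_scalars h N\<^esub>"
        by (intro bexI[of _ "\<ominus>\<^bsub>N\<^esub> u"]) (simp_all add: N.M.l_neg)
    qed (simp_all add: N.M.a_ac)
  qed (simp_all add: R.is_cring N.smult_l_distr N.smult_r_distr N.smult_assoc1)
qed

lemma restrict_scalars_submodule:
  assumes N: "module S N" and P: "submodule P R (restrict_scalars h N)"
  shows "submodule P S N"
proof -
  note E = module.submoduleE[OF restrict_scalars_module[OF N] P]
  show ?thesis
  proof (rule module.submoduleI[OF N])
    show "P \<subseteq> carrier N" using E(1) by simp
    show "\<zero>\<^bsub>N\<^esub> \<in> P" using submodule_zero[OF restrict_scalars_module[OF N] P] by simp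
    show "\<ominus>\<^bsub>N\<^esub> v \<in> P" if "v \<in> P" for v using E(3)[OF that] by simp
    show "u \<oplus>\<^bsub>N\<^esub> v \<in> P" if "u \<in> P" "v \<in> P" for u v using E(5)[OF that] by simp
    show "a \<odot>\<^bsub>N\<^esub> v \<in> P" if a: "a \<in> carrier S" and v: "v \<in> P" for a v
    proof -
      obtain r where r: "r \<in> carrier R" "a = h r" using a surj by blast
      then show ?thesis using E(4)[OF r(1) v] by simp
    qed
  qed
qed

lemma restrict_scalars_fin_gen:
  assumes "fin_gen_module S N"
  shows "fin_gen_module R (restrict_scalars h N)"
proof -
  have N: "module S N" using assms by (simp add: fin_gen_module_def)
  obtain A where A: "finite A" "A \<subseteq> carrier N" "\<forall>P. submodule P S N \<and> A \<subseteq> P \<longrightarrow> P = carrier N"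
    using assms unfolding fin_gen_module_def by (elim conjE exE) (rule that)
  have "\<forall>P. submodule P R (restrict_scalars h N) \<and> A \<subseteq> P \<longrightarrow> P = carrier (restrict_scalars h N)"
    using A(3) restrict_scalars_submodule[OF N] by simp
  then show ?thesis
    unfolding fin_gen_module_def using A(1,2) restrict_scalars_module[OF N]
    by (intro conjI exI[of _ A]) simp_all
qed

text \<open>Reduction \<open>R\<^sup>n \<rightarrow> S\<^sup>n\<close> of vectors.\<close>

definition red :: "nat \<Rightarrow> (nat \<Rightarrow> 'a) \<Rightarrow> nat \<Rightarrow> 'c" where
  "red n v = (\<lambda>k\<in>{..<n}. h (v k))"

lemma red_apply: "k < n \<Longrightarrow> red n v k = h (v k)"
  by (simp add: red_def)

lemma red_vectors:
  assumes "v \<in> vectors n I"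
  shows "red n v \<in> vectors n (h ` I)"
  unfolding red_def by (rule restrict_PiE_iff[THEN iffD2], rule ballI, rule imageI, rule PiE_mem[OF assms])

lemma red_closed: "v \<in> carrier (free_module R n) \<Longrightarrow> red n v \<in> carrier (free_module S n)"
  using red_vectors[of v n "carrier R"] by (simp only: free_module_simps(1) surj)

lemma red_hom: "red n \<in> module_homs R (free_module R n) (restrict_scalars h (free_module S n))"
proof (rule module_homsI)
  note [simp] = R.free_module_closures S.free_module_closures red_closed red_apply
    R.free_module_apply S.free_module_apply R.free_module_closed
  show "red n v \<in> carrier (restrict_scalars h (free_module S n))" if "v \<in> carrier (free_module R n)" for v
    using that by simp
  show "red n (u \<oplus>\<^bsub>free_module R n\<^esub> v) = red n u \<oplus>\<^bsub>restrict_scalars h (free_module S n)\<^esub> red n v"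
    if "u \<in> carrier (free_module R n)" "v \<in> carrier (free_module R n)" for u v
    by (rule S.free_module_eqI[of _ n]) (use that in simp_all)
  show "red n (a \<odot>\<^bsub>free_module R n\<^esub> v) = a \<odot>\<^bsub>restrict_scalars h (free_module S n)\<^esub> red n v"
    if "a \<in> carrier R" "v \<in> carrier (free_module R n)" for a v
    by (rule S.free_module_eqI[of _ n]) (use that in simp_all)
qed

lemma red_diff:
  assumes "u \<in> carrier (free_module R n)" "v \<in> carrier (free_module R n)"
  shows "red n (u \<ominus>\<^bsub>free_module R n\<^esub> v) = red n u \<ominus>\<^bsub>free_module S n\<^esub> red n v"
  using module_homs_diff[OF R.free_module_is_module restrict_scalars_module[OF S.free_module_is_module] red_hom assms]
  by (simp add: a_minus_def)

lemma red_lift: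
  assumes "u \<in> vectors n (h ` I)"
  obtains v where "v \<in> vectors n I" "red n v = u"
proof -
  have "\<forall>k. \<exists>a. k < n \<longrightarrow> a \<in> I \<and> h a = u k"
  proof
    fix k
    show "\<exists>a. k < n \<longrightarrow> a \<in> I \<and> h a = u k"
    proof (cases "k < n")
      case True
      then have "u k \<in> h ` I" by (intro PiE_mem[OF assms]) simp
      then show ?thesis by (elim imageE) auto
    qed simp
  qed
  from choice[OF this] obtain v where v: "\<forall>k. k < n \<longrightarrow> v k \<in> I \<and> h (v k) = u k" by (rule exE)
  let ?v = "\<lambda>k\<in>{..<n}. v k"
  have "?v \<in> vectors n I" by (rule restrict_PiE_iff[THEN iffD2]) (simp add: v)
  moreover have "red n ?v = u"
    by (rule PiE_ext[of _ "{..<n}" "\<lambda>_. UNIV"]) (use assms v in \<open>auto simp: red_def PiE_iff\<close>)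
  ultimately show thesis by (rule that)
qed

end

text \<open>
  The map \<open>h\<close> is the projection onto \<open>R / (x)\<close>; of the regularity of \<open>x\<close> only its two consequences for
  elements are recorded, cancellation and \<open>(\<mm>\<^sup>p\<^sup>+\<^sup>1 : x) = \<mm>\<^sup>p\<close>.
\<close>

locale regular_section = surjective_ring_hom R S h for R (structure) and S (structure) and h +
  fixes x
  assumes local: "noetherian_local_ring R"
    and x_in_max: "x \<in> max_ideal R"
    and x_cancel: "r \<in> carrier R \<Longrightarrow> x \<otimes> r = \<zero> \<Longrightarrow> r = \<zero>"
    and x_colon: "r \<in> carrier R \<Longrightarrow> x \<otimes> r \<in> ideal_pow R (max_ideal R) (Suc p) \<Longrightarrow>
      r \<in> ideal_pow R (max_ideal R) p"
    and hx: "h x = \<zero>\<^bsub>S\<^esub>"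
    and kernel: "r \<in> carrier R \<Longrightarrow> h r = \<zero>\<^bsub>S\<^esub> \<Longrightarrow> \<exists>s\<in>carrier R. r = x \<otimes> s"
begin

abbreviation "F n \<equiv> free_module R n"
abbreviation "FS n \<equiv> free_module S n"
abbreviation "pw p \<equiv> ideal_pow R (max_ideal R) p"

lemmas max_is_ideal = noetherian_local_ringD(4)[OF local]
lemmas pw_ideal = R.ideal_pow_ideal[OF max_is_ideal]
lemmas F_module = R.free_module_is_module
lemmas F_group = module.axioms(2)[OF F_module]
lemmas FS_module = S.free_module_is_module

lemma x_closed: "x \<in> carrier R"
  using ideal.Icarr[OF max_is_ideal x_in_max] .

lemma x_in_pw: "x \<in> pw (Suc 0)"
  using x_in_max R.ideal_pow_Suc0[OF max_is_ideal] by simp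

lemma section_local: "noetherian_local_ring S" and max_ideal_section: "max_ideal S = h ` max_ideal R"
proof -
  have ker: "r \<in> max_ideal R" if "r \<in> carrier R" "h r = \<zero>\<^bsub>S\<^esub>" for r
    using kernel[OF that] ideal.I_r_closed[OF max_is_ideal x_in_max] by auto
  show "noetherian_local_ring S" "max_ideal S = h ` max_ideal R" using local_image[OF local ker] by auto
qed

lemma ideal_pow_section: "ideal_pow S (max_ideal S) p = h ` pw p"
  unfolding max_ideal_section by (rule image_ideal_pow[OF max_is_ideal, symmetric])

lemma scaled_vectors_cancel:
  assumes u: "u \<in> carrier (F n)" and xu: "x \<odot>\<^bsub>F n\<^esub> u = \<zero>\<^bsub>F n\<^esub>"
  shows "u = \<zero>\<^bsub>F n\<^esub>"
proof (rule R.free_module_eqI[OF u R.free_module_closures(1)])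
  fix k assume k: "k < n"
  have "x \<otimes> u k = \<zero>" using xu R.free_module_apply(1,3)[OF k] by metis
  then show "u k = \<zero>\<^bsub>F n\<^esub> k"
    using x_cancel[OF R.free_module_closed[OF u k]] R.free_module_apply(1)[OF k] by simp
qed

lemma scaled_vectors_inj:
  assumes u: "u \<in> carrier (F n)" and v: "v \<in> carrier (F n)" and eq: "x \<odot>\<^bsub>F n\<^esub> u = x \<odot>\<^bsub>F n\<^esub> v"
  shows "u = v"
proof -
  have "x \<odot>\<^bsub>F n\<^esub> (u \<ominus>\<^bsub>F n\<^esub> v) = \<zero>\<^bsub>F n\<^esub>"
    using module_homs_diff[OF F_module F_module R.smult_hom[OF x_closed] u v] eq
      abelian_group.diff_eq_zero_iff[OF F_group R.free_module_closures(4)[OF x_closed v] R.free_module_closures(4)[OF x_closed v]] by simp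
  then have "u \<ominus>\<^bsub>F n\<^esub> v = \<zero>\<^bsub>F n\<^esub>"
    by (rule scaled_vectors_cancel[OF R.free_module_closures(3)[OF u v]])
  then show ?thesis using abelian_group.diff_eq_zero_iff[OF F_group u v] by simp
qed

lemma scaled_vectors_colon:
  assumes u: "u \<in> carrier (F n)" and xu: "x \<odot>\<^bsub>F n\<^esub> u \<in> vectors n (pw (Suc p))"
  shows "u \<in> vectors n (pw p)"
proof (rule R.ideal_vectorsI[OF u])
  fix k assume k: "k < n"
  have "x \<otimes> u k \<in> pw (Suc p)" using PiE_mem[OF xu, of k] k R.free_module_apply(3)[OF k] by simp
  then show "u k \<in> pw p" by (rule x_colon[OF R.free_module_closed[OF u k]])
qed

text \<open>
  In each coordinate, two elements of \<open>R\<close> with the same image in \<open>S\<close> differ by a multiple of \<open>x\<close>.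
\<close>

lemma red_preimage:
  assumes v: "v \<in> carrier (F n)" and I: "ideal I R" and rv: "red n v \<in> vectors n (h ` I)"
  obtains y u where "y \<in> vectors n I" "u \<in> carrier (F n)" "v = y \<oplus>\<^bsub>F n\<^esub> x \<odot>\<^bsub>F n\<^esub> u"
proof -
  obtain y where y: "y \<in> vectors n I" "red n y = red n v" by (rule red_lift[OF rv])
  have yc: "y \<in> carrier (F n)" using y(1) R.ideal_vectors_subset[OF I] by blast
  have "\<forall>k. \<exists>r. k < n \<longrightarrow> r \<in> carrier R \<and> v k \<ominus> y k = x \<otimes> r"
  proof (intro allI)
    fix k
    show "\<exists>r. k < n \<longrightarrow> r \<in> carrier R \<and> v k \<ominus> y k = x \<otimes> r"
    proof (cases "k < n")
      case True
      note c = R.free_module_closed[OF v True] R.free_module_closed[OF yc True]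
      have "h (v k) = h (y k)" using y(2) red_apply[OF True] by metis
      then have "h (v k \<ominus> y k) = \<zero>\<^bsub>S\<^esub>" using c by (simp add: R.minus_eq S.r_neg)
      then show ?thesis using kernel[of "v k \<ominus> y k"] c by auto
    qed simp
  qed
  from choice[OF this] obtain u where u: "\<forall>k. k < n \<longrightarrow> u k \<in> carrier R \<and> v k \<ominus> y k = x \<otimes> u k" by (rule exE)
  let ?u = "\<lambda>k\<in>{..<n}. u k"
  have uc: "?u \<in> carrier (F n)"
    unfolding free_module_simps(1) by (rule restrict_PiE_iff[THEN iffD2]) (simp add: u)
  have "v = y \<oplus>\<^bsub>F n\<^esub> x \<odot>\<^bsub>F n\<^esub> ?u"
  proof (rule R.free_module_eqI[OF v])
    show "y \<oplus>\<^bsub>F n\<^esub> x \<odot>\<^bsub>F n\<^esub> ?u \<in> carrier (F n)"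
      by (intro R.free_module_closures x_closed yc uc)
    fix k assume k: "k < n"
    note c = R.free_module_closed[OF v k] R.free_module_closed[OF yc k]
    have "v k = y k \<oplus> (v k \<ominus> y k)" using c by algebra
    also have "\<dots> = y k \<oplus> x \<otimes> u k" using u k by simp
    finally show "v k = (y \<oplus>\<^bsub>F n\<^esub> x \<odot>\<^bsub>F n\<^esub> ?u) k"
      using k by (simp add: R.free_module_apply)
  qed
  with y(1) uc show thesis by (rule that)
qed

lemma red_zero_preimage:
  assumes v: "v \<in> carrier (F n)" and rv: "red n v = \<zero>\<^bsub>FS n\<^esub>"
  obtains u where "u \<in> carrier (F n)" "v = x \<odot>\<^bsub>F n\<^esub> u"
proof -
  have "\<zero>\<^bsub>FS n\<^esub> \<in> vectors n (h ` {\<zero>})"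
    unfolding free_module_simps by (rule restrict_PiE_iff[THEN iffD2]) simp
  then have "red n v \<in> vectors n (h ` {\<zero>})" unfolding rv .
  then obtain y u where yu: "y \<in> vectors n {\<zero>}" "u \<in> carrier (F n)" "v = y \<oplus>\<^bsub>F n\<^esub> x \<odot>\<^bsub>F n\<^esub> u"
    by (rule red_preimage[OF v R.zeroideal])
  have "y = \<zero>\<^bsub>F n\<^esub>"
  proof (rule R.free_module_eqI[OF _ R.free_module_closures(1)])
    show "y \<in> carrier (F n)" using yu(1) R.ideal_vectors_subset[OF R.zeroideal] by blast
    show "y k = \<zero>\<^bsub>F n\<^esub> k" if "k < n" for k
      using PiE_mem[OF yu(1), of k] that R.free_module_apply(1)[OF that] by simp
  qed
  then have "v = x \<odot>\<^bsub>F n\<^esub> u"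
    using yu(3) abelian_monoid.l_zero[OF abelian_group.axioms(1)[OF F_group] R.free_module_closures(4)[OF x_closed yu(2)]]
    by simp
  with yu(2) show thesis by (rule that)
qed

lemma red_scaled:
  assumes u: "u \<in> carrier (F n)"
  shows "red n (x \<odot>\<^bsub>F n\<^esub> u) = \<zero>\<^bsub>FS n\<^esub>"
  using module_homsD(3)[OF red_hom x_closed u] hx module.smult_l_null[OF FS_module red_closed[OF u]] by simp

end

section \<open>Lifting a resolution\<close>

text \<open>
  Over the resolution \<open>(b, d, e)\<close> of \<open>M\<close>, the map \<open>dl i\<close> lifts \<open>d (i + 1)\<close>, and \<open>c i\<close> stands for the rank
  in degree \<open>i - 1\<close>.  The map \<open>dl' i\<close> is the lift that starts one degree lower, the zero map for
  \<open>i = 0\<close>; with it the formula for \<open>D\<close> is the same in every degree.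
\<close>

locale lifted_resolution = regular_section +
  fixes M b d e c dl dl' t
  assumes M: "module S M" and res: "minimal_free_resolution S M b d e"
    and c_0: "c 0 = (0::nat)" and c_Suc: "c (Suc i) = b i"
    and dl_hom: "dl i \<in> module_homs R (F (b (Suc i))) (F (b i))"
    and red_dl: "v \<in> carrier (F (b (Suc i))) \<Longrightarrow> red (b i) (dl i v) = d (Suc i) (red (b (Suc i)) v)"
    and dl'_hom: "dl' i \<in> module_homs R (F (b i)) (F (c i))"
    and dl'_Suc: "dl' (Suc i) = dl i"
    and t_hom: "t i \<in> module_homs R (F (b (Suc i))) (F (c i))"
    and xt: "v \<in> carrier (F (b (Suc i))) \<Longrightarrow> x \<odot>\<^bsub>F (c i)\<^esub> t i v = dl' i (dl i v)"
begin

abbreviation "D\<^sub>1 i g u \<equiv> dl i g \<ominus>\<^bsub>F (b i)\<^esub> x \<odot>\<^bsub>F (b i)\<^esub> u"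
abbreviation "D\<^sub>2 i g u \<equiv> t i g \<ominus>\<^bsub>F (c i)\<^esub> dl' i u"

text \<open>
  The differential from degree \<open>i + 1\<close> to degree \<open>i\<close> of the resolution over \<open>R\<close>.
\<close>

definition D :: "nat \<Rightarrow> (nat \<Rightarrow> 'a) \<Rightarrow> nat \<Rightarrow> 'a" where
  "D i w = (let g = fst_part (b (Suc i)) w; u = snd_part (b (Suc i)) (b i) w in
     join_parts (b i) (c i) (D\<^sub>1 i g u) (D\<^sub>2 i g u))"

definition aug where
  "aug w = e (red (b 0) (fst_part (b 0) w))"

lemmas resD = S.minimal_free_resolutionD[OF noetherian_local_ringD(4)[OF section_local] res]
lemmas closures = R.free_module_closures(3) R.free_module_closures(4)[OF x_closed]
  module_homsD(1)[OF dl_hom] module_homsD(1)[OF dl'_hom] module_homsD(1)[OF t_hom]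

lemma D_closed:
  assumes w: "w \<in> carrier (F (b (Suc i) + b i))"
  shows "D i w \<in> carrier (F (b i + c i))"
  unfolding D_def Let_def
  by (intro R.parts_closed(3) closures R.parts_closed(1)[OF w] R.parts_closed(2)[OF w])

lemma D_hom: "D i \<in> module_homs R (F (b (Suc i) + b i)) (F (b i + c i))"
proof -
  have eq: "D i = (\<lambda>w. join_parts (b i) (c i)
      (dl i (fst_part (b (Suc i)) w) \<ominus>\<^bsub>F (b i)\<^esub> x \<odot>\<^bsub>F (b i)\<^esub> snd_part (b (Suc i)) (b i) w)
      (t i (fst_part (b (Suc i)) w) \<ominus>\<^bsub>F (c i)\<^esub> dl' i (snd_part (b (Suc i)) (b i) w)))"
    unfolding D_def Let_def by (rule refl)
  note f = R.fst_part_hom[of "b (Suc i)" "b i"] and s = R.snd_part_hom[of "b (Suc i)" "b i"]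
  show ?thesis unfolding eq
    by (intro R.join_parts_hom module_homs_sub F_module module_homs_comp[OF f dl_hom] module_homs_comp[OF f t_hom]
        module_homs_comp[OF s dl'_hom] module_homs_comp[OF s R.smult_hom[OF x_closed]])
qed

lemma D_parts:
  assumes w: "w \<in> carrier (F (b (Suc i) + b i))"
  defines "g \<equiv> fst_part (b (Suc i)) w" and "u \<equiv> snd_part (b (Suc i)) (b i) w"
  shows "fst_part (b i) (D i w) = D\<^sub>1 i g u"
    and "snd_part (b i) (c i) (D i w) = D\<^sub>2 i g u"
proof -
  have gu: "g \<in> carrier (F (b (Suc i)))" "u \<in> carrier (F (b i))"
    unfolding g_def u_def using R.parts_closed(1,2)[OF w] by auto
  show "fst_part (b i) (D i w) = D\<^sub>1 i g u"
    unfolding D_def Let_def g_def[symmetric] u_def[symmetric]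
    by (rule fst_part_join[of _ _ "carrier R"]) (fold free_module_simps(1), intro closures gu)
  show "snd_part (b i) (c i) (D i w) = D\<^sub>2 i g u"
    unfolding D_def Let_def g_def[symmetric] u_def[symmetric]
    by (rule snd_part_join[of _ _ "carrier R"]) (fold free_module_simps(1), intro closures gu)
qed

lemma parts_eqI:
  assumes "w \<in> carrier (F (n + m))" "w' \<in> carrier (F (n + m))"
    "fst_part n w = fst_part n w'" "snd_part n m w = snd_part n m w'"
  shows "w = w'"
proof -
  have "w = join_parts n m (fst_part n w) (snd_part n m w)"
    by (rule join_parts_eta[OF assms(1)[unfolded free_module_simps(1)], symmetric])
  also have "\<dots> = w'"
    unfolding assms(3,4) by (rule join_parts_eta[OF assms(2)[unfolded free_module_simps(1)]])
  finally show ?thesis .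
qed

lemma parts_zero:
  "fst_part n \<zero>\<^bsub>F (n + m)\<^esub> = \<zero>\<^bsub>F n\<^esub>" "snd_part n m \<zero>\<^bsub>F (n + m)\<^esub> = \<zero>\<^bsub>F m\<^esub>"
  by (rule module_homs_zero[OF F_module F_module R.fst_part_hom], rule module_homs_zero[OF F_module F_module R.snd_part_hom])

text \<open>
  Multiplied by \<open>x\<close>, the second component of \<open>D i w\<close> is the image under \<open>dl'\<close> of the first one.
  So the second component vanishes together with the first, and its depth is controlled by it.
\<close>

lemma scaled_second_component:
  assumes g: "g \<in> carrier (F (b (Suc i)))" and u: "u \<in> carrier (F (b i))"
  shows "x \<odot>\<^bsub>F (c i)\<^esub> (D\<^sub>2 i g u) = dl' i (D\<^sub>1 i g u)"
proof -
  note c = closures g u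
  have "x \<odot>\<^bsub>F (c i)\<^esub> (D\<^sub>2 i g u) = x \<odot>\<^bsub>F (c i)\<^esub> t i g \<ominus>\<^bsub>F (c i)\<^esub> x \<odot>\<^bsub>F (c i)\<^esub> dl' i u"
    by (rule module_homs_diff[OF F_module F_module R.smult_hom[OF x_closed]]) (intro c)+
  also have "\<dots> = dl' i (dl i g) \<ominus>\<^bsub>F (c i)\<^esub> dl' i (x \<odot>\<^bsub>F (b i)\<^esub> u)"
    by (simp only: xt[OF g] module_homsD(3)[OF dl'_hom x_closed u])
  also have "\<dots> = dl' i (D\<^sub>1 i g u)"
    by (rule module_homs_diff[OF F_module F_module dl'_hom, symmetric]) (intro c)+
  finally show ?thesis .
qed

lemma D_zero_iff:
  assumes w: "w \<in> carrier (F (b (Suc i) + b i))"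
  defines "g \<equiv> fst_part (b (Suc i)) w" and "u \<equiv> snd_part (b (Suc i)) (b i) w"
  shows "D i w = \<zero>\<^bsub>F (b i + c i)\<^esub> \<longleftrightarrow> dl i g = x \<odot>\<^bsub>F (b i)\<^esub> u"
proof -
  have gu: "g \<in> carrier (F (b (Suc i)))" "u \<in> carrier (F (b i))"
    unfolding g_def u_def using R.parts_closed(1,2)[OF w] by auto
  note parts = D_parts[OF w, folded g_def u_def]
  have first: "D\<^sub>1 i g u = \<zero>\<^bsub>F (b i)\<^esub> \<longleftrightarrow> dl i g = x \<odot>\<^bsub>F (b i)\<^esub> u"
    by (rule abelian_group.diff_eq_zero_iff[OF F_group]) (intro closures gu)+
  show ?thesis
  proof
    assume "D i w = \<zero>\<^bsub>F (b i + c i)\<^esub>"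
    then show "dl i g = x \<odot>\<^bsub>F (b i)\<^esub> u" using parts(1) parts_zero(1) first by simp
  next
    assume "dl i g = x \<odot>\<^bsub>F (b i)\<^esub> u"
    then have z: "D\<^sub>1 i g u = \<zero>\<^bsub>F (b i)\<^esub>" using first by simp
    have "D\<^sub>2 i g u = \<zero>\<^bsub>F (c i)\<^esub>"
    proof (rule scaled_vectors_cancel)
      show "D\<^sub>2 i g u \<in> carrier (F (c i))" by (intro closures gu)
      show "x \<odot>\<^bsub>F (c i)\<^esub> (D\<^sub>2 i g u) = \<zero>\<^bsub>F (c i)\<^esub>"
        unfolding scaled_second_component[OF gu] z by (rule module_homs_zero[OF F_module F_module dl'_hom])
    qed
    then show "D i w = \<zero>\<^bsub>F (b i + c i)\<^esub>"
      by (intro parts_eqI[OF D_closed[OF w] R.free_module_closures(1)]) (simp_all only: parts_zero parts z)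
  qed
qed

lemma D_D:
  assumes w: "w \<in> carrier (F (b (Suc (Suc i)) + b (Suc i)))"
  shows "D i (D (Suc i) w) = \<zero>\<^bsub>F (b i + c i)\<^esub>"
proof -
  let ?g = "fst_part (b (Suc (Suc i))) w" and ?u = "snd_part (b (Suc (Suc i))) (b (Suc i)) w"
  have gu: "?g \<in> carrier (F (b (Suc (Suc i))))" "?u \<in> carrier (F (b (Suc i)))"
    using R.parts_closed(1,2)[OF w] by auto
  have Dw: "D (Suc i) w \<in> carrier (F (b (Suc i) + b i))" using D_closed[OF w] by (simp only: c_Suc)
  show ?thesis
    unfolding D_zero_iff[OF Dw] D_parts[OF w, unfolded c_Suc] dl'_Suc
    using scaled_second_component[OF gu] by (simp only: c_Suc dl'_Suc)
qed

lemma red_D: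
  assumes w: "w \<in> carrier (F (b (Suc i) + b i))"
  shows "red (b i) (fst_part (b i) (D i w)) = d (Suc i) (red (b (Suc i)) (fst_part (b (Suc i)) w))"
proof -
  let ?g = "fst_part (b (Suc i)) w" and ?u = "snd_part (b (Suc i)) (b i) w"
  have gu: "?g \<in> carrier (F (b (Suc i)))" "?u \<in> carrier (F (b i))" using R.parts_closed(1,2)[OF w] by auto
  have "red (b i) (fst_part (b i) (D i w)) = red (b i) (dl i ?g) \<ominus>\<^bsub>FS (b i)\<^esub> \<zero>\<^bsub>FS (b i)\<^esub>"
    unfolding D_parts(1)[OF w] red_scaled[OF gu(2), symmetric]
    by (rule red_diff) (intro closures gu)+
  also have "\<dots> = d (Suc i) (red (b (Suc i)) ?g)"
    unfolding red_dl[OF gu(1)]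
    by (rule abelian_group.diff_zero[OF module.axioms(2)[OF FS_module] module_homsD(1)[OF resD(1) red_closed[OF gu(1)]]])
  finally show ?thesis .
qed

text \<open>
  A vector that is a boundary modulo \<open>x\<close> is \<open>dl h'\<close> up to a multiple of \<open>x\<close>, and this multiple is
  what the second coordinate block of \<open>w\<close> contributes.
\<close>

lemma preimage_of_boundary:
  assumes g: "g \<in> carrier (F (b i))" and g': "g' \<in> carrier (FS (b (Suc i)))"
    and eq: "red (b i) g = d (Suc i) g'"
  obtains w where "w \<in> carrier (F (b (Suc i) + b i))" "fst_part (b i) (D i w) = g"
proof -
  obtain h' where h': "h' \<in> carrier (F (b (Suc i)))" "red (b (Suc i)) h' = g'"
    using red_lift[of g' "b (Suc i)" "carrier R"] g' by (auto simp: free_module_simps(1) surj)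
  have c: "dl i h' \<ominus>\<^bsub>F (b i)\<^esub> g \<in> carrier (F (b i))" by (intro closures h'(1) g)
  have dc: "dl i h' \<in> carrier (F (b i))" by (intro closures h'(1))
  have "red (b i) (dl i h' \<ominus>\<^bsub>F (b i)\<^esub> g) = \<zero>\<^bsub>FS (b i)\<^esub>"
    unfolding red_diff[OF dc g] red_dl[OF h'(1)] h'(2) eq[symmetric]
    using abelian_group.diff_eq_zero_iff[OF module.axioms(2)[OF FS_module] red_closed[OF g] red_closed[OF g]] by simp
  then obtain u where u: "u \<in> carrier (F (b i))" "dl i h' \<ominus>\<^bsub>F (b i)\<^esub> g = x \<odot>\<^bsub>F (b i)\<^esub> u"
    by (rule red_zero_preimage[OF c])
  let ?w = "join_parts (b (Suc i)) (b i) h' u"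
  have w: "?w \<in> carrier (F (b (Suc i) + b i))" by (rule R.parts_closed(3)[OF h'(1) u(1)])
  have "fst_part (b i) (D i ?w) = dl i h' \<ominus>\<^bsub>F (b i)\<^esub> (dl i h' \<ominus>\<^bsub>F (b i)\<^esub> g)"
    unfolding D_parts(1)[OF w] u(2) using h'(1) u(1)
    by (simp add: free_module_simps(1))
  also have "\<dots> = g"
    by (rule abelian_group.add_diff_cancel(3)[OF F_group dc g])
  finally show thesis using w by (intro that)
qed

lemma vectors_max_if_red_max:
  assumes v: "v \<in> carrier (F n)" and rv: "red n v \<in> vectors n (h ` max_ideal R)"
  shows "v \<in> vectors n (max_ideal R)"
proof -
  obtain y u where yu: "y \<in> vectors n (max_ideal R)" "u \<in> carrier (F n)" "v = y \<oplus>\<^bsub>F n\<^esub> x \<odot>\<^bsub>F n\<^esub> u"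
    by (rule red_preimage[OF v max_is_ideal rv])
  have "x \<odot>\<^bsub>F n\<^esub> u \<in> vectors n (max_ideal R)"
    unfolding free_module_simps
    by (rule restrict_PiE_iff[THEN iffD2])
      (use ideal.I_r_closed[OF max_is_ideal x_in_max] R.free_module_closed[OF yu(2)] in simp)
  then show ?thesis unfolding yu(3) by (rule R.ideal_vectors_closed(1)[OF max_is_ideal yu(1)])
qed

lemma dl_min: "dl i ` carrier (F (b (Suc i))) \<subseteq> vectors (b i) (max_ideal R)"
proof (rule image_subsetI, rule vectors_max_if_red_max)
  fix v assume v: "v \<in> carrier (F (b (Suc i)))"
  show "dl i v \<in> carrier (F (b i))" by (intro closures v)
  show "red (b i) (dl i v) \<in> vectors (b i) (h ` max_ideal R)"
    unfolding red_dl[OF v] max_ideal_section[symmetric]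
    using minimal_complex.d_min[OF resD(6), of i] red_closed[OF v] by blast
qed

lemma dl'_min: "dl' i ` carrier (F (b i)) \<subseteq> vectors (c i) (max_ideal R)"
proof (cases i)
  case 0
  have "dl' 0 v \<in> vectors (c 0) (max_ideal R)" if "v \<in> carrier (F (b 0))" for v
    using module_homsD(1)[OF dl'_hom that] by (simp add: c_0 free_module_simps(1))
  then show ?thesis using 0 by blast
next
  case (Suc j)
  then show ?thesis using dl_min[of j] by (simp only: dl'_Suc c_Suc)
qed

lemma hom_raises:
  assumes f: "f \<in> module_homs R (F n) (F n')" and f_min: "f ` carrier (F n) \<subseteq> vectors n' (max_ideal R)"
    and v: "v \<in> vectors n (pw p)"
  shows "f v \<in> vectors n' (pw (Suc p))"
proof (rule R.module_homs_ideal_vectors[OF f pw_ideal pw_ideal f_min _ v])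
  fix a a' assume "a \<in> pw p" "a' \<in> max_ideal R"
  then show "a \<otimes> a' \<in> pw (Suc p)"
    using R.ideal_pow_mult[OF max_is_ideal, of a p a' "Suc 0"] R.ideal_pow_Suc0[OF max_is_ideal] by simp
qed

lemma smult_raises:
  assumes v: "v \<in> vectors n (pw p)"
  shows "x \<odot>\<^bsub>F n\<^esub> v \<in> vectors n (pw (Suc p))"
  unfolding free_module_simps
proof (rule restrict_PiE_iff[THEN iffD2], rule ballI)
  fix k assume "k \<in> {..<n}"
  then have "v k \<in> pw p" by (rule PiE_mem[OF v])
  then show "x \<otimes> v k \<in> pw (Suc p)" using R.ideal_pow_mult[OF max_is_ideal x_in_pw, of "v k" p] by simp
qed

text \<open>
  Minimality of \<open>D\<close>, and its compatibility with the filtration.  The second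
  component is bounded after multiplication by \<open>x\<close>, since \<open>t\<close> is controlled only through \<open>x t\<close>.
\<close>

lemma D_raises:
  assumes w: "w \<in> vectors (b (Suc i) + b i) (pw p)"
  shows "D i w \<in> vectors (b i + c i) (pw (Suc p))"
proof -
  let ?g = "fst_part (b (Suc i)) w" and ?u = "snd_part (b (Suc i)) (b i) w"
  have gu: "?g \<in> vectors (b (Suc i)) (pw p)" "?u \<in> vectors (b i) (pw p)" using parts_vectors(1,2)[OF w] by auto
  have guc: "?g \<in> carrier (F (b (Suc i)))" "?u \<in> carrier (F (b i))"
    using gu R.ideal_vectors_subset[OF pw_ideal] by blast+
  have 1: "D\<^sub>1 i ?g ?u \<in> vectors (b i) (pw (Suc p))"
    by (intro R.ideal_vectors_closed(2)[OF pw_ideal] hom_raises[OF dl_hom dl_min gu(1)] smult_raises[OF gu(2)])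
  have "D\<^sub>2 i ?g ?u \<in> vectors (c i) (pw (Suc p))"
  proof (rule scaled_vectors_colon)
    show "D\<^sub>2 i ?g ?u \<in> carrier (F (c i))" by (intro closures guc)
    show "x \<odot>\<^bsub>F (c i)\<^esub> (D\<^sub>2 i ?g ?u) \<in> vectors (c i) (pw (Suc (Suc p)))"
      unfolding scaled_second_component[OF guc] by (rule hom_raises[OF dl'_hom dl'_min 1])
  qed
  with 1 show ?thesis unfolding D_def Let_def by (rule parts_vectors(3))
qed

text \<open>
  A cycle \<open>w\<close> has a first component that is a cycle modulo \<open>x\<close>, hence that of some \<open>D w'\<close>.  The
  second components agree as well, since both become \<open>dl\<close> of the common first component when
  multiplied by \<open>x\<close>.
\<close>

theorem lifted_minimal_free_resolution:
  "minimal_free_resolution R (restrict_scalars h M) (\<lambda>i. b i + c i) (\<lambda>i. D (i - 1)) aug"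
proof -
  note N = restrict_scalars_module[OF M]
  have hom: "D i \<in> module_homs R (F (b (Suc i) + c (Suc i))) (F (b i + c i))" for i
    using D_hom[of i] by (simp only: c_Suc)
  have hmap: "h \<in> carrier R \<rightarrow> carrier S" by simp
  have aug_hom: "aug \<in> module_homs R (F (b 0 + c 0)) (restrict_scalars h M)"
  proof -
    have "aug = (\<lambda>w. e (red (b 0) (fst_part (b 0) w)))" by (rule ext) (simp only: aug_def)
    then show ?thesis
      using module_homs_comp[OF module_homs_comp[OF R.fst_part_hom red_hom] restrict_scalars_homs[OF hmap resD(2)]]
      by (simp only:)
  qed
  have w0: "w = w'" if "w \<in> carrier (F (b 0 + c 0))" "w' \<in> carrier (F (b 0 + c 0))"
    "fst_part (b 0) w = fst_part (b 0) w'" for w w'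
  proof (rule parts_eqI[OF that])
    show "snd_part (b 0) (c 0) w = snd_part (b 0) (c 0) w'" unfolding snd_part_def c_0 by (rule restrict_ext) simp
  qed
  have surj_aug: "aug ` carrier (F (b 0 + c 0)) = carrier (restrict_scalars h M)"
  proof
    show "aug ` carrier (F (b 0 + c 0)) \<subseteq> carrier (restrict_scalars h M)"
      using module_homsD(1)[OF aug_hom] by (rule image_subsetI)
    show "carrier (restrict_scalars h M) \<subseteq> aug ` carrier (F (b 0 + c 0))"
    proof
      fix y assume "y \<in> carrier (restrict_scalars h M)"
      then have "y \<in> e ` carrier (FS (b 0))" using resD(3) by simp
      then obtain v where v: "v \<in> carrier (FS (b 0))" "y = e v" by (elim imageE)
      obtain g where g: "g \<in> carrier (F (b 0))" "red (b 0) g = v"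
        using red_lift[of v "b 0" "carrier R"] v(1) by (auto simp: free_module_simps(1) surj)
      have "aug (join_parts (b 0) (c 0) g \<zero>\<^bsub>F (c 0)\<^esub>) = y"
        unfolding aug_def using g v(2) fst_part_join[of g "b 0" "carrier R"] by (simp add: free_module_simps(1))
      then show "y \<in> aug ` carrier (F (b 0 + c 0))"
        using R.parts_closed(3)[OF g(1) R.free_module_closures(1)] by (metis imageI)
    qed
  qed
  have ex0: "D 0 ` carrier (F (b (Suc 0) + b 0)) = a_kernel (F (b 0 + c 0)) (restrict_scalars h M) aug"
  proof
    show "D 0 ` carrier (F (b (Suc 0) + b 0)) \<subseteq> a_kernel (F (b 0 + c 0)) (restrict_scalars h M) aug"
    proof (rule image_subsetI)
      fix w assume w: "w \<in> carrier (F (b (Suc 0) + b 0))"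
      have "red (b 0) (fst_part (b 0) (D 0 w)) \<in> a_kernel (FS (b 0)) M e"
        using red_closed[OF R.parts_closed(1)[OF w]] unfolding resD(4)[symmetric] red_D[OF w] by (rule imageI)
      then show "D 0 w \<in> a_kernel (F (b 0 + c 0)) (restrict_scalars h M) aug"
        using D_closed[OF w] by (simp add: a_kernel_def' aug_def)
    qed
    show "a_kernel (F (b 0 + c 0)) (restrict_scalars h M) aug \<subseteq> D 0 ` carrier (F (b (Suc 0) + b 0))"
    proof
      fix w assume "w \<in> a_kernel (F (b 0 + c 0)) (restrict_scalars h M) aug"
      then have w: "w \<in> carrier (F (b 0 + c 0))" "e (red (b 0) (fst_part (b 0) w)) = \<zero>\<^bsub>M\<^esub>"
        by (auto simp: a_kernel_def' aug_def)
      have g: "fst_part (b 0) w \<in> carrier (F (b 0))" by (rule R.parts_closed(1)[OF w(1)])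
      have "red (b 0) (fst_part (b 0) w) \<in> d (Suc 0) ` carrier (FS (b (Suc 0)))"
        unfolding resD(4) using red_closed[OF g] w(2) by (simp add: a_kernel_def')
      then obtain g' where g': "g' \<in> carrier (FS (b (Suc 0)))" "red (b 0) (fst_part (b 0) w) = d (Suc 0) g'"
        by (elim imageE)
      obtain w' where w': "w' \<in> carrier (F (b (Suc 0) + b 0))" "fst_part (b 0) (D 0 w') = fst_part (b 0) w"
        by (rule preimage_of_boundary[OF g g'])
      have "w = D 0 w'" by (rule w0[OF w(1) D_closed[OF w'(1)] w'(2)[symmetric]])
      then show "w \<in> D 0 ` carrier (F (b (Suc 0) + b 0))" using w'(1) by (rule image_eqI)
    qed
  qed
  have ex: "D (Suc i) ` carrier (F (b (Suc (Suc i)) + b (Suc i))) = a_kernel (F (b (Suc i) + b i)) (F (b i + c i)) (D i)"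
    for i
  proof
    show "D (Suc i) ` carrier (F (b (Suc (Suc i)) + b (Suc i))) \<subseteq> a_kernel (F (b (Suc i) + b i)) (F (b i + c i)) (D i)"
    proof (rule image_subsetI)
      fix w assume w: "w \<in> carrier (F (b (Suc (Suc i)) + b (Suc i)))"
      show "D (Suc i) w \<in> a_kernel (F (b (Suc i) + b i)) (F (b i + c i)) (D i)"
        using D_closed[OF w] D_D[OF w] by (simp add: a_kernel_def' c_Suc)
    qed
    show "a_kernel (F (b (Suc i) + b i)) (F (b i + c i)) (D i) \<subseteq> D (Suc i) ` carrier (F (b (Suc (Suc i)) + b (Suc i)))"
    proof
      fix w assume "w \<in> a_kernel (F (b (Suc i) + b i)) (F (b i + c i)) (D i)"
      then have w: "w \<in> carrier (F (b (Suc i) + b i))" "D i w = \<zero>\<^bsub>F (b i + c i)\<^esub>" by (auto simp: a_kernel_def')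
      let ?g = "fst_part (b (Suc i)) w" and ?u = "snd_part (b (Suc i)) (b i) w"
      have gu: "?g \<in> carrier (F (b (Suc i)))" "?u \<in> carrier (F (b i))" using R.parts_closed(1,2)[OF w(1)] by auto
      have dg: "dl i ?g = x \<odot>\<^bsub>F (b i)\<^esub> ?u" using w(2) D_zero_iff[OF w(1)] by simp
      have "d (Suc i) (red (b (Suc i)) ?g) = \<zero>\<^bsub>FS (b i)\<^esub>"
        unfolding red_dl[OF gu(1), symmetric] dg by (rule red_scaled[OF gu(2)])
      then have "red (b (Suc i)) ?g \<in> d (Suc (Suc i)) ` carrier (FS (b (Suc (Suc i))))"
        unfolding resD(5) using red_closed[OF gu(1)] by (simp add: a_kernel_def')
      then obtain g' where g': "g' \<in> carrier (FS (b (Suc (Suc i))))" "red (b (Suc i)) ?g = d (Suc (Suc i)) g'"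
        by (elim imageE)
      obtain w' where w': "w' \<in> carrier (F (b (Suc (Suc i)) + b (Suc i)))" "fst_part (b (Suc i)) (D (Suc i) w') = ?g"
        by (rule preimage_of_boundary[OF gu(1) g'])
      have Dw': "D (Suc i) w' \<in> carrier (F (b (Suc i) + b i))" using D_closed[OF w'(1)] by (simp only: c_Suc)
      have "dl i (fst_part (b (Suc i)) (D (Suc i) w')) = x \<odot>\<^bsub>F (b i)\<^esub> snd_part (b (Suc i)) (b i) (D (Suc i) w')"
        using D_zero_iff[OF Dw'] D_D[OF w'(1)] by simp
      then have "x \<odot>\<^bsub>F (b i)\<^esub> ?u = x \<odot>\<^bsub>F (b i)\<^esub> snd_part (b (Suc i)) (b i) (D (Suc i) w')"
        unfolding w'(2) dg .
      then have "?u = snd_part (b (Suc i)) (b i) (D (Suc i) w')"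
        by (rule scaled_vectors_inj[OF gu(2) R.parts_closed(2)[OF Dw']])
      then have "w = D (Suc i) w'" by (rule parts_eqI[OF w(1) Dw' w'(2)[symmetric]])
      then show "w \<in> D (Suc i) ` carrier (F (b (Suc (Suc i)) + b (Suc i)))" using w'(1) by (rule image_eqI)
    qed
  qed
  have min: "D i ` carrier (F (b (Suc i) + b i)) \<subseteq> vectors (b i + c i) (max_ideal R)" for i
    using D_raises[of _ i 0] R.ideal_pow_Suc0[OF max_is_ideal] by (auto simp: free_module_simps(1))
  show ?thesis
    unfolding minimal_free_resolution_def Let_def R.ideal_smult_free_module[OF max_is_ideal]
    using hom aug_hom surj_aug ex0 ex min by (simp add: c_Suc)
qed

text \<open>
  A cycle \<open>a\<close> of the linear part over \<open>S\<close> lifts to a vector \<open>g\<close> with \<open>dl g = y + x u\<close>, where \<open>y\<close> is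
  deep enough.  Since \<open>x u\<close> lies one step deeper than \<open>g\<close>, the vector \<open>u\<close> is as deep as \<open>g\<close>, and
  \<open>(g, u)\<close> is a cycle of the linear part over \<open>R\<close>.  It bounds there, and reduction modulo \<open>x\<close> of
  the first component shows that \<open>a\<close> bounds.
\<close>

theorem linear_part_exact_section:
  assumes ex: "linear_part_exact R (\<lambda>i. b i + c i) (\<lambda>i. D (i - 1)) i"
  shows "linear_part_exact S b d i"
  unfolding linear_part_exact_def ideal_pow_section
proof (intro allI ballI impI)
  fix n a assume a: "a \<in> vectors (b (Suc i)) (h ` pw (n - Suc i))"
    and da: "d (Suc i) a \<in> vectors (b i) (h ` pw (Suc n - i))"
  let ?goal = "\<exists>c'\<in>vectors (b (Suc (Suc i))) (h ` pw (n - Suc (Suc i))).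
      a \<ominus>\<^bsub>FS (b (Suc i))\<^esub> d (Suc (Suc i)) c' \<in> vectors (b (Suc i)) (h ` pw (Suc n - Suc i))"
  obtain g where g: "g \<in> vectors (b (Suc i)) (pw (n - Suc i))" "red (b (Suc i)) g = a" by (rule red_lift[OF a])
  have gc: "g \<in> carrier (F (b (Suc i)))" using g(1) R.ideal_vectors_subset[OF pw_ideal] by blast
  show ?goal
  proof (cases "Suc i \<le> n")
    case False
    have all: "vectors k (h ` pw 0) = carrier (FS k)" for k by (simp add: free_module_simps(1) surj)
    have n: "n - Suc i = 0" "n - Suc (Suc i) = 0" "Suc n - Suc i = 0" using False by auto
    have "a \<ominus>\<^bsub>FS (b (Suc i))\<^esub> d (Suc (Suc i)) \<zero>\<^bsub>FS (b (Suc (Suc i)))\<^esub> \<in> carrier (FS (b (Suc i)))"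
      using a unfolding n all
      by (intro S.free_module_closures(3) module_homsD(1)[OF resD(1)] S.free_module_closures(1))
    then show ?thesis unfolding n all using S.free_module_closures(1) by (rule bexI)
  next
    case True
    define p where "p = n - Suc i"
    have np: "n - Suc i = p" "Suc n - i = Suc (Suc p)" "Suc n - Suc i = Suc p" using True by (auto simp: p_def)
    note g = g[unfolded np(1)]
    have up: "vectors k (pw (Suc (Suc p))) \<subseteq> vectors k (pw (Suc p))" for k
      by (intro PiE_mono R.ideal_pow_antimono[OF max_is_ideal]) simp
    have dg: "dl i g \<in> vectors (b i) (pw (Suc p))" by (rule hom_raises[OF dl_hom dl_min g(1)])
    have dgc: "dl i g \<in> carrier (F (b i))" by (intro closures gc)
    have "red (b i) (dl i g) \<in> vectors (b i) (h ` pw (Suc (Suc p)))"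
      unfolding red_dl[OF gc] g(2) using da unfolding np .
    then obtain y u where yu: "y \<in> vectors (b i) (pw (Suc (Suc p)))" "u \<in> carrier (F (b i))"
      "dl i g = y \<oplus>\<^bsub>F (b i)\<^esub> x \<odot>\<^bsub>F (b i)\<^esub> u"
      by (rule red_preimage[OF dgc pw_ideal])
    have yc: "y \<in> carrier (F (b i))" using yu(1) R.ideal_vectors_subset[OF pw_ideal] by blast
    have xu: "x \<odot>\<^bsub>F (b i)\<^esub> u \<in> carrier (F (b i))" by (intro closures yu)
    have y: "D\<^sub>1 i g u = y" "dl i g \<ominus>\<^bsub>F (b i)\<^esub> y = x \<odot>\<^bsub>F (b i)\<^esub> u"
      unfolding yu(3) by (rule abelian_group.add_diff_cancel[OF F_group yc xu])+
    have "x \<odot>\<^bsub>F (b i)\<^esub> u \<in> vectors (b i) (pw (Suc p))"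
      unfolding y(2)[symmetric] by (rule R.ideal_vectors_closed(2)[OF pw_ideal dg subsetD[OF up yu(1)]])
    then have u: "u \<in> vectors (b i) (pw p)" by (rule scaled_vectors_colon[OF yu(2)])
    define w where "w = join_parts (b (Suc i)) (b i) g u"
    have w: "w \<in> vectors (b (Suc i) + b i) (pw p)" unfolding w_def by (rule parts_vectors(3)[OF g(1) u])
    have wc: "w \<in> carrier (F (b (Suc i) + b i))" using w R.ideal_vectors_subset[OF pw_ideal] by blast
    have wp: "fst_part (b (Suc i)) w = g" "snd_part (b (Suc i)) (b i) w = u"
      unfolding w_def by (rule fst_part_join[OF g(1)], rule snd_part_join[OF u])
    have "D\<^sub>2 i g u \<in> vectors (c i) (pw (Suc (Suc p)))"
    proof (rule scaled_vectors_colon)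
      show "D\<^sub>2 i g u \<in> carrier (F (c i))" by (intro closures gc yu)
      show "x \<odot>\<^bsub>F (c i)\<^esub> (D\<^sub>2 i g u) \<in> vectors (c i) (pw (Suc (Suc (Suc p))))"
        unfolding scaled_second_component[OF gc yu(2)] y(1) by (rule hom_raises[OF dl'_hom dl'_min yu(1)])
    qed
    then have Dw: "D i w \<in> vectors (b i + c i) (pw (Suc (Suc p)))"
      unfolding D_def Let_def wp y(1) by (rule parts_vectors(3)[OF yu(1)])
    obtain v where v: "v \<in> vectors (b (Suc (Suc i)) + b (Suc i)) (pw (n - Suc (Suc i)))"
      "w \<ominus>\<^bsub>F (b (Suc i) + b i)\<^esub> D (Suc i) v \<in> vectors (b (Suc i) + b i) (pw (Suc p))"
      using ex[unfolded linear_part_exact_def, THEN spec[of _ n]] w Dw unfolding np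
      by (auto simp: c_Suc)
    have vc: "v \<in> carrier (F (b (Suc (Suc i)) + b (Suc i)))" using v(1) R.ideal_vectors_subset[OF pw_ideal] by blast
    have Dvc: "D (Suc i) v \<in> carrier (F (b (Suc i) + b i))" using D_closed[OF vc] by (simp only: c_Suc)
    let ?v = "red (b (Suc (Suc i))) (fst_part (b (Suc (Suc i))) v)"
    have "red (b (Suc i)) (fst_part (b (Suc i)) (w \<ominus>\<^bsub>F (b (Suc i) + b i)\<^esub> D (Suc i) v))
        = red (b (Suc i)) (fst_part (b (Suc i)) w) \<ominus>\<^bsub>FS (b (Suc i))\<^esub> red (b (Suc i)) (fst_part (b (Suc i)) (D (Suc i) v))"
      unfolding module_homs_diff[OF F_module F_module R.fst_part_hom wc Dvc]
      by (rule red_diff[OF R.parts_closed(1)[OF wc] R.parts_closed(1)[OF Dvc]])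
    also have "\<dots> = a \<ominus>\<^bsub>FS (b (Suc i))\<^esub> d (Suc (Suc i)) ?v" unfolding wp g(2) red_D[OF vc] ..
    finally have "a \<ominus>\<^bsub>FS (b (Suc i))\<^esub> d (Suc (Suc i)) ?v \<in> vectors (b (Suc i)) (h ` pw (Suc p))"
      using red_vectors[OF parts_vectors(1)[OF v(2)]] by simp
    moreover have "?v \<in> vectors (b (Suc (Suc i))) (h ` pw (n - Suc (Suc i)))"
      by (rule red_vectors[OF parts_vectors(1)[OF v(1)]])
    ultimately show ?thesis unfolding np by (rule bexI)
  qed
qed

end

section \<open>Descent of absolute Koszulness\<close>

lemma (in regular_section) lifted_resolution_exists:
  assumes M: "module S M" and res: "minimal_free_resolution S M b d e"
  obtains c dl dl' t where "lifted_resolution R S h x M b d e c dl dl' t"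
proof -
  note resD = S.minimal_free_resolutionD[OF noetherian_local_ringD(4)[OF section_local] res]
  have hmap: "h \<in> carrier R \<rightarrow> carrier S" by simp
  have "\<exists>f. f \<in> module_homs R (F (b (Suc i))) (F (b i)) \<and>
      (\<forall>v \<in> carrier (F (b (Suc i))). red (b i) (f v) = d (Suc i) (red (b (Suc i)) v))" for i
  proof -
    note N = restrict_scalars_module[OF FS_module]
    have dred: "(\<lambda>v. d (Suc i) (red (b (Suc i)) v)) \<in> module_homs R (F (b (Suc i))) (restrict_scalars h (FS (b i)))"
      by (rule module_homs_comp[OF red_hom restrict_scalars_homs[OF hmap resD(1)]])
    have "red (b i) ` carrier (F (b i)) = carrier (FS (b i))"
    proof
      show "red (b i) ` carrier (F (b i)) \<subseteq> carrier (FS (b i))" by (rule image_subsetI) (rule red_closed)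
      show "carrier (FS (b i)) \<subseteq> red (b i) ` carrier (F (b i))"
      proof
        fix u assume "u \<in> carrier (FS (b i))"
        then have "u \<in> vectors (b i) (h ` carrier R)" by (simp only: free_module_simps(1) surj)
        then obtain v where "v \<in> vectors (b i) (carrier R)" "red (b i) v = u" by (rule red_lift)
        then show "u \<in> red (b i) ` carrier (F (b i))" by (auto simp: free_module_simps(1))
      qed
    qed
    then have "(\<lambda>v. d (Suc i) (red (b (Suc i)) v)) ` carrier (F (b (Suc i))) \<subseteq> red (b i) ` carrier (F (b i))"
      using module_homsD(1)[OF resD(1)] red_closed by (simp add: image_subset_iff)
    then obtain f where f: "f \<in> module_homs R (F (b (Suc i))) (F (b i))"
      "\<And>v. v \<in> carrier (F (b (Suc i))) \<Longrightarrow> red (b i) (f v) = d (Suc i) (red (b (Suc i)) v)"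
      using R.free_module_lift[OF N F_module dred red_hom] by metis
    then show ?thesis by (intro exI[of _ f]) simp
  qed
  then have "\<forall>i. \<exists>f. f \<in> module_homs R (F (b (Suc i))) (F (b i)) \<and>
      (\<forall>v \<in> carrier (F (b (Suc i))). red (b i) (f v) = d (Suc i) (red (b (Suc i)) v))" by (rule allI)
  from choice[OF this] obtain dl where dl: "\<forall>i. dl i \<in> module_homs R (F (b (Suc i))) (F (b i)) \<and>
      (\<forall>v \<in> carrier (F (b (Suc i))). red (b i) (dl i v) = d (Suc i) (red (b (Suc i)) v))" by (rule exE)
  define c where "c i = (case i of 0 \<Rightarrow> 0 | Suc j \<Rightarrow> b j)" for i
  define dl' where "dl' i = (case i of 0 \<Rightarrow> (\<lambda>v. \<zero>\<^bsub>F 0\<^esub>) | Suc j \<Rightarrow> dl j)" for i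
  have c: "c 0 = 0" "c (Suc i) = b i" for i by (simp_all add: c_def)
  have dl'_Suc: "dl' (Suc i) = dl i" for i by (simp add: dl'_def)
  have dl': "dl' i \<in> module_homs R (F (b i)) (F (c i))" for i
    using dl R.zero_hom[of 0] by (cases i) (simp_all add: dl'_def c)
  have "\<exists>f. f \<in> module_homs R (F (b (Suc i))) (F (c i)) \<and>
      (\<forall>v \<in> carrier (F (b (Suc i))). x \<odot>\<^bsub>F (c i)\<^esub> f v = dl' i (dl i v))" for i
  proof -
    have dl_i: "dl i \<in> module_homs R (F (b (Suc i))) (F (b i))" for i using dl by simp
    have comp: "(\<lambda>v. dl' i (dl i v)) \<in> module_homs R (F (b (Suc i))) (F (c i))"
      by (rule module_homs_comp[OF dl_i dl'])
    have "dl' i (dl i v) \<in> (\<lambda>w. x \<odot>\<^bsub>F (c i)\<^esub> w) ` carrier (F (c i))" if v: "v \<in> carrier (F (b (Suc i)))" for v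
    proof -
      have dlv: "dl i v \<in> carrier (F (b i))" by (rule module_homsD(1)[OF dl_i v])
      have dc: "dl' i (dl i v) \<in> carrier (F (c i))" by (rule module_homsD(1)[OF dl' dlv])
      have "red (c i) (dl' i (dl i v)) = \<zero>\<^bsub>FS (c i)\<^esub>"
      proof (cases i)
        case 0
        show ?thesis unfolding 0 c(1) by (rule S.free_module_eqI[OF red_closed S.free_module_closures(1)])
          (use dc in \<open>simp_all add: 0 c\<close>)
      next
        case (Suc j)
        have "red (b j) (dl j (dl (Suc j) v)) = d (Suc j) (d (Suc (Suc j)) (red (b (Suc (Suc j))) v))"
          using dl v dlv unfolding Suc by simp
        moreover have "d (Suc (Suc j)) (red (b (Suc (Suc j))) v) \<in> a_kernel (FS (b (Suc j))) (FS (b j)) (d (Suc j))"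
          unfolding resD(5)[symmetric] by (rule imageI, rule red_closed) (use v in \<open>simp add: Suc\<close>)
        ultimately show ?thesis unfolding Suc dl'_Suc c by (simp add: a_kernel_def')
      qed
      then obtain u where "u \<in> carrier (F (c i))" "dl' i (dl i v) = x \<odot>\<^bsub>F (c i)\<^esub> u"
        by (rule red_zero_preimage[OF dc])
      then show ?thesis by (intro image_eqI)
    qed
    then have "(\<lambda>v. dl' i (dl i v)) ` carrier (F (b (Suc i))) \<subseteq> (\<lambda>w. x \<odot>\<^bsub>F (c i)\<^esub> w) ` carrier (F (c i))"
      by (rule image_subsetI)
    then obtain f where "f \<in> module_homs R (F (b (Suc i))) (F (c i))"
      "\<And>v. v \<in> carrier (F (b (Suc i))) \<Longrightarrow> x \<odot>\<^bsub>F (c i)\<^esub> f v = dl' i (dl i v)"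
      using R.free_module_lift[OF F_module F_module comp R.smult_hom[OF x_closed]] by metis
    then show ?thesis by (intro exI[of _ f]) simp
  qed
  then have "\<forall>i. \<exists>f. f \<in> module_homs R (F (b (Suc i))) (F (c i)) \<and>
      (\<forall>v \<in> carrier (F (b (Suc i))). x \<odot>\<^bsub>F (c i)\<^esub> f v = dl' i (dl i v))" by (rule allI)
  from choice[OF this] obtain t where t: "\<forall>i. t i \<in> module_homs R (F (b (Suc i))) (F (c i)) \<and>
      (\<forall>v \<in> carrier (F (b (Suc i))). x \<odot>\<^bsub>F (c i)\<^esub> t i v = dl' i (dl i v))" by (rule exE)
  have "lifted_resolution R S h x M b d e c dl dl' t"
    by (intro lifted_resolution.intro lifted_resolution_axioms.intro regular_section_axioms M res c dl' dl'_Suc)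
      (use dl t in simp_all)
  then show thesis by (rule that)
qed

theorem (in regular_section) linearity_defect_section_finite:
  assumes ak: "absolutely_koszul R" and fg: "fin_gen_module S M"
  shows "linearity_defect S M \<noteq> \<infinity>"
proof (cases "carrier M = {\<zero>\<^bsub>M\<^esub>}")
  case True
  then show ?thesis by (simp add: linearity_defect_def)
next
  case False
  have M: "module S M" using fg by (simp add: fin_gen_module_def)
  let ?N = "restrict_scalars h M"
  obtain b d e where res: "minimal_free_resolution S M b d e"
    by (rule minimal_free_resolution_exists[OF section_local fg])
  obtain c dl dl' t where "lifted_resolution R S h x M b d e c dl dl' t"
    by (rule lifted_resolution_exists[OF M res])
  then interpret L: lifted_resolution R S h x M b d e c dl dl' t .
  have "linearity_defect R ?N \<noteq> \<infinity>"
    by (rule absolutely_koszulD[OF ak restrict_scalars_fin_gen[OF fg]])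
  moreover have "carrier ?N \<noteq> {\<zero>\<^bsub>?N\<^esub>}" using False by simp
  ultimately have "finite {i. \<not> linear_part_exact R (\<lambda>i. b i + c i) (\<lambda>i. L.D (i - 1)) i}"
    using linearity_defect_finite_iff[OF local restrict_scalars_module[OF M] _ L.lifted_minimal_free_resolution]
    by simp
  then have "finite {i. \<not> linear_part_exact S b d i}"
    by (rule rev_finite_subset) (use L.linear_part_exact_section in blast)
  then show ?thesis using linearity_defect_finite_iff[OF section_local M False res] by simp
qed

lemma regular_section_quotient:
  fixes R (structure)
  assumes R: "noetherian_local_ring R" and x: "x \<in> max_ideal R"
    and reg: "nonzerodivisor (assoc_graded_ring R (max_ideal R)) (degree_one_class R (max_ideal R) x)"
  shows "regular_section R (R Quot PIdl x) (\<lambda>r. PIdl x +> r) x"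
proof -
  note D = noetherian_local_ringD[OF R]
  interpret cring R by (rule D)
  have xc: "x \<in> carrier R" using ideal.Icarr[OF D(4) x] .
  note I = cgenideal_ideal[OF xc]
  have hom: "ring_hom_cring R (R Quot PIdl x) (\<lambda>r. PIdl x +> r)"
    by (rule ideal.rcos_ring_hom_cring[OF I is_cring])
  have zero: "\<zero>\<^bsub>R Quot PIdl x\<^esub> = PIdl x" by (simp add: FactRing_def)
  show ?thesis
  proof (intro regular_section.intro surjective_ring_hom.intro hom surjective_ring_hom_axioms.intro
      regular_section_axioms.intro)
    show "(\<lambda>r. PIdl x +> r) ` carrier R = carrier (R Quot PIdl x)"
      by (auto simp: FactRing_def A_RCOSETS_def' a_r_coset_def')
    show "noetherian_local_ring R" "x \<in> max_ideal R" by fact+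
    show "r = \<zero>" if "r \<in> carrier R" "x \<otimes> r = \<zero>" for r
      by (rule regular_initial_form_imp_cancel[OF R x reg that])
    show "r \<in> ideal_pow R (max_ideal R) p"
      if "r \<in> carrier R" "x \<otimes> r \<in> ideal_pow R (max_ideal R) (Suc p)" for r p
      by (rule regular_initial_form_colon[OF D(4) x reg that])
    have "abelian_subgroup (PIdl x) R"
      using abelian_subgroupI3[OF ideal.axioms(1)[OF I] is_abelian_group] .
    then show "PIdl x +> x = \<zero>\<^bsub>R Quot PIdl x\<^esub>"
      unfolding zero by (rule abelian_subgroup.a_rcos_const[OF _ cgenideal_self[OF xc]])
    fix r assume r: "r \<in> carrier R" "PIdl x +> r = \<zero>\<^bsub>R Quot PIdl x\<^esub>"
    then have "r \<in> PIdl x" unfolding zero by (intro ideal.rcos_const_imp_mem[OF I])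
    then obtain s where "s \<in> carrier R" "r = s \<otimes> x" unfolding cgenideal_def by auto
    then show "\<exists>s\<in>carrier R. r = x \<otimes> s" using xc m_comm by auto
  qed
qed

theorem corollary5p6:
  fixes R :: "('a, 'r) ring_scheme" and x :: 'a
  assumes "noetherian_local_ring R"
    and "absolutely_koszul R"
    and "x \<in> max_ideal R - ideal_pow R (max_ideal R) 2"
    and "nonzerodivisor (assoc_graded_ring R (max_ideal R)) (degree_one_class R (max_ideal R) x)"
  shows "absolutely_koszul (R Quot PIdl\<^bsub>R\<^esub> x)"
proof -
  interpret regular_section R "R Quot PIdl\<^bsub>R\<^esub> x" "\<lambda>r. PIdl\<^bsub>R\<^esub> x +>\<^bsub>R\<^esub> r" x
    using assms by (intro regular_section_quotient) auto
  show ?thesis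
    unfolding absolutely_koszul_def
    using section_local linearity_defect_section_finite[OF assms(2)] by auto
qed

end
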